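(* Let $[\alpha]_{K\times K}\in\mathcal A_{\mathrm{SLS}}$ and let $\pi=(i_1\to i_2\to\cdots\to i_M)$ be any cycle. Then for every GDoF tuple $(d_k)_{k\in[K]}$ in the GDoF region of the $K$ user MISO BC, and for every $m\in[M]$ (with $i_{M+1}=i_1$), $$\sum_{k\in\{\pi\}}d_k\le\Delta_\pi+\alpha_{i_{m+1}i_m}.$$ Furthermore, $\sum_{k\in\{\pi\}}d_k\le\Delta_\pi+\mathcal D_{\Sigma,\mathrm{TINA}}$.
   Context: Channel model: for $k\in[K]$, $Y_k(t)=\sum_{i=1}^K \bar P^{\alpha_{ki}}G_{ki}(t)X_i(t)+Z_k(t)$, $\bar P=\sqrt P$, unit power constraints on $X_i(t)\in\mathbb C$, $Z_k(t)$ zero-mean unit-variance complex AWGN, $\alpha_{ki}\ge0$ known to all. $G_{ki}(t)$ are known perfectly at receivers and only to finite precision at transmitters (transmitters know only a distribution with joint/conditional densities bounded by a constant independent of $P$, magnitudes bounded above and away from zero independently of $P$; transmitted symbols are independent of the channel realizations). In the $K$ user MISO broadcast channel (BC), $K$ independent messages (message $k$ for Receiver $k$) are jointly encoded by all $K$ transmitters. GDoF region: $\{(d_k): d_k=\lim_{P\to\infty}R_k(P)/\log P\text{ for achievable }(R_k(P))\}$. SLS regime: $\mathcal A_{\mathrm{SLS}}=\{[\alpha]\in\mathbb R_+^{K\times K}:\ \alpha_{ii}\ge\max(\alpha_{ij},\alpha_{ki},\alpha_{ik}+\alpha_{ji}-\alpha_{jk})\ \forall i,j,k\in[K],\ i\notin\{j,k\}\}$.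 Cycles: a cycle $\pi=(i_1\to\cdots\to i_M)$, $M\ge1$, is an ordered list of distinct indices of $[K]$, read cyclically; $\{\pi\}$ its set; $\Pi$ the set of all cycles. $\delta_{ij}=\alpha_{ii}-\alpha_{ji}$ ($i\neq j$), $\delta_{ii}=0$; $\Delta_\pi=\sum_{m=1}^M\delta_{i_mi_{m+1}}$ if $M>1$, $\Delta_\pi=\alpha_{i_1i_1}$ if $M=1$. For $S\subseteq[K]$, $\mathcal D_{\mathrm{P\text{-}TIN}}(S)=\{(d_k)_{k\in[K]}: d_k=0\ (k\notin S),\ d_k\ge0\ (k\in S),\ \sum_{k\in\{\pi\}}d_k\le\Delta_\pi\ \forall \pi\in\Pi,\ \{\pi\}\subseteq S\}$; $\mathcal D_{\mathrm{TINA}}=\bigcup_{S\subseteq[K]}\mathcal D_{\mathrm{P\text{-}TIN}}(S)$ and $\mathcal D_{\Sigma,\mathrm{TINA}}$ is its maximum coordinate sum. *)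

theory Defs
  imports "HOL-Probability.Probability"
begin

text \<open>Users are indexed by [K] = {1..K}. The channel strength matrix is alpha k i
  (receiver k, transmitter i).\<close>

definition SLS :: "nat \<Rightarrow> (nat \<Rightarrow> nat \<Rightarrow> real) \<Rightarrow> bool" where
  "SLS K \<alpha> \<longleftrightarrow>
     (\<forall>k\<in>{1..K}. \<forall>i\<in>{1..K}. 0 \<le> \<alpha> k i) \<and>
     (\<forall>i\<in>{1..K}. \<forall>j\<in>{1..K}. \<forall>k\<in>{1..K}. i \<noteq> j \<and> i \<noteq> k \<longrightarrow>
        \<alpha> i i \<ge> max (\<alpha> i j) (max (\<alpha> k i) (\<alpha> i k + \<alpha> j i - \<alpha> j k)))"

text \<open>A cycle (i_1 -> ... -> i_M), M >= 1, is a nonempty list of distinct indices of [K],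
  read cyclically: the successor of position m (0-based) is position (m+1) mod M.\<close>

definition is_cycle :: "nat \<Rightarrow> nat list \<Rightarrow> bool" where
  "is_cycle K \<pi> \<longleftrightarrow> \<pi> \<noteq> [] \<and> distinct \<pi> \<and> set \<pi> \<subseteq> {1..K}"

definition delta :: "(nat \<Rightarrow> nat \<Rightarrow> real) \<Rightarrow> nat \<Rightarrow> nat \<Rightarrow> real" where
  "delta \<alpha> i j = (if i = j then 0 else \<alpha> i i - \<alpha> j i)"

definition Delta :: "(nat \<Rightarrow> nat \<Rightarrow> real) \<Rightarrow> nat list \<Rightarrow> real" where
  "Delta \<alpha> \<pi> =
     (if length \<pi> = 1 then \<alpha> (\<pi>!0) (\<pi>!0)
      else (\<Sum>m<length \<pi>. delta \<alpha> (\<pi>!m) (\<pi>!((m+1) mod length \<pi>))))"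

definition D_PTIN :: "nat \<Rightarrow> (nat \<Rightarrow> nat \<Rightarrow> real) \<Rightarrow> nat set \<Rightarrow> (nat \<Rightarrow> real) set" where
  "D_PTIN K \<alpha> S = {d. (\<forall>k\<in>{1..K}. k \<notin> S \<longrightarrow> d k = 0) \<and> (\<forall>k\<in>S. 0 \<le> d k) \<and>
      (\<forall>\<pi>. is_cycle K \<pi> \<and> set \<pi> \<subseteq> S \<longrightarrow> (\<Sum>k\<in>set \<pi>. d k) \<le> Delta \<alpha> \<pi>)}"

definition D_TINA :: "nat \<Rightarrow> (nat \<Rightarrow> nat \<Rightarrow> real) \<Rightarrow> (nat \<Rightarrow> real) set" where
  "D_TINA K \<alpha> = (\<Union>S\<in>Pow {1..K}. D_PTIN K \<alpha> S)"

text \<open>Maximum coordinate sum over the TINA region (the maximum is attained; we write Sup).\<close>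
definition D_sum_TINA :: "nat \<Rightarrow> (nat \<Rightarrow> nat \<Rightarrow> real) \<Rightarrow> real" where
  "D_sum_TINA K \<alpha> = Sup ((\<lambda>d. \<Sum>k\<in>{1..K}. d k) ` D_TINA K \<alpha>)"

text \<open>A channel realization is g :: nat * nat * nat => complex, g (k,i,t) = G_ki(t),
  k,i in [K], t a time index (t = 0,1,2,...).\<close>

definition chan_idx :: "nat \<Rightarrow> (nat \<times> nat \<times> nat) set" where
  "chan_idx K = {1..K} \<times> {1..K} \<times> (UNIV :: nat set)"

definition block_idx :: "nat \<Rightarrow> nat \<Rightarrow> (nat \<times> nat \<times> nat) set" where
  "block_idx K n = {1..K} \<times> {1..K} \<times> {..<n}"

text \<open>Finite precision CSIT: the law mu of the channel process is a probability measure;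
  for all finite disjoint sets S, T of coefficients, the joint densities (w.r.t. Lebesgue
  measure on C^|S u T| and C^|T|) exist and the conditional density of G_S given G_T is
  bounded by fmax^|S| (T = {} gives the bound on joint densities); the magnitudes are
  almost surely bounded above and away from zero. All constants are independent of P
  (the channel law does not depend on P).\<close>

definition admissible_channel :: "nat \<Rightarrow> (nat \<times> nat \<times> nat \<Rightarrow> complex) measure \<Rightarrow> bool" where
  "admissible_channel K \<mu> \<longleftrightarrow>
     prob_space \<mu> \<and> sets \<mu> = sets (PiM (chan_idx K) (\<lambda>_. borel)) \<and>
     (\<exists>fmax>0. \<forall>S T. finite S \<and> finite T \<and> S \<subseteq> chan_idx K \<and> T \<subseteq> chan_idx K \<and> S \<inter> T = {} \<longrightarrow>
        (\<exists>fST fT.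
           fST \<in> borel_measurable (PiM (S \<union> T) (\<lambda>_. lborel)) \<and>
           fT \<in> borel_measurable (PiM T (\<lambda>_. lborel)) \<and>
           distr \<mu> (PiM (S \<union> T) (\<lambda>_. lborel)) (\<lambda>g. restrict g (S \<union> T))
             = density (PiM (S \<union> T) (\<lambda>_. lborel)) fST \<and>
           distr \<mu> (PiM T (\<lambda>_. lborel)) (\<lambda>g. restrict g T)
             = density (PiM T (\<lambda>_. lborel)) fT \<and>
           (AE x in PiM (S \<union> T) (\<lambda>_. lborel).
              fST x \<le> ennreal (fmax ^ card S) * fT (restrict x T)))) \<and>
     (\<exists>a b. 0 < a \<and> a \<le> b \<and>
        (AE g in \<mu>. \<forall>x\<in>chan_idx K. a \<le> cmod (g x) \<and> cmod (g x) \<le> b))"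

definition CN :: "complex measure" where
  "CN = density lborel (\<lambda>z. ennreal (exp (- (cmod z)\<^sup>2) / pi))"

definition noise :: "nat \<Rightarrow> (nat \<Rightarrow> complex) measure" where
  "noise n = PiM {..<n} (\<lambda>_. CN)"

text \<open>Received signal at receiver k, time t, given codewords x i t, channel g, noise z;
  Pbar^alpha = P^(alpha/2).\<close>
definition rx :: "nat \<Rightarrow> (nat \<Rightarrow> nat \<Rightarrow> real) \<Rightarrow> real \<Rightarrow> (nat \<Rightarrow> nat \<Rightarrow> complex)
                   \<Rightarrow> (nat \<times> nat \<times> nat \<Rightarrow> complex) \<Rightarrow> (nat \<Rightarrow> complex) \<Rightarrow> nat \<Rightarrow> nat \<Rightarrow> complex" where
  "rx K \<alpha> P x g z k t =
     (\<Sum>i\<in>{1..K}. complex_of_real (P powr (\<alpha> k i / 2)) * g (k, i, t) * x i t) + z t"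

definition msgs :: "nat \<Rightarrow> (nat \<Rightarrow> nat) \<Rightarrow> (nat \<Rightarrow> nat) set" where
  "msgs K M = PiE {1..K} (\<lambda>k. {..<M k})"

text \<open>Probability that receiver k decodes its message wrongly (uniform messages).
  The encoder enc i w t (transmitter i, message tuple w, time t) depends on the messages
  only (no channel knowledge); decoder k sees its block of outputs and the channel.\<close>
definition err_prob :: "nat \<Rightarrow> (nat \<Rightarrow> nat \<Rightarrow> real) \<Rightarrow> (nat \<times> nat \<times> nat \<Rightarrow> complex) measure
    \<Rightarrow> real \<Rightarrow> nat \<Rightarrow> (nat \<Rightarrow> nat) \<Rightarrow> (nat \<Rightarrow> (nat \<Rightarrow> nat) \<Rightarrow> nat \<Rightarrow> complex)
    \<Rightarrow> (nat \<Rightarrow> (nat \<Rightarrow> complex) \<Rightarrow> (nat \<times> nat \<times> nat \<Rightarrow> complex) \<Rightarrow> nat) \<Rightarrow> nat \<Rightarrow> ennreal" where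
  "err_prob K \<alpha> \<mu> P n M enc dec k =
     ennreal (1 / real (card (msgs K M))) *
     (\<Sum>w\<in>msgs K M. \<integral>\<^sup>+ g. (\<integral>\<^sup>+ z.
        (if dec k (restrict (rx K \<alpha> P (\<lambda>i t. enc i w t) g z k) {..<n}) (restrict g (block_idx K n)) \<noteq> w k
         then 1 else 0) \<partial>noise n) \<partial>\<mu>)"

definition achievable :: "nat \<Rightarrow> (nat \<Rightarrow> nat \<Rightarrow> real) \<Rightarrow> (nat \<times> nat \<times> nat \<Rightarrow> complex) measure
    \<Rightarrow> real \<Rightarrow> (nat \<Rightarrow> real) \<Rightarrow> bool" where
  "achievable K \<alpha> \<mu> P R \<longleftrightarrow>
     (\<forall>k\<in>{1..K}. 0 \<le> R k) \<and>
     (\<forall>\<epsilon>>0. \<forall>N. \<exists>n\<ge>N. \<exists>M enc dec.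
        (\<forall>k\<in>{1..K}. 1 \<le> M k \<and> real n * R k \<le> ln (real (M k))) \<and>
        (\<forall>i\<in>{1..K}. \<forall>w\<in>msgs K M. (\<Sum>t<n. (cmod (enc i w t))\<^sup>2) \<le> real n) \<and>
        (\<forall>k\<in>{1..K}. (\<lambda>(y, g). dec k y g) \<in>
            measurable (PiM {..<n} (\<lambda>_. borel) \<Otimes>\<^sub>M PiM (block_idx K n) (\<lambda>_. borel))
                       (count_space UNIV)) \<and>
        (\<forall>k\<in>{1..K}. err_prob K \<alpha> \<mu> P n M enc dec k \<le> ennreal \<epsilon>))"

definition gdof_region :: "nat \<Rightarrow> (nat \<Rightarrow> nat \<Rightarrow> real) \<Rightarrow> (nat \<times> nat \<times> nat \<Rightarrow> complex) measure
    \<Rightarrow> (nat \<Rightarrow> real) set" where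
  "gdof_region K \<alpha> \<mu> = {d. \<exists>R :: real \<Rightarrow> nat \<Rightarrow> real.
      (\<forall>\<^sub>F P in at_top. achievable K \<alpha> \<mu> P (R P)) \<and>
      (\<forall>k\<in>{1..K}. ((\<lambda>P. R P k / ln P) \<longlongrightarrow> d k) at_top)}"

end

theory Submission
  imports Defs
begin

text \<open>
  Open the cycle at the edge \<open>m\<close> to a path \<open>u\<^sub>0, \<dots>, u\<^sub>r\<close>. It suffices to bound the number of
  message tuples of any code with small error by \<open>P\<close> to the power
  \<open>n (\<Sum>\<^sub>j (\<alpha> u\<^sub>j u\<^sub>j - \<alpha> u\<^sub>j\<^sub>+\<^sub>1 u\<^sub>j) + \<alpha> u\<^sub>r u\<^sub>r)\<close>, up to factors \<open>c ^ n\<close> and \<open>P powr (\<eta> n)\<close>. This is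
  done by counting, without entropies. Divide the noise-free output space of each receiver into unit
  cells.

  (1) Tuples that receiver \<open>u\<close> decodes reliably and that share a cell there carry at most \<open>c ^ n\<close>
  different messages of user \<open>u\<close>.

  (2) Aligned images: if two codewords are at distance \<open>z\<^sub>t\<close> at receiver \<open>u\<close> at time \<open>t\<close>, then the bounded
  density of the channel of receiver \<open>u'\<close>, given all other channels, makes them share a cell at \<open>u'\<close>
  with probability at most the product over \<open>t\<close> of \<open>c P powr (\<alpha> u u - \<alpha> u' u) / (1 + |z\<^sub>t|\<^sup>2)\<close>. The SLS
  condition says that the gap \<open>\<alpha> u i - \<alpha> u' i\<close> is largest at \<open>i = u\<close>. Summing over the cells of
  \<open>u\<close>, a packing bound for the cells of \<open>u\<close> becomes one for the cells of \<open>u'\<close>, after discarding a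
  small fraction of the tuples.

  (3) At \<open>u\<^sub>r\<close> the power constraint leaves about \<open>P powr (n \<alpha> u\<^sub>r u\<^sub>r)\<close> cells.

  The bound with the TINA value follows since a single active user achieves \<open>\<alpha> k k\<close> in TINA, which
  dominates \<open>\<alpha> j k\<close>.
\<close>

section \<open>Gaussian noise\<close>

lemma nn_integral_real_gaussian:
  fixes s :: real
  assumes "0 < s"
  shows "(\<integral>\<^sup>+x. ennreal (exp (- s * (x::real)\<^sup>2)) \<partial>lborel) = ennreal (sqrt (pi / s))"
proof -
  define \<sigma> where "\<sigma> = sqrt (1 / (2 * s))"
  have \<sigma>: "0 < \<sigma>" "\<sigma>\<^sup>2 = 1 / (2 * s)" using assms by (auto simp: \<sigma>_def)
  have eq: "exp (- s * x\<^sup>2) = sqrt (pi / s) * normal_density 0 \<sigma> x" for x :: real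
    using assms by (simp add: normal_density_def \<sigma> real_sqrt_divide field_simps)
  have "(\<integral>\<^sup>+x. ennreal (exp (- s * (x::real)\<^sup>2)) \<partial>lborel)
      = (\<integral>\<^sup>+x. ennreal (sqrt (pi / s)) * ennreal (normal_density 0 \<sigma> x) \<partial>lborel)"
    unfolding eq using assms by (intro nn_integral_cong) (simp add: ennreal_mult'')
  also have "\<dots> = ennreal (sqrt (pi / s)) * (\<integral>\<^sup>+x. ennreal (normal_density 0 \<sigma> x) \<partial>lborel)"
    by (rule nn_integral_cmult) simp
  also have "(\<integral>\<^sup>+x. ennreal (normal_density 0 \<sigma> x) \<partial>lborel) = 1"
    using \<sigma> by (simp add: nn_integral_eq_integral normal_density_nonneg)
  finally show ?thesis by simp
qed

lemma nn_integral_complex_gaussian: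
  fixes s :: real
  assumes "0 < s"
  shows "(\<integral>\<^sup>+z. ennreal (exp (- s * (cmod (z::complex))\<^sup>2)) \<partial>lborel) = ennreal (pi / s)"
proof -
  have "(\<integral>\<^sup>+z. ennreal (exp (- s * (cmod (z::complex))\<^sup>2)) \<partial>lborel)
     = (\<integral>\<^sup>+z. (\<Prod>c\<in>Basis. ennreal (exp (- s * ((z::complex) \<bullet> c)\<^sup>2))) \<partial>lborel)"
  proof (intro nn_integral_cong)
    fix z :: complex
    have "(cmod z)\<^sup>2 = (Re z)\<^sup>2 + (Im z)\<^sup>2" by (simp add: cmod_power2)
    then show "ennreal (exp (- s * (cmod z)\<^sup>2)) = (\<Prod>c\<in>Basis. ennreal (exp (- s * (z \<bullet> c)\<^sup>2)))"
      by (simp add: Basis_complex_def inner_complex_def ennreal_mult'[symmetric] exp_add[symmetric]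
          algebra_simps)
  qed
  also have "\<dots> = (\<Prod>c\<in>(Basis::complex set). (\<integral>\<^sup>+x. ennreal (exp (- s * x\<^sup>2)) \<partial>lborel))"
    by (intro nn_integral_lborel_prod) auto
  also have "\<dots> = ennreal (sqrt (pi / s)) * ennreal (sqrt (pi / s))"
    unfolding nn_integral_real_gaussian[OF assms] by (simp add: Basis_complex_def)
  also have "\<dots> = ennreal (pi / s)"
    using assms by (subst ennreal_mult'[symmetric]) auto
  finally show ?thesis .
qed

section \<open>The noise law and a measure that dominates its shifts\<close>

lemma sets_CN [measurable_cong, simp]: "sets CN = sets borel" and space_CN [simp]: "space CN = UNIV"
  by (auto simp: CN_def)

lemma prob_space_CN: "prob_space CN"
proof
  have "emeasure CN (space CN) = (\<integral>\<^sup>+z. ennreal (1/pi) * ennreal (exp (- 1 * (cmod (z::complex))\<^sup>2)) \<partial>lborel)"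
    by (simp add: CN_def emeasure_density ennreal_mult''[symmetric])
  also have "\<dots> = ennreal (1/pi) * ennreal (pi/1)"
    by (subst nn_integral_cmult) (simp, subst nn_integral_complex_gaussian, simp_all)
  also have "\<dots> = 1" by (simp add: ennreal_mult'[symmetric])
  finally show "emeasure CN (space CN) = 1" .
qed

text \<open>A measure dominating all Gaussians whose mean lies within distance \<open>sqrt 2\<close> of \<open>c\<close>; its
  mass is a constant.\<close>

definition wide_gaussian :: "complex \<Rightarrow> complex measure" where
  "wide_gaussian c = density lborel (\<lambda>y. ennreal (exp 2 / pi * exp (- (1/2) * (cmod (y - c))\<^sup>2)))"

lemma sets_wide_gaussian [measurable_cong, simp]: "sets (wide_gaussian c) = sets borel"
  and space_wide_gaussian [simp]: "space (wide_gaussian c) = UNIV"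
  by (auto simp: wide_gaussian_def)

lemma nn_integral_lborel_shift:
  fixes f :: "complex \<Rightarrow> ennreal"
  assumes [measurable]: "f \<in> borel_measurable borel"
  shows "(\<integral>\<^sup>+y. f (m + y) \<partial>lborel) = (\<integral>\<^sup>+y. f y \<partial>lborel)"
proof -
  have "(\<integral>\<^sup>+y. f y \<partial>lborel) = (\<integral>\<^sup>+y. f y \<partial>distr lborel borel ((+) m))"
    by (simp add: lborel_distr_plus)
  also have "\<dots> = (\<integral>\<^sup>+y. f (m + y) \<partial>lborel)" by (intro nn_integral_distr) auto
  finally show ?thesis by simp
qed

lemma emeasure_wide_gaussian: "emeasure (wide_gaussian c) UNIV = ennreal (2 * exp 2)"
proof -
  have "emeasure (wide_gaussian c) UNIV
      = (\<integral>\<^sup>+y. ennreal (exp 2 / pi * exp (- (1/2) * (cmod (y - c))\<^sup>2)) \<partial>lborel)"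
    by (simp add: wide_gaussian_def emeasure_density)
  also have "\<dots> = (\<integral>\<^sup>+y. ennreal (exp 2 / pi * exp (- (1/2) * (cmod (c + y - c))\<^sup>2)) \<partial>lborel)"
    by (rule nn_integral_lborel_shift[symmetric]) simp
  also have "\<dots> = (\<integral>\<^sup>+y. ennreal (exp 2 / pi) * ennreal (exp (- (1/2) * (cmod (y::complex))\<^sup>2)) \<partial>lborel)"
    by (intro nn_integral_cong) (simp add: ennreal_mult''[symmetric])
  also have "\<dots> = ennreal (exp 2 / pi) * ennreal (pi / (1/2))"
    by (subst nn_integral_cmult) (simp, subst nn_integral_complex_gaussian, simp_all)
  also have "\<dots> = ennreal (2 * exp 2)" by (simp add: ennreal_mult'[symmetric])
  finally show ?thesis .
qed

lemma finite_measure_wide_gaussian: "finite_measure (wide_gaussian c)"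
  by standard (simp add: emeasure_wide_gaussian)

lemma product_sigma_finite_CN: "product_sigma_finite (\<lambda>_. CN)"
  unfolding product_sigma_finite_def using prob_space_CN prob_space_imp_sigma_finite by auto

lemma product_sigma_finite_wide_gaussian: "product_sigma_finite (\<lambda>i. wide_gaussian (c i))"
  unfolding product_sigma_finite_def using finite_measure_wide_gaussian finite_measure_def by auto

text \<open>From \<open>|m + z - c|^2 \<le> 2 |m - c|^2 + 2 |z|^2\<close> and
  \<open>|m - c|^2 \<le> 2\<close>, the exponent \<open>- |z|^2\<close> is at most
  \<open>2 - |m + z - c|^2 / 2\<close>. This explains the factor \<open>exp 2\<close> and the halved
  exponent in \<open>wide_gaussian\<close>.\<close>

lemma CN_shift_le_wide_gaussian:
  assumes [measurable]: "f \<in> borel_measurable borel" and "(cmod (m - c))\<^sup>2 \<le> 2"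
  shows "(\<integral>\<^sup>+z. f (m + z) \<partial>CN) \<le> (\<integral>\<^sup>+y. f y \<partial>wide_gaussian c)"
proof -
  have le: "exp (- (cmod z)\<^sup>2) / pi \<le> exp 2 / pi * exp (- (1/2) * (cmod (m + z - c))\<^sup>2)" for z
  proof -
    have "(cmod (m + z - c))\<^sup>2 \<le> (cmod (m - c) + cmod z)\<^sup>2"
      using norm_triangle_ineq[of "m - c" z] by (intro power_mono) (auto simp: algebra_simps)
    also have "\<dots> \<le> 2 * (cmod (m - c))\<^sup>2 + 2 * (cmod z)\<^sup>2"
      using sum_squares_bound[of "cmod (m - c)" "cmod z"] by (simp add: power2_sum)
    finally have "- (cmod z)\<^sup>2 \<le> 2 + - (1/2) * (cmod (m + z - c))\<^sup>2" using assms(2) by simp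
    then have "exp (- (cmod z)\<^sup>2) \<le> exp 2 * exp (- (1/2) * (cmod (m + z - c))\<^sup>2)"
      by (simp add: exp_add[symmetric])
    then show ?thesis by (simp add: divide_right_mono)
  qed
  have "(\<integral>\<^sup>+z. f (m + z) \<partial>CN) = (\<integral>\<^sup>+z. ennreal (exp (- (cmod z)\<^sup>2) / pi) * f (m + z) \<partial>lborel)"
    unfolding CN_def by (rule nn_integral_density) auto
  also have "\<dots> \<le> (\<integral>\<^sup>+z. ennreal (exp 2 / pi * exp (- (1/2) * (cmod (m + z - c))\<^sup>2)) * f (m + z) \<partial>lborel)"
    by (intro nn_integral_mono mult_right_mono ennreal_leI le) auto
  also have "\<dots> = (\<integral>\<^sup>+y. ennreal (exp 2 / pi * exp (- (1/2) * (cmod (y - c))\<^sup>2)) * f y \<partial>lborel)"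
    by (rule nn_integral_lborel_shift
        [where f = "\<lambda>y. ennreal (exp 2 / pi * exp (- (1/2) * (cmod (y - c))\<^sup>2)) * f y"]) simp
  also have "\<dots> = (\<integral>\<^sup>+y. f y \<partial>wide_gaussian c)"
    unfolding wide_gaussian_def by (rule nn_integral_density[symmetric]) auto
  finally show ?thesis .
qed

text \<open>The one-coordinate domination is applied one coordinate at a time, with Tonelli
  separating the new coordinate from the others. The sum \<open>m i + z i\<close> is restricted to
  \<open>I\<close> because points of the product space are \<open>undefined\<close> off
  \<open>I\<close>.\<close>

lemma PiM_nn_integral_shift_le:
  fixes c m :: "nat \<Rightarrow> complex"
  assumes "finite I" and "\<And>i. i \<in> I \<Longrightarrow> (cmod (m i - c i))\<^sup>2 \<le> 2"
    and "f \<in> borel_measurable (PiM I (\<lambda>_. borel))"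
  shows "(\<integral>\<^sup>+z. f (\<lambda>i\<in>I. m i + z i) \<partial>PiM I (\<lambda>_. CN)) \<le> (\<integral>\<^sup>+y. f y \<partial>PiM I (\<lambda>i. wide_gaussian (c i)))"
  using assms
proof (induction I arbitrary: f rule: finite_induct)
  case empty
  then show ?case by (simp add: PiM_empty restrict_def nn_integral_count_space_finite)
next
  case (insert j I)
  interpret N: product_sigma_finite "\<lambda>_::nat. CN" by (rule product_sigma_finite_CN)
  interpret W: product_sigma_finite "\<lambda>i. wide_gaussian (c i)"
    by (rule product_sigma_finite_wide_gaussian)
  interpret NI: finite_product_sigma_finite "\<lambda>_::nat. CN" I by standard fact
  interpret WI: finite_product_sigma_finite "\<lambda>i. wide_gaussian (c i)" I by standard fact
  note [measurable] = insert.prems(2)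
  have [measurable_cong]: "sets (PiM A (\<lambda>_. CN)) = sets (PiM A (\<lambda>_. borel))"
    "sets (PiM A (\<lambda>i. wide_gaussian (c i))) = sets (PiM A (\<lambda>_. borel))" for A :: "nat set"
    by (auto intro!: sets_PiM_cong)
  have "(\<integral>\<^sup>+z. f (\<lambda>i\<in>insert j I. m i + z i) \<partial>PiM (insert j I) (\<lambda>_. CN))
     = (\<integral>\<^sup>+z. (\<integral>\<^sup>+v. f (\<lambda>i\<in>insert j I. m i + (z(j := v)) i) \<partial>CN) \<partial>PiM I (\<lambda>_. CN))"
    using insert.hyps by (intro N.product_nn_integral_insert) auto
  also have "\<dots> = (\<integral>\<^sup>+z. (\<integral>\<^sup>+v. f ((\<lambda>i\<in>I. m i + z i)(j := m j + v)) \<partial>CN) \<partial>PiM I (\<lambda>_. CN))"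
    using insert.hyps by (intro nn_integral_cong arg_cong[where f = f]) (auto simp: fun_eq_iff)
  also have "\<dots> \<le> (\<integral>\<^sup>+z. (\<integral>\<^sup>+v. f ((\<lambda>i\<in>I. m i + z i)(j := v)) \<partial>wide_gaussian (c j)) \<partial>PiM I (\<lambda>_. CN))"
  proof (intro nn_integral_mono)
    fix z
    have [measurable]: "(\<lambda>v. f ((\<lambda>i\<in>I. m i + z i)(j := v))) \<in> borel_measurable borel"
      by measurable (auto simp: space_PiM)
    show "(\<integral>\<^sup>+v. f ((\<lambda>i\<in>I. m i + z i)(j := m j + v)) \<partial>CN)
        \<le> (\<integral>\<^sup>+v. f ((\<lambda>i\<in>I. m i + z i)(j := v)) \<partial>wide_gaussian (c j))"
      using insert.prems(1) by (intro CN_shift_le_wide_gaussian) auto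
  qed
  also have "\<dots> \<le> (\<integral>\<^sup>+y. (\<integral>\<^sup>+v. f (y(j := v)) \<partial>wide_gaussian (c j)) \<partial>PiM I (\<lambda>i. wide_gaussian (c i)))"
  proof (rule insert.IH)
    interpret C: sigma_finite_measure "wide_gaussian (c j)"
      by (rule W.sigma_finite_measures)
    show "(\<lambda>y. \<integral>\<^sup>+v. f (y(j := v)) \<partial>wide_gaussian (c j)) \<in> borel_measurable (PiM I (\<lambda>_. borel))"
      by measurable
  qed (use insert.prems in auto)
  also have "\<dots> = (\<integral>\<^sup>+y. f y \<partial>PiM (insert j I) (\<lambda>i. wide_gaussian (c i)))"
    using insert.hyps by (intro W.product_nn_integral_insert[symmetric]) auto
  finally show ?case .
qed

text \<open>Sphere packing with exponential slack: the wide Gaussian dominates the output law of every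
  codeword of the cell at once, and the decoding regions are disjoint.\<close>

lemma card_decodable_le:
  fixes c :: "nat \<Rightarrow> complex" and m :: "'v \<Rightarrow> nat \<Rightarrow> complex"
  assumes "finite V" and "\<And>v t. v \<in> V \<Longrightarrow> t < n \<Longrightarrow> (cmod (m v t - c t))\<^sup>2 \<le> 2"
    and D: "D \<in> measurable (PiM {..<n} (\<lambda>_. borel)) (count_space UNIV)"
    and succ: "\<And>v. v \<in> V \<Longrightarrow> (\<integral>\<^sup>+z. (if D (\<lambda>t\<in>{..<n}. m v t + z t) \<noteq> v then 1 else 0) \<partial>noise n) \<le> ennreal (1/2)"
  shows "real (card V) \<le> 2 * (2 * exp 2) ^ n"
proof -
  note [measurable] = D
  interpret N: product_prob_space "\<lambda>_::nat. CN" "{..<n}"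
    using product_sigma_finite_CN prob_space_CN
    by (simp add: product_prob_space_def product_prob_space_axioms_def)
  have pN: "emeasure (noise n) (space (noise n)) = 1"
    unfolding noise_def by (rule N.emeasure_space_1)
  interpret W: product_sigma_finite "\<lambda>i. wide_gaussian (c i)"
    by (rule product_sigma_finite_wide_gaussian)
  have sN [measurable_cong]: "sets (noise n) = sets (PiM {..<n} (\<lambda>_. borel))"
    unfolding noise_def by (intro sets_PiM_cong) auto
  have [measurable_cong]: "sets (PiM {..<n} (\<lambda>i. wide_gaussian (c i))) = sets (PiM {..<n} (\<lambda>_. borel))"
    by (intro sets_PiM_cong) auto
  let ?W = "PiM {..<n} (\<lambda>i. wide_gaussian (c i))"
  \<comment> \<open>Every decoding region has mass at least 1/2 under the dominating measure: the
    noise is a probability measure, the error has probability at most 1/2, and the success event is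
    carried over by domination.\<close>
  have half: "ennreal (1/2) \<le> (\<integral>\<^sup>+y. (if D y = v then 1 else 0) \<partial>?W)" if v: "v \<in> V" for v
  proof -
    have "1 = (\<integral>\<^sup>+z. 1 \<partial>noise n)" by (simp add: pN)
    also have "\<dots> = (\<integral>\<^sup>+z. (if D (\<lambda>t\<in>{..<n}. m v t + z t) \<noteq> v then 1 else 0)
            + (if D (\<lambda>t\<in>{..<n}. m v t + z t) = v then 1 else 0) \<partial>noise n)"
      by (intro nn_integral_cong) auto
    also have "\<dots> = (\<integral>\<^sup>+z. (if D (\<lambda>t\<in>{..<n}. m v t + z t) \<noteq> v then 1 else 0) \<partial>noise n)
            + (\<integral>\<^sup>+z. (if D (\<lambda>t\<in>{..<n}. m v t + z t) = v then 1 else 0) \<partial>noise n)"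
      by (intro nn_integral_add) measurable
    also have "\<dots> \<le> ennreal (1/2) + (\<integral>\<^sup>+y. (if D y = v then 1 else 0) \<partial>?W)"
      unfolding noise_def
      using succ[OF v] assms(2)[OF v]
      by (intro add_mono PiM_nn_integral_shift_le) (auto simp: noise_def)
    finally have "1 \<le> ennreal (1/2) + (\<integral>\<^sup>+y. (if D y = v then 1 else 0) \<partial>?W)" .
    moreover have "ennreal (1/2) + ennreal (1/2) = 1"
      by (subst ennreal_plus[symmetric]) auto
    ultimately have "ennreal (1/2) + ennreal (1/2) \<le> ennreal (1/2) + (\<integral>\<^sup>+y. (if D y = v then 1 else 0) \<partial>?W)"
      by metis
    then show ?thesis by (subst (asm) ennreal_add_left_cancel_le) auto
  qed
  have "ennreal (real (card V) * (1/2)) = (\<Sum>v\<in>V. ennreal (1/2))"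
    by (subst sum_ennreal) auto
  also have "\<dots> \<le> (\<Sum>v\<in>V. \<integral>\<^sup>+y. (if D y = v then 1 else 0) \<partial>?W)"
    by (intro sum_mono half)
  also have "\<dots> = (\<integral>\<^sup>+y. (\<Sum>v\<in>V. (if D y = v then 1 else 0)) \<partial>?W)"
    by (intro nn_integral_sum[symmetric]) measurable
  \<comment> \<open>The decoder names a single message for each output, so the decoding regions are
    disjoint and their indicators sum to at most 1.\<close>
  also have "\<dots> \<le> (\<integral>\<^sup>+y. 1 \<partial>?W)"
  proof (intro nn_integral_mono)
    fix y
    show "(\<Sum>v\<in>V. (if D y = v then 1 else 0)) \<le> (1::ennreal)"
      using \<open>finite V\<close> by (simp add: sum.delta)
  qed
  also have "\<dots> = emeasure ?W (PiE {..<n} (\<lambda>_. UNIV))"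
    by (simp add: space_PiM)
  also have "\<dots> = (\<Prod>t<n. emeasure (wide_gaussian (c t)) UNIV)"
    by (intro W.emeasure_PiM) auto
  also have "\<dots> = ennreal ((2 * exp 2) ^ n)"
    by (simp add: emeasure_wide_gaussian ennreal_power)
  finally have "real (card V) * (1/2) \<le> (2 * exp 2) ^ n"
    by (subst (asm) ennreal_le_iff) auto
  then show ?thesis by simp
qed

section \<open>Aligned images\<close>

text \<open>The noise-free part of \<open>rx\<close>. It is linear in \<open>x\<close>, so the
  difference of two codewords can be put in place of a codeword.\<close>

definition sig :: "nat \<Rightarrow> (nat \<Rightarrow> nat \<Rightarrow> real) \<Rightarrow> real \<Rightarrow> (nat \<Rightarrow> nat \<Rightarrow> complex)
    \<Rightarrow> (nat \<times> nat \<times> nat \<Rightarrow> complex) \<Rightarrow> nat \<Rightarrow> nat \<Rightarrow> complex" where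
  "sig K \<alpha> P x g u t = (\<Sum>i\<in>{1..K}. complex_of_real (P powr (\<alpha> u i / 2)) * g (u, i, t) * x i t)"

lemma rx_eq_sig: "rx K \<alpha> P x g z k t = sig K \<alpha> P x g k t + z t"
  by (simp add: rx_def sig_def)

lemma sig_diff:
  "sig K \<alpha> P x g u t - sig K \<alpha> P x' g u t = sig K \<alpha> P (\<lambda>i t. x i t - x' i t) g u t"
  by (simp add: sig_def sum_subtractf[symmetric] algebra_simps)

lemma finite_block_idx [simp]: "finite (block_idx K n)"
  by (simp add: block_idx_def)

lemma sig_cong_block:
  assumes "\<And>i. i \<in> {1..K} \<Longrightarrow> g (u, i, t) = g' (u, i, t)"
  shows "sig K \<alpha> P x g u t = sig K \<alpha> P x g' u t"
  using assms by (simp add: sig_def)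

lemma measurable_sig:
  assumes "u \<in> {1..K}" "t < n"
  shows "(\<lambda>g. sig K \<alpha> P x g u t) \<in> borel_measurable (PiM (block_idx K n) (\<lambda>_. borel))"
proof -
  have "(\<lambda>g. g (u, i, t)) \<in> borel_measurable (PiM (block_idx K n) (\<lambda>_. borel :: complex measure))"
    if "i \<in> {1..K}" for i
    using assms that by (intro measurable_component_singleton) (auto simp: block_idx_def)
  then show ?thesis
    unfolding sig_def by (intro borel_measurable_sum borel_measurable_times) auto
qed

text \<open>The law of the channel coefficients of one block of length \<open>n\<close>. The
  conditional density bound is specialised to conditioning on all coefficients of the block outside
  \<open>S\<close>, which is the form in which coefficients are integrated out.\<close>

locale block_channel =
  fixes K n :: nat and \<nu> :: "(nat \<times> nat \<times> nat \<Rightarrow> complex) measure" and b fmax :: real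
  assumes prob: "prob_space \<nu>"
    and sets_\<nu> [measurable_cong]: "sets \<nu> = sets (PiM (block_idx K n) (\<lambda>_. borel))"
    and fmax_pos: "0 < fmax" and b_pos: "0 < b"
    and bounded: "AE g in \<nu>. \<forall>x\<in>block_idx K n. cmod (g x) \<le> b"
    and density_bound: "\<And>S. S \<subseteq> block_idx K n \<Longrightarrow> \<exists>fST fT.
        fST \<in> borel_measurable (PiM (block_idx K n) (\<lambda>_. lborel)) \<and>
        fT \<in> borel_measurable (PiM (block_idx K n - S) (\<lambda>_. lborel)) \<and>
        \<nu> = density (PiM (block_idx K n) (\<lambda>_. lborel)) fST \<and>
        distr \<nu> (PiM (block_idx K n - S) (\<lambda>_. lborel)) (\<lambda>g. restrict g (block_idx K n - S))
          = density (PiM (block_idx K n - S) (\<lambda>_. lborel)) fT \<and>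
        (AE x in PiM (block_idx K n) (\<lambda>_. lborel).
           fST x \<le> ennreal (fmax ^ card S) * fT (restrict x (block_idx K n - S)))"
begin

lemma space_\<nu>: "space \<nu> = (\<Pi>\<^sub>E x\<in>block_idx K n. UNIV)"
  using sets_eq_imp_space_eq[OF sets_\<nu>] by (simp add: space_PiM)

text \<open>Integrating out the coefficients in \<open>S\<close> first: given all other coefficients, each coordinate
  must lie in a disc, and the conditional density is bounded.\<close>

lemma nn_integral_discs_le:
  fixes F :: "(nat \<times> nat \<times> nat \<Rightarrow> complex) \<Rightarrow> ennreal" and r :: "nat \<times> nat \<times> nat \<Rightarrow> real"
  assumes S: "S \<subseteq> block_idx K n"
    and F[measurable]: "F \<in> borel_measurable (PiM (block_idx K n) (\<lambda>_. borel))"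
    and E[measurable]: "E \<in> sets (PiM (block_idx K n) (\<lambda>_. borel))"
    and inv: "\<And>g g'. (\<And>x. x \<in> block_idx K n - S \<Longrightarrow> g x = g' x) \<Longrightarrow> F g = F g'"
    and disc: "\<And>g s. g \<in> E \<Longrightarrow> s \<in> S \<Longrightarrow> g s \<in> cball (ctr s (restrict g (block_idx K n - S))) (r s)"
    and r: "\<And>s. s \<in> S \<Longrightarrow> 0 \<le> r s"
  shows "(\<integral>\<^sup>+g. F g * indicator E g \<partial>\<nu>) \<le> ennreal (\<Prod>s\<in>S. fmax * (pi * (r s)\<^sup>2)) * (\<integral>\<^sup>+g. F g \<partial>\<nu>)"
proof -
  let ?B = "block_idx K n" and ?T = "block_idx K n - S"
  have fin: "finite S" "finite ?T" using finite_subset[OF S] by auto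
  have BT: "?T \<union> S = ?B" "?T \<inter> S = {}" using S by auto
  obtain fST fT where f[measurable]: "fST \<in> borel_measurable (PiM ?B (\<lambda>_. lborel))"
      "fT \<in> borel_measurable (PiM ?T (\<lambda>_. lborel))"
    and \<nu>: "\<nu> = density (PiM ?B (\<lambda>_. lborel)) fST"
    and \<nu>T: "distr \<nu> (PiM ?T (\<lambda>_. lborel)) (\<lambda>g. restrict g ?T) = density (PiM ?T (\<lambda>_. lborel)) fT"
    and le: "AE x in PiM ?B (\<lambda>_. lborel). fST x \<le> ennreal (fmax ^ card S) * fT (restrict x ?T)"
    using density_bound[OF S] by blast
  interpret L: product_sigma_finite "\<lambda>_::nat \<times> nat \<times> nat. lborel :: complex measure"
    by standard
  have [measurable_cong]: "sets (PiM A (\<lambda>_. lborel)) = sets (PiM A (\<lambda>_. borel :: complex measure))"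
    for A :: "(nat \<times> nat \<times> nat) set" by (intro sets_PiM_cong) auto
  have rT[measurable]: "(\<lambda>g. restrict g ?T) \<in> measurable (PiM ?B (\<lambda>_. borel :: complex measure)) (PiM ?T (\<lambda>_. borel))"
    by (rule measurable_restrict_subset) auto
  \<comment> \<open>\<open>F\<close> does not look at the coordinates in \<open>S\<close>, so it
    factors through the restriction to \<open>?T\<close>; the value 0 is an arbitrary filler for
    them.\<close>
  define G where "G y = F (\<lambda>x\<in>?B. if x \<in> ?T then y x else 0)" for y
  have [measurable]: "G \<in> borel_measurable (PiM ?T (\<lambda>_. borel))"
    unfolding G_def
  proof (rule measurable_compose[OF _ F], rule measurable_restrict)
    fix x assume "x \<in> ?B"
    show "(\<lambda>y. if x \<in> ?T then y x else 0) \<in> borel_measurable (PiM ?T (\<lambda>_. borel :: complex measure))"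
      by (cases "x \<in> ?T") auto
  qed
  have FG: "F g = G (restrict g ?T)" for g
    unfolding G_def by (intro inv) auto
  let ?c = "ennreal (fmax ^ card S)"
  have "(\<integral>\<^sup>+g. F g * indicator E g \<partial>\<nu>) = (\<integral>\<^sup>+g. fST g * (F g * indicator E g) \<partial>PiM ?B (\<lambda>_. lborel))"
    unfolding \<nu> by (rule nn_integral_density) auto
  also have "\<dots> \<le> (\<integral>\<^sup>+g. ?c * fT (restrict g ?T) * (G (restrict g ?T) * indicator E g) \<partial>PiM ?B (\<lambda>_. lborel))"
    using le by (intro nn_integral_mono_AE) (auto simp: FG intro!: mult_right_mono)
  also have "\<dots> = (\<integral>\<^sup>+g. ?c * fT (restrict g ?T) * (G (restrict g ?T) * indicator E g) \<partial>PiM (?T \<union> S) (\<lambda>_. lborel))"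
    by (simp only: BT)
  also have "\<dots> = (\<integral>\<^sup>+y. (\<integral>\<^sup>+z. ?c * fT (restrict (merge ?T S (y, z)) ?T) *
      (G (restrict (merge ?T S (y, z)) ?T) * indicator E (merge ?T S (y, z)))
      \<partial>PiM S (\<lambda>_. lborel)) \<partial>PiM ?T (\<lambda>_. lborel))"
    by (rule L.product_nn_integral_fold[OF BT(2) fin(2,1)]) (unfold BT(1), measurable)
  also have "\<dots> \<le> (\<integral>\<^sup>+y. ennreal (\<Prod>s\<in>S. fmax * (pi * (r s)\<^sup>2)) * (fT y * G y) \<partial>PiM ?T (\<lambda>_. lborel))"
  proof (intro nn_integral_mono)
    fix y :: "nat \<times> nat \<times> nat \<Rightarrow> complex" assume y: "y \<in> space (PiM ?T (\<lambda>_. lborel))"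
    then have yext: "y \<in> extensional ?T" by (auto simp: space_PiM PiE_def)
    have res: "restrict (merge ?T S (y, z)) ?T = y" for z
      using yext by (auto simp: merge_def fun_eq_iff restrict_def extensional_def)
    \<comment> \<open>Once \<open>y\<close> fixes the coefficients outside \<open>S\<close>,
      membership in \<open>E\<close> confines each coordinate of \<open>z\<close> to its own disc.
      The integral over \<open>S\<close> then factors into disc areas.\<close>
    have ind: "indicator E (merge ?T S (y, z)) \<le> (\<Prod>s\<in>S. indicator (cball (ctr s y) (r s)) (z s) :: ennreal)" for z
    proof (cases "merge ?T S (y, z) \<in> E")
      case True
      have "z s \<in> cball (ctr s y) (r s)" if "s \<in> S" for s
        using disc[OF True that, unfolded res] that by (simp add: merge_def)
      then show ?thesis by (simp add: indicator_def)
    qed simp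
    have "(\<integral>\<^sup>+z. ?c * fT (restrict (merge ?T S (y, z)) ?T) *
        (G (restrict (merge ?T S (y, z)) ?T) * indicator E (merge ?T S (y, z))) \<partial>PiM S (\<lambda>_. lborel))
      \<le> (\<integral>\<^sup>+z. (?c * fT y * G y) * (\<Prod>s\<in>S. indicator (cball (ctr s y) (r s)) (z s)) \<partial>PiM S (\<lambda>_. lborel))"
      unfolding res mult.assoc[symmetric] by (intro nn_integral_mono mult_left_mono ind) auto
    also have "\<dots> = (?c * fT y * G y) * (\<integral>\<^sup>+z. (\<Prod>s\<in>S. indicator (cball (ctr s y) (r s)) (z s)) \<partial>PiM S (\<lambda>_. lborel))"
      by (intro nn_integral_cmult borel_measurable_prod_ennreal
          measurable_compose[OF measurable_component_singleton borel_measurable_indicator]) auto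
    also have "(\<integral>\<^sup>+z. (\<Prod>s\<in>S. indicator (cball (ctr s y) (r s)) (z s)) \<partial>PiM S (\<lambda>_. lborel))
        = (\<Prod>s\<in>S. \<integral>\<^sup>+v. indicator (cball (ctr s y) (r s)) v \<partial>lborel)"
      by (intro L.product_nn_integral_prod[OF fin(1)] borel_measurable_indicator) simp
    also have "\<dots> = (\<Prod>s\<in>S. ennreal (pi * (r s)\<^sup>2))"
      using r by (intro prod.cong) (auto simp: emeasure_cball unit_ball_vol_2)
    also have "(?c * fT y * G y) * (\<Prod>s\<in>S. ennreal (pi * (r s)\<^sup>2))
        = (?c * (\<Prod>s\<in>S. ennreal (pi * (r s)\<^sup>2))) * (fT y * G y)"
      by (simp add: mult_ac)
    also have "?c * (\<Prod>s\<in>S. ennreal (pi * (r s)\<^sup>2)) = ennreal (\<Prod>s\<in>S. fmax * (pi * (r s)\<^sup>2))"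
      using fmax_pos by (simp add: prod_ennreal ennreal_mult'[symmetric] prod.distrib prod_nonneg)
    finally show "(\<integral>\<^sup>+z. ?c * fT (restrict (merge ?T S (y, z)) ?T) *
        (G (restrict (merge ?T S (y, z)) ?T) * indicator E (merge ?T S (y, z))) \<partial>PiM S (\<lambda>_. lborel))
      \<le> ennreal (\<Prod>s\<in>S. fmax * (pi * (r s)\<^sup>2)) * (fT y * G y)" .
  qed
  also have "\<dots> = ennreal (\<Prod>s\<in>S. fmax * (pi * (r s)\<^sup>2)) * (\<integral>\<^sup>+y. fT y * G y \<partial>PiM ?T (\<lambda>_. lborel))"
    by (rule nn_integral_cmult) measurable
  also have "(\<integral>\<^sup>+y. fT y * G y \<partial>PiM ?T (\<lambda>_. lborel)) = (\<integral>\<^sup>+y. G y \<partial>density (PiM ?T (\<lambda>_. lborel)) fT)"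
    by (rule nn_integral_density[symmetric]) auto
  \<comment> \<open>\<open>fT\<close> is the density of the marginal law on \<open>?T\<close>, so
    integrating \<open>G\<close> against it returns the mean of \<open>F\<close> under
    \<nu>.\<close>
  also have "\<dots> = (\<integral>\<^sup>+g. F g \<partial>\<nu>)"
    unfolding \<nu>T[symmetric] by (subst nn_integral_distr) (auto simp: FG[symmetric])
  finally show ?thesis .
qed

text \<open>The aligned images bound. The weight uses one transmitter \<open>\<iota> t\<close> per time instant, and only those
  instants for which the received difference from that transmitter exceeds the noise level.\<close>

lemma aligned_images_le:
  fixes F :: "(nat \<times> nat \<times> nat \<Rightarrow> complex) \<Rightarrow> ennreal" and x :: "nat \<Rightarrow> nat \<Rightarrow> complex"
  assumes u: "u \<in> {1..K}" and \<iota>: "\<And>t. t < n \<Longrightarrow> \<iota> t \<in> {1..K}" and P: "0 < P"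
    and F: "F \<in> borel_measurable (PiM (block_idx K n) (\<lambda>_. borel))"
    and inv: "\<And>g g'. (\<And>k i t. k \<noteq> u \<Longrightarrow> (k, i, t) \<in> block_idx K n \<Longrightarrow> g (k, i, t) = g' (k, i, t)) \<Longrightarrow> F g = F g'"
    and v: "\<And>t. v t = P powr (\<alpha> u (\<iota> t) / 2) * cmod (x (\<iota> t) t)"
  shows "(\<integral>\<^sup>+g. F g * indicator {g. \<forall>t<n. cmod (sig K \<alpha> P x g u t) \<le> 2} g \<partial>\<nu>)
    \<le> ennreal (\<Prod>t<n. if v t \<le> 1 then 1 else fmax * (pi * (2 / v t)\<^sup>2)) * (\<integral>\<^sup>+g. F g \<partial>\<nu>)"
proof -
  define \<tau> where "\<tau> = {t. t < n \<and> 1 < v t}"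
  define S where "S = (\<lambda>t. (u, \<iota> t, t)) ` \<tau>"
  let ?B = "block_idx K n"
  let ?E = "{g \<in> space (PiM ?B (\<lambda>_. borel)). \<forall>t<n. cmod (sig K \<alpha> P x g u t) \<le> 2}"
  have S: "S \<subseteq> ?B" using u \<iota> by (auto simp: S_def \<tau>_def block_idx_def)
  have E: "?E \<in> sets (PiM ?B (\<lambda>_. borel))"
  proof -
    have "{g \<in> space (PiM ?B (\<lambda>_. borel)). \<forall>t\<in>{..<n}. cmod (sig K \<alpha> P x g u t) \<le> 2}
        \<in> sets (PiM ?B (\<lambda>_. borel))"
    proof (rule sets.sets_Collect_finite_All)
      fix t assume "t \<in> {..<n}"
      then have [measurable]: "(\<lambda>g. sig K \<alpha> P x g u t) \<in> borel_measurable (PiM ?B (\<lambda>_. borel))"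
        using u by (intro measurable_sig) auto
      show "{g \<in> space (PiM ?B (\<lambda>_. borel)). cmod (sig K \<alpha> P x g u t) \<le> 2} \<in> sets (PiM ?B (\<lambda>_. borel))"
        by measurable
    qed simp
    then show ?thesis by (simp only: Ball_def lessThan_iff)
  qed
  define rest where "rest t g = (\<Sum>i\<in>{1..K} - {\<iota> t}. complex_of_real (P powr (\<alpha> u i / 2)) * g (u, i, t) * x i t)" for t g
  define coef where "coef t = complex_of_real (P powr (\<alpha> u (\<iota> t) / 2)) * x (\<iota> t) t" for t
  \<comment> \<open>Solving \<open>cmod (coef t * g s + rest t g) \<le> 2\<close> for the
    coefficient \<open>g s\<close> gives a disc with this centre and radius
    \<open>2 / v t\<close>.\<close>
  define ctr where "ctr s g = - rest (snd (snd s)) g / coef (snd (snd s))" for s :: "nat \<times> nat \<times> nat" and g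
  have coef: "cmod (coef t) = v t" for t
    by (simp add: coef_def v norm_mult)
  have "(\<integral>\<^sup>+g. F g * indicator ?E g \<partial>\<nu>)
     \<le> ennreal (\<Prod>s\<in>S. fmax * (pi * (2 / v (snd (snd s)))\<^sup>2)) * (\<integral>\<^sup>+g. F g \<partial>\<nu>)"
  proof (rule nn_integral_discs_le[OF S F E, where ctr = ctr])
    fix g g' :: "nat \<times> nat \<times> nat \<Rightarrow> complex"
    assume "\<And>x. x \<in> ?B - S \<Longrightarrow> g x = g' x"
    then show "F g = F g'" by (intro inv) (auto simp: S_def)
  next
    fix g s assume g: "g \<in> ?E" and s: "s \<in> S"
    then obtain t where t: "s = (u, \<iota> t, t)" "t < n" "1 < v t" by (auto simp: S_def \<tau>_def)
    have c0: "coef t \<noteq> 0" using coef[of t] t by auto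
    \<comment> \<open>\<open>S\<close> contains one coefficient per time instant, so
      \<open>rest t\<close> involves only coefficients outside \<open>S\<close> and the centre of
      the disc is known before the integration over \<open>S\<close>.\<close>
    have r: "rest t (restrict g (?B - S)) = rest t g"
      unfolding rest_def using u t by (intro sum.cong refl) (auto simp: S_def block_idx_def)
    have "sig K \<alpha> P x g u t = coef t * g s + rest t g"
      unfolding sig_def rest_def coef_def t using \<iota>[OF t(2)] by (subst sum.remove[of _ "\<iota> t"]) auto
    then have "cmod (coef t * g s + rest t g) \<le> 2" using g t by auto
    moreover have "g s - ctr s g = (coef t * g s + rest t g) / coef t"
      using c0 by (simp add: ctr_def t field_simps)
    ultimately have "cmod (g s - ctr s g) \<le> 2 / v t"
      using t by (simp add: norm_divide coef divide_right_mono)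
    moreover have "ctr s (restrict g (?B - S)) = ctr s g"
      by (simp add: ctr_def t r)
    ultimately show "g s \<in> cball (ctr s (restrict g (?B - S))) (2 / v (snd (snd s)))"
      by (simp add: t(1) dist_norm norm_minus_commute)
  qed (auto simp: S_def \<tau>_def)
  also have "(\<Prod>s\<in>S. fmax * (pi * (2 / v (snd (snd s)))\<^sup>2)) = (\<Prod>t\<in>\<tau>. fmax * (pi * (2 / v t)\<^sup>2))"
    unfolding S_def by (subst prod.reindex) (auto simp: inj_on_def)
  also have "\<dots> = (\<Prod>t<n. if v t \<le> 1 then 1 else fmax * (pi * (2 / v t)\<^sup>2))"
    by (intro prod.mono_neutral_cong_left) (auto simp: \<tau>_def)
  also have "(\<integral>\<^sup>+g. F g * indicator ?E g \<partial>\<nu>) = (\<integral>\<^sup>+g. F g * indicator {g. \<forall>t<n. cmod (sig K \<alpha> P x g u t) \<le> 2} g \<partial>\<nu>)"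
    by (intro nn_integral_cong) (auto simp: indicator_def space_\<nu> space_PiM)
  finally show ?thesis .
qed

end

section \<open>Counting cells\<close>

definition cell_sq :: "int \<times> int \<Rightarrow> real" where
  "cell_sq z = (real_of_int (fst z))\<^sup>2 + (real_of_int (snd z))\<^sup>2"

lemma cell_sq_nonneg [simp]: "0 \<le> cell_sq z"
  by (simp add: cell_sq_def)

lemma square_powr_half:
  fixes x a :: real
  assumes "0 < x"
  shows "(x\<^sup>2) powr (a / 2) = x powr a"
proof -
  have "x\<^sup>2 = x powr 2" using assms by simp
  then show ?thesis by (simp add: powr_powr del: powr_numeral)
qed

text \<open>Comparison with the series of \<open>m powr (- (1 + \<eta>))\<close>, after splitting
  the integers by sign. A bound uniform over finite sets is the form needed for the finitely many
  cells that a code occupies.\<close>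

lemma sum_int_powr_bounded:
  fixes \<eta> :: real
  assumes "0 < \<eta>"
  obtains C where "0 < C" "\<And>F. finite F \<Longrightarrow> (\<Sum>a\<in>F. (1 + (real_of_int a)\<^sup>2) powr (- (1 + \<eta>) / 2)) \<le> C"
proof -
  define f where "f m = (1 + (real m)\<^sup>2) powr (- (1 + \<eta>) / 2)" for m :: nat
  have f0: "0 \<le> f m" for m by (simp add: f_def)
  have "summable f"
  proof (rule summable_comparison_test')
    show "summable (\<lambda>m. real m powr (- (1 + \<eta>)))"
      using assms by (simp add: summable_real_powr_iff)
    fix m :: nat assume "1 \<le> m"
    then have "f m \<le> ((real m)\<^sup>2) powr (- (1 + \<eta>) / 2)"
      unfolding f_def using assms by (intro powr_mono2') auto
    also have "\<dots> = real m powr (- (1 + \<eta>))"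
      using \<open>1 \<le> m\<close> by (intro square_powr_half) auto
    finally show "norm (f m) \<le> real m powr (- (1 + \<eta>))" using f0[of m] by simp
  qed
  have sub: "(\<Sum>a\<in>F. (1 + (real_of_int a)\<^sup>2) powr (- (1 + \<eta>) / 2)) \<le> suminf f"
    if "finite F" "inj_on (\<lambda>a. nat \<bar>a\<bar>) F" for F
  proof -
    have "(\<Sum>a\<in>F. (1 + (real_of_int a)\<^sup>2) powr (- (1 + \<eta>) / 2)) = (\<Sum>a\<in>F. f (nat \<bar>a\<bar>))"
      by (intro sum.cong) (auto simp: f_def)
    also have "\<dots> = sum f ((\<lambda>a. nat \<bar>a\<bar>) ` F)"
      using that by (simp add: sum.reindex)
    also have "\<dots> \<le> suminf f"
      using that f0 \<open>summable f\<close> by (intro sum_le_suminf) auto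
    finally show ?thesis .
  qed
  \<comment> \<open>Each sign contributes at most one copy of the series; the \<open>+ 1\<close>
    makes positivity of the constant immediate.\<close>
  show thesis
  proof (rule that[of "2 * suminf f + 1"])
    show "0 < 2 * suminf f + 1"
      using suminf_nonneg[OF \<open>summable f\<close> f0] by simp
    fix F :: "int set" assume F: "finite F"
    have "F = {a\<in>F. 0 \<le> a} \<union> {a\<in>F. a < 0}" by auto
    then have "(\<Sum>a\<in>F. (1 + (real_of_int a)\<^sup>2) powr (- (1 + \<eta>) / 2))
      = (\<Sum>a\<in>{a\<in>F. 0 \<le> a}. (1 + (real_of_int a)\<^sup>2) powr (- (1 + \<eta>) / 2))
        + (\<Sum>a\<in>{a\<in>F. a < 0}. (1 + (real_of_int a)\<^sup>2) powr (- (1 + \<eta>) / 2))"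
      using F by (subst sum.union_disjoint[symmetric]) auto
    also have "\<dots> \<le> suminf f + suminf f"
      using F by (intro add_mono sub) (auto simp: inj_on_def)
    finally show "(\<Sum>a\<in>F. (1 + (real_of_int a)\<^sup>2) powr (- (1 + \<eta>) / 2)) \<le> 2 * suminf f + 1"
      by simp
  qed
qed

text \<open>Since \<open>(1 + p^2) (1 + q^2) \<le> (1 + p^2 + q^2)^2\<close>, the planar weight is
  at most a product of two one-dimensional weights with half the exponent, and these are summable
  because the full exponent exceeds 1.\<close>

lemma sum_cell_powr_bounded:
  fixes \<eta> :: real
  assumes "0 < \<eta>"
  obtains C where "1 \<le> C" "\<And>Z. finite Z \<Longrightarrow> (\<Sum>z\<in>Z. (1 + cell_sq z) powr (- (1 + \<eta>))) \<le> C"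
proof -
  obtain C where C: "0 < C"
    "\<And>F. finite F \<Longrightarrow> (\<Sum>a\<in>F. (1 + (real_of_int a)\<^sup>2) powr (- (1 + \<eta>) / 2)) \<le> C"
    using sum_int_powr_bounded[OF assms] by blast
  let ?f = "\<lambda>a::int. (1 + (real_of_int a)\<^sup>2) powr (- (1 + \<eta>) / 2)"
  have le: "(1 + cell_sq (a, b')) powr (- (1 + \<eta>)) \<le> ?f a * ?f b'" for a b'
  proof -
    have "(1 + cell_sq (a, b')) powr (- (1 + \<eta>)) = ((1 + cell_sq (a, b'))\<^sup>2) powr (- (1 + \<eta>) / 2)"
      using cell_sq_nonneg[of "(a, b')"] by (intro square_powr_half[symmetric]) linarith
    also have "\<dots> \<le> ((1 + (real_of_int a)\<^sup>2) * (1 + (real_of_int b')\<^sup>2)) powr (- (1 + \<eta>) / 2)"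
    proof (rule powr_mono2')
      have "(1 + x) * (1 + y) \<le> (1 + (x + y))\<^sup>2" if "0 \<le> x" "0 \<le> y" for x y :: real
      proof -
        have "(1 + (x + y))\<^sup>2 - (1 + x) * (1 + y) = x + y + x * x + y * y + x * y"
          by (simp add: power2_eq_square algebra_simps)
        moreover have "0 \<le> x * y" using that by simp
        ultimately show ?thesis using that by (smt (verit) zero_le_square)
      qed
      then show "(1 + (real_of_int a)\<^sup>2) * (1 + (real_of_int b')\<^sup>2) \<le> (1 + cell_sq (a, b'))\<^sup>2"
        by (simp add: cell_sq_def)
      show "0 < (1 + (real_of_int a)\<^sup>2) * (1 + (real_of_int b')\<^sup>2)"
        by (intro mult_pos_pos add_pos_nonneg) auto
    qed (use assms in auto)
    also have "\<dots> = ?f a * ?f b'" by (simp add: powr_mult)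
    finally show ?thesis .
  qed
  show thesis
  proof (rule that[of "C * C + 1"])
    show "1 \<le> C * C + 1" using C(1) by simp
    fix Z :: "(int \<times> int) set" assume Z: "finite Z"
    have "(\<Sum>z\<in>Z. (1 + cell_sq z) powr (- (1 + \<eta>))) \<le> (\<Sum>z\<in>Z. ?f (fst z) * ?f (snd z))"
      using le by (intro sum_mono) (metis prod.collapse)
    also have "\<dots> \<le> (\<Sum>z\<in>fst ` Z \<times> snd ` Z. ?f (fst z) * ?f (snd z))"
      using Z by (intro sum_mono2) (force intro!: mult_nonneg_nonneg)+
    also have "\<dots> = sum ?f (fst ` Z) * sum ?f (snd ` Z)"
      by (simp add: sum_product sum.cartesian_product split_beta)
    also have "\<dots> \<le> C * C"
      using Z C by (intro mult_mono sum_nonneg) auto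
    finally show "(\<Sum>z\<in>Z. (1 + cell_sq z) powr (- (1 + \<eta>))) \<le> C * C + 1" by simp
  qed
qed

text \<open>Each factor satisfies \<open>1 + c \<le> (1 + Q) * exp (c / (1 + Q))\<close>, and the
  exponents add up to at most \<open>n\<close>. The inequality of arithmetic and geometric means
  would save the factor \<open>exp 1\<close>, but constants to the power \<open>n\<close> are
  harmless here.\<close>

lemma prod_one_plus_le:
  fixes c :: "nat \<Rightarrow> real"
  assumes "\<And>t. t < n \<Longrightarrow> 0 \<le> c t" "(\<Sum>t<n. c t) \<le> real n * Q" "0 \<le> Q"
  shows "(\<Prod>t<n. 1 + c t) \<le> ((1 + Q) * exp 1) ^ n"
proof -
  have "(\<Prod>t<n. 1 + c t) \<le> (\<Prod>t<n. (1 + Q) * exp (c t / (1 + Q)))"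
  proof (intro prod_mono conjI)
    fix t assume t: "t \<in> {..<n}"
    then show "0 \<le> 1 + c t" using assms(1)[of t] by simp
    have "1 + c t \<le> (1 + Q) * (1 + c t / (1 + Q))"
      using assms by (simp add: field_simps)
    also have "\<dots> \<le> (1 + Q) * exp (c t / (1 + Q))"
      using assms by (intro mult_left_mono exp_ge_add_one_self) auto
    finally show "1 + c t \<le> (1 + Q) * exp (c t / (1 + Q))" .
  qed
  also have "\<dots> = (1 + Q) ^ n * exp ((\<Sum>t<n. c t) / (1 + Q))"
    by (simp add: prod.distrib exp_sum[symmetric] sum_divide_distrib)
  also have "\<dots> \<le> (1 + Q) ^ n * exp (real n)"
  proof (intro mult_left_mono)
    have "(\<Sum>t<n. c t) \<le> real n * (1 + Q)" using assms by (simp add: algebra_simps)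
    then show "exp ((\<Sum>t<n. c t) / (1 + Q)) \<le> exp (real n)"
      using assms by (simp add: pos_divide_le_eq)
  qed (use assms in auto)
  also have "\<dots> = ((1 + Q) * exp 1) ^ n"
    by (simp add: power_mult_distrib exp_of_nat_mult[symmetric])
  finally show ?thesis .
qed

text \<open>The power constraint is only an average one, so the alphabet of a single coordinate is not
  bounded in terms of \<open>Q\<close>. The excess exponent \<open>\<eta>\<close> makes the sum over all cells converge, and the price
  \<open>\<Prod>(1 + |z|\<^sup>2) powr \<eta>\<close> is controlled by the power constraint.\<close>

lemma sum_prod_cells_le:
  fixes z :: "'a \<Rightarrow> nat \<Rightarrow> int \<times> int" and \<eta> s C S Q :: real
  assumes "finite X" and "s \<le> 1 + \<eta>" and "0 \<le> Q" "0 \<le> C" "0 \<le> S"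
    and C: "\<And>Z. finite Z \<Longrightarrow> (\<Sum>z\<in>Z. (1 + cell_sq z) powr (- (1 + \<eta>))) \<le> C"
    and fib: "\<And>x. x \<in> X \<Longrightarrow> real (card {x'\<in>X. \<forall>t<n. z x' t = z x t}) \<le> S"
    and pow: "\<And>x. x \<in> X \<Longrightarrow> (\<Sum>t<n. cell_sq (z x t)) \<le> real n * Q"
  shows "(\<Sum>x\<in>X. \<Prod>t<n. (1 + cell_sq (z x t)) powr (- s)) \<le> S * (C * ((1 + Q) * exp 1) powr (1 + \<eta> - s)) ^ n"
proof -
  define w where "w z = (1 + cell_sq z) powr (- (1 + \<eta>))" for z
  define \<zeta> where "\<zeta> x = restrict (z x) {..<n}" for x
  define Z where "Z = (\<Union>x\<in>X. z x ` {..<n})"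
  have finZ: "finite Z" using \<open>finite X\<close> by (auto simp: Z_def)
  have w0: "0 \<le> w z" for z by (simp add: w_def)
  have p1: "0 < 1 + cell_sq z" for z using cell_sq_nonneg[of z] by linarith
  let ?A = "(((1 + Q) * exp 1) powr (1 + \<eta> - s)) ^ n"
  \<comment> \<open>The exponent \<open>- s\<close> is split as
    \<open>(1 + \<eta> - s) - (1 + \<eta>)\<close>. The first part is non-negative and is bounded
    through \<open>pow\<close>; the second part is the summable weight \<open>w\<close>.\<close>
  have "(\<Sum>x\<in>X. \<Prod>t<n. (1 + cell_sq (z x t)) powr (- s)) \<le> (\<Sum>x\<in>X. ?A * (\<Prod>t<n. w (z x t)))"
  proof (rule sum_mono)
    fix x assume x: "x \<in> X"
    have "(\<Prod>t<n. (1 + cell_sq (z x t)) powr (- s))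
        = (\<Prod>t<n. (1 + cell_sq (z x t)) powr (1 + \<eta> - s) * w (z x t))"
      unfolding w_def powr_add[symmetric] by simp
    also have "\<dots> = (\<Prod>t<n. (1 + cell_sq (z x t)) powr (1 + \<eta> - s)) * (\<Prod>t<n. w (z x t))"
      by (rule prod.distrib)
    also have "(\<Prod>t<n. (1 + cell_sq (z x t)) powr (1 + \<eta> - s)) = (\<Prod>t<n. 1 + cell_sq (z x t)) powr (1 + \<eta> - s)"
      by (rule prod_powr_distrib[symmetric])
    also have "\<dots> \<le> (((1 + Q) * exp 1) ^ n) powr (1 + \<eta> - s)"
      using pow[OF x] assms(2,3)
      by (intro powr_mono2 prod_one_plus_le) (auto intro!: prod_nonneg less_imp_le[OF p1])
    also have "\<dots> = ?A"
      using \<open>0 \<le> Q\<close> by (simp add: powr_realpow[symmetric] powr_powr mult.commute)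
    finally show "(\<Prod>t<n. (1 + cell_sq (z x t)) powr (- s)) \<le> ?A * (\<Prod>t<n. w (z x t))"
      by (simp add: mult_right_mono prod_nonneg w0)
  qed
  also have "\<dots> = ?A * (\<Sum>x\<in>X. \<Prod>t<n. w (\<zeta> x t))"
    by (simp add: sum_distrib_left \<zeta>_def)
  also have "(\<Sum>x\<in>X. \<Prod>t<n. w (\<zeta> x t)) = (\<Sum>c\<in>\<zeta> ` X. \<Sum>x\<in>{x\<in>X. \<zeta> x = c}. \<Prod>t<n. w (\<zeta> x t))"
    using \<open>finite X\<close> by (rule sum.image_gen)
  also have "\<dots> \<le> (\<Sum>c\<in>\<zeta> ` X. S * (\<Prod>t<n. w (c t)))"
  proof (rule sum_mono)
    fix c assume "c \<in> \<zeta> ` X"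
    then obtain x where x: "x \<in> X" "c = \<zeta> x" by auto
    have "{x'\<in>X. \<zeta> x' = c} = {x'\<in>X. \<forall>t<n. z x' t = z x t}"
      by (auto simp: x \<zeta>_def fun_eq_iff restrict_def)
    then have "real (card {x'\<in>X. \<zeta> x' = c}) \<le> S" using fib[OF x(1)] by simp
    then show "(\<Sum>x\<in>{x\<in>X. \<zeta> x = c}. \<Prod>t<n. w (\<zeta> x t)) \<le> S * (\<Prod>t<n. w (c t))"
      by (simp add: mult_right_mono prod_nonneg w0)
  qed
  also have "\<dots> = S * (\<Sum>c\<in>\<zeta> ` X. \<Prod>t<n. w (c t))" by (simp add: sum_distrib_left)
  \<comment> \<open>Enlarging the occupied cell sequences to all sequences with entries in
    \<open>Z\<close> makes the sum factor over time.\<close>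
  also have "(\<Sum>c\<in>\<zeta> ` X. \<Prod>t<n. w (c t)) \<le> (\<Sum>c\<in>PiE {..<n} (\<lambda>_. Z). \<Prod>t<n. w (c t))"
    using finZ by (intro sum_mono2 finite_PiE prod_nonneg w0) (auto simp: \<zeta>_def Z_def split: if_splits)
  also have "\<dots> = (\<Prod>t<n. \<Sum>v\<in>Z. w v)"
    using finZ by (intro prod_sum_PiE[symmetric]) auto
  also have "\<dots> \<le> C ^ n"
    using C[OF finZ] by (simp add: w_def power_mono sum_nonneg)
  finally have "(\<Sum>x\<in>X. \<Prod>t<n. (1 + cell_sq (z x t)) powr (- s)) \<le> ?A * (S * C ^ n)"
    using \<open>0 \<le> S\<close> by (simp add: mult_left_mono)
  then show ?thesis by (simp add: power_mult_distrib mult_ac)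
qed

section \<open>Quantisation of complex signals into unit cells\<close>

definition cell :: "complex \<Rightarrow> int \<times> int" where
  "cell x = (\<lfloor>Re x\<rfloor>, \<lfloor>Im x\<rfloor>)"

text \<open>The difference of the cell indices, not the cell of the difference: relative to a fixed
  second argument it determines the cell of the first one exactly.\<close>

definition cell_diff :: "complex \<Rightarrow> complex \<Rightarrow> int \<times> int" where
  "cell_diff x y = (\<lfloor>Re x\<rfloor> - \<lfloor>Re y\<rfloor>, \<lfloor>Im x\<rfloor> - \<lfloor>Im y\<rfloor>)"

lemma cell_diff_eq_iff: "cell_diff x z = cell_diff y z \<longleftrightarrow> cell x = cell y"
  by (auto simp: cell_diff_def cell_def)

lemma same_cell_dist:
  assumes "cell x = cell y"
  shows "(cmod (x - y))\<^sup>2 \<le> 2" "cmod (x - y) \<le> 2"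
proof -
  have "\<bar>Re (x - y)\<bar> \<le> 1" "\<bar>Im (x - y)\<bar> \<le> 1"
    using assms by (auto simp: cell_def, linarith+)
  then have "(Re (x - y))\<^sup>2 \<le> 1" "(Im (x - y))\<^sup>2 \<le> 1"
    by (simp_all add: abs_square_le_1)
  then show le2: "(cmod (x - y))\<^sup>2 \<le> 2" by (simp add: cmod_power2)
  then have "(cmod (x - y))\<^sup>2 \<le> 2\<^sup>2" by simp
  then show "cmod (x - y) \<le> 2" by (rule power2_le_imp_le) simp
qed

text \<open>In each real coordinate, rounding changes the difference by at most 1, which costs a
  factor 2 and an additive 2 per coordinate after squaring.\<close>

lemma cell_sq_cell_diff_le: "cell_sq (cell_diff x y) \<le> 2 * (cmod (x - y))\<^sup>2 + 4"
proof -
  have aux: "(real_of_int (\<lfloor>p\<rfloor> - \<lfloor>q\<rfloor>))\<^sup>2 \<le> 2 * (p - q)\<^sup>2 + 2" for p q :: real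
  proof -
    define e where "e = real_of_int (\<lfloor>p\<rfloor> - \<lfloor>q\<rfloor>) - (p - q)"
    have "\<bar>e\<bar> \<le> 1" unfolding e_def by linarith
    then have "e\<^sup>2 \<le> 1" by (simp add: abs_square_le_1)
    moreover have "((p - q) + e)\<^sup>2 \<le> 2 * (p - q)\<^sup>2 + 2 * e\<^sup>2"
      using sum_squares_bound[of "p - q" e] by (simp add: power2_sum)
    moreover have "real_of_int (\<lfloor>p\<rfloor> - \<lfloor>q\<rfloor>) = (p - q) + e" by (simp add: e_def)
    ultimately show ?thesis by simp
  qed
  show ?thesis
    using aux[of "Re x" "Re y"] aux[of "Im x" "Im y"]
    by (simp add: cell_sq_def cell_diff_def cmod_power2)
qed

lemma cmod_sig_le:
  assumes "\<And>i. i \<in> {1..K} \<Longrightarrow> cmod (g (u, i, t)) \<le> b" "0 \<le> b"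
    and "\<And>i. i \<in> {1..K} \<Longrightarrow> P powr (\<alpha> u i / 2) * cmod (x i t) \<le> c i"
  shows "cmod (sig K \<alpha> P x g u t) \<le> b * (\<Sum>i\<in>{1..K}. c i)"
proof -
  have "cmod (sig K \<alpha> P x g u t) \<le> (\<Sum>i\<in>{1..K}. b * c i)"
    unfolding sig_def
  proof (rule sum_norm_le)
    fix i assume i: "i \<in> {1..K}"
    have "cmod (complex_of_real (P powr (\<alpha> u i / 2)) * g (u, i, t) * x i t)
        = cmod (g (u, i, t)) * (P powr (\<alpha> u i / 2) * cmod (x i t))"
      by (simp add: norm_mult)
    also have "\<dots> \<le> b * c i"
      using assms i by (intro mult_mono) auto
    finally show "cmod (complex_of_real (P powr (\<alpha> u i / 2)) * g (u, i, t) * x i t) \<le> b * c i" .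
  qed
  then show ?thesis by (simp add: sum_distrib_left)
qed

text \<open>One fixed code at one power level \<open>P\<close>. Bounds on its error probability are
  hypotheses of the individual lemmas.\<close>

locale bc_code = block_channel K n \<nu> b fmax
  for K n :: nat and \<nu> :: "(nat \<times> nat \<times> nat \<Rightarrow> complex) measure" and b fmax :: real +
  fixes \<alpha> :: "nat \<Rightarrow> nat \<Rightarrow> real" and P :: real and Mc :: "nat \<Rightarrow> nat"
    and enc :: "nat \<Rightarrow> (nat \<Rightarrow> nat) \<Rightarrow> nat \<Rightarrow> complex"
    and dec :: "nat \<Rightarrow> (nat \<Rightarrow> complex) \<Rightarrow> (nat \<times> nat \<times> nat \<Rightarrow> complex) \<Rightarrow> nat"
  assumes sls: "SLS K \<alpha>" and P1: "1 \<le> P"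
    and Mc1: "\<And>k. k \<in> {1..K} \<Longrightarrow> 1 \<le> Mc k"
    and power: "\<And>i w. i \<in> {1..K} \<Longrightarrow> w \<in> msgs K Mc \<Longrightarrow> (\<Sum>t<n. (cmod (enc i w t))\<^sup>2) \<le> real n"
    and dec: "\<And>k. k \<in> {1..K} \<Longrightarrow> (\<lambda>(y, g). dec k y g) \<in>
        measurable (PiM {..<n} (\<lambda>_. borel) \<Otimes>\<^sub>M PiM (block_idx K n) (\<lambda>_. borel)) (count_space UNIV)"
begin

section \<open>Cells and reliable decoding for a fixed code\<close>

abbreviation "W \<equiv> msgs K Mc"

abbreviation s :: "nat \<Rightarrow> (nat \<Rightarrow> nat) \<Rightarrow> (nat \<times> nat \<times> nat \<Rightarrow> complex) \<Rightarrow> nat \<Rightarrow> complex" where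
  "s u w g t \<equiv> sig K \<alpha> P (\<lambda>i. enc i w) g u t"

definition same :: "nat \<Rightarrow> (nat \<times> nat \<times> nat \<Rightarrow> complex) \<Rightarrow> (nat \<Rightarrow> nat) \<Rightarrow> (nat \<Rightarrow> nat) \<Rightarrow> bool" where
  "same u g w w' \<longleftrightarrow> (\<forall>t<n. cell (s u w g t) = cell (s u w' g t))"

text \<open>The error probability of user \<open>u\<close> given the message tuple and the channel.
  The decoder sees the whole block \<open>g\<close>, so the set of reliable tuples may depend on the
  coefficients of every receiver.\<close>

definition err :: "nat \<Rightarrow> (nat \<Rightarrow> nat) \<Rightarrow> (nat \<times> nat \<times> nat \<Rightarrow> complex) \<Rightarrow> ennreal" where
  "err u w g = (\<integral>\<^sup>+z. (if dec u (\<lambda>t\<in>{..<n}. s u w g t + z t) g \<noteq> w u then 1 else 0) \<partial>noise n)"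

lemma finite_W: "finite W"
  by (auto simp: msgs_def intro: finite_PiE)

lemma card_W: "card W = (\<Prod>k\<in>{1..K}. Mc k)"
  by (simp add: msgs_def card_PiE)

lemma card_W_pos: "0 < card W"
  using Mc1 by (auto simp: card_W intro!: prod_pos) (metis One_nat_def atLeastAtMost_iff not_less_eq_eq Suc_le_eq)

text \<open>One tuple of \<open>Y\<close> is chosen to represent each message of user
  \<open>u\<close>. All representatives have noise-free outputs within \<open>sqrt 2\<close> of that
  of \<open>wc\<close> at every time, so sphere packing applies to the decoder with \<open>g\<close>
  held fixed.\<close>

lemma card_reliable_le:
  assumes g: "g \<in> space \<nu>" and u: "u \<in> {1..K}" and Y: "finite Y"
    and rel: "\<And>w. w \<in> Y \<Longrightarrow> err u w g \<le> ennreal (1/2)"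
    and cl: "\<And>w. w \<in> Y \<Longrightarrow> same u g wc w"
  shows "real (card ((\<lambda>w. w u) ` Y)) \<le> 2 * (2 * exp 2) ^ n"
proof -
  define rep where "rep v = (SOME w. w \<in> Y \<and> w u = v)" for v
  have rep: "rep v \<in> Y \<and> rep v u = v" if "v \<in> (\<lambda>w. w u) ` Y" for v
    unfolding rep_def using someI_ex[of "\<lambda>w. w \<in> Y \<and> w u = v"] that by blast
  show ?thesis
  proof (rule card_decodable_le[where c = "\<lambda>t. s u wc g t" and m = "\<lambda>v t. s u (rep v) g t"
        and D = "\<lambda>y. dec u y g"])
    show "finite ((\<lambda>w. w u) ` Y)" using Y by simp
    fix v t assume v: "v \<in> (\<lambda>w. w u) ` Y"
    then show "t < n \<Longrightarrow> (cmod (s u (rep v) g t - s u wc g t))\<^sup>2 \<le> 2"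
      using cl[of "rep v"] rep[OF v] same_cell_dist(1) by (simp add: same_def)
    show "(\<integral>\<^sup>+z. (if dec u (\<lambda>t\<in>{..<n}. s u (rep v) g t + z t) g \<noteq> v then 1 else 0) \<partial>noise n) \<le> ennreal (1/2)"
      using rel[of "rep v"] rep[OF v] by (simp add: err_def)
  next
    have "(\<lambda>y. (y, g)) \<in> measurable (PiM {..<n} (\<lambda>_. borel)) (PiM {..<n} (\<lambda>_. borel) \<Otimes>\<^sub>M PiM (block_idx K n) (\<lambda>_. borel))"
      using g by (intro measurable_Pair) (auto simp: space_\<nu> space_PiM)
    from measurable_compose[OF this dec[OF u]]
    show "(\<lambda>y. dec u y g) \<in> measurable (PiM {..<n} (\<lambda>_. borel)) (count_space UNIV)" by simp
  qed
qed

text \<open>\<open>V\<close> is the set of users whose messages are held fixed. Counting within a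
  class of agreeing tuples plays the role of conditioning on these messages.\<close>

definition agree :: "nat set \<Rightarrow> (nat \<Rightarrow> nat) \<Rightarrow> (nat \<Rightarrow> nat) \<Rightarrow> bool" where
  "agree V w w' \<longleftrightarrow> (\<forall>k\<in>V. w k = w' k)"

text \<open>Expurgation: once the tuples that agree also at user \<open>u\<close> occupy each cell at most \<open>T\<close> times,
  dropping the agreement at \<open>u\<close> costs only the number of messages decodable in one cell.\<close>

lemma card_expurgated_le:
  assumes g: "g \<in> space \<nu>" and u: "u \<in> {1..K}" and Y: "finite Y"
    and rel: "\<And>w. w \<in> Y \<Longrightarrow> err u w g \<le> ennreal (1/2)"
    and cnt: "\<And>w. w \<in> Y \<Longrightarrow> real (card {w'\<in>Y. agree (insert u V) w w' \<and> same u g w w'}) \<le> T"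
    and T: "0 \<le> T"
  shows "real (card {w'\<in>Y. agree V w w' \<and> same u g w w'}) \<le> 2 * (2 * exp 2) ^ n * T"
proof -
  let ?Y = "{w'\<in>Y. agree V w w' \<and> same u g w w'}"
  have "card ?Y = (\<Sum>v\<in>(\<lambda>w. w u) ` ?Y. card {w'\<in>?Y. w' u = v})"
    using sum.image_gen[of ?Y "\<lambda>_. 1::nat" "\<lambda>w. w u"] Y by simp
  then have "real (card ?Y) = (\<Sum>v\<in>(\<lambda>w. w u) ` ?Y. real (card {w'\<in>?Y. w' u = v}))" by simp
  also have "\<dots> \<le> (\<Sum>v\<in>(\<lambda>w. w u) ` ?Y. T)"
  proof (rule sum_mono)
    fix v assume "v \<in> (\<lambda>w. w u) ` ?Y"
    then obtain w1 where w1: "w1 \<in> ?Y" "v = w1 u" by auto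
    have "{w'\<in>?Y. w' u = v} \<subseteq> {w'\<in>Y. agree (insert u V) w1 w' \<and> same u g w1 w'}"
      using w1 by (auto simp: agree_def same_def)
    then have "card {w'\<in>?Y. w' u = v} \<le> card {w'\<in>Y. agree (insert u V) w1 w' \<and> same u g w1 w'}"
      using Y by (intro card_mono) auto
    then show "real (card {w'\<in>?Y. w' u = v}) \<le> T" using cnt[of w1] w1 by simp
  qed
  also have "\<dots> = real (card ((\<lambda>w. w u) ` ?Y)) * T" by simp
  also have "\<dots> \<le> 2 * (2 * exp 2) ^ n * T"
    using Y rel by (intro mult_right_mono card_reliable_le[OF g u, where wc = w] T) auto
  finally show ?thesis .
qed

section \<open>Consequences of the SLS condition and of the power constraint\<close>

lemma alpha_le: "u \<in> {1..K} \<Longrightarrow> i \<in> {1..K} \<Longrightarrow> \<alpha> u i \<le> \<alpha> u u"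
  using sls unfolding SLS_def by (cases "u = i") (auto simp: Ball_def)

lemma alpha_nonneg: "u \<in> {1..K} \<Longrightarrow> i \<in> {1..K} \<Longrightarrow> 0 \<le> \<alpha> u i"
  using sls unfolding SLS_def by auto

text \<open>For \<open>i \<noteq> u\<close> this is the third term of the SLS maximum at
  \<open>u\<close>, with \<open>j = u'\<close> and \<open>k = i\<close>. It makes transmitter
  \<open>u\<close> the worst case when distances at \<open>u'\<close> are compared with distances at
  \<open>u\<close>.\<close>

lemma alpha_diff_le:
  assumes "u \<in> {1..K}" "u' \<in> {1..K}" "u \<noteq> u'" "i \<in> {1..K}"
  shows "\<alpha> u i - \<alpha> u' i \<le> \<alpha> u u - \<alpha> u' u"
proof (cases "i = u")
  case False
  have "\<alpha> u u \<ge> max (\<alpha> u u') (max (\<alpha> i u) (\<alpha> u i + \<alpha> u' u - \<alpha> u' i))"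
    using sls assms False unfolding SLS_def by metis
  then show ?thesis by simp
qed simp

lemma alpha_cross_le: "u \<in> {1..K} \<Longrightarrow> u' \<in> {1..K} \<Longrightarrow> u \<noteq> u' \<Longrightarrow> \<alpha> u' u \<le> \<alpha> u u"
  using sls unfolding SLS_def by (metis max.bounded_iff)

definition bounded_gain :: "(nat \<times> nat \<times> nat \<Rightarrow> complex) \<Rightarrow> bool" where
  "bounded_gain g \<longleftrightarrow> (\<forall>x\<in>block_idx K n. cmod (g x) \<le> b)"

text \<open>No gain at receiver \<open>u\<close> exceeds \<open>P powr \<alpha> u u\<close>. One
  factor \<open>K\<close> comes from the Cauchy-Schwarz inequality over the transmitters, the other
  from summing their energies, and the difference of two codewords has energy at most
  \<open>4 * n\<close> at each transmitter.\<close>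

lemma sum_sig_diff_le:
  assumes g: "bounded_gain g" and u: "u \<in> {1..K}" and w: "w \<in> W" "w' \<in> W"
  shows "(\<Sum>t<n. (cmod (s u w g t - s u w' g t))\<^sup>2) \<le> real n * (4 * (real K)\<^sup>2 * b\<^sup>2 * P powr \<alpha> u u)"
proof -
  define x where "x i t = enc i w t - enc i w' t" for i t
  have "(cmod (s u w g t - s u w' g t))\<^sup>2 \<le> P powr \<alpha> u u * b\<^sup>2 * (real K * (\<Sum>i\<in>{1..K}. (cmod (x i t))\<^sup>2))"
    if t: "t < n" for t
  proof -
    have "cmod (s u w g t - s u w' g t) \<le> b * (\<Sum>i\<in>{1..K}. P powr (\<alpha> u u / 2) * cmod (x i t))"
      unfolding sig_diff x_def
    proof (rule cmod_sig_le)
      fix i assume i: "i \<in> {1..K}"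
      then show "cmod (g (u, i, t)) \<le> b" using g u t by (auto simp: bounded_gain_def block_idx_def)
      show "P powr (\<alpha> u i / 2) * cmod (enc i w t - enc i w' t) \<le> P powr (\<alpha> u u / 2) * cmod (enc i w t - enc i w' t)"
        using alpha_le[OF u i] P1 by (intro mult_right_mono powr_mono) auto
    qed (use b_pos in auto)
    then have "(cmod (s u w g t - s u w' g t))\<^sup>2 \<le> (b * (\<Sum>i\<in>{1..K}. P powr (\<alpha> u u / 2) * cmod (x i t)))\<^sup>2"
      by (intro power_mono) auto
    also have "\<dots> = (P powr (\<alpha> u u / 2))\<^sup>2 * b\<^sup>2 * (\<Sum>i\<in>{1..K}. cmod (x i t))\<^sup>2"
      by (simp add: sum_distrib_left[symmetric] power_mult_distrib)
    also have "(P powr (\<alpha> u u / 2))\<^sup>2 = P powr \<alpha> u u"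
      using P1 by (simp add: power2_eq_square powr_add[symmetric])
    also have "P powr \<alpha> u u * b\<^sup>2 * (\<Sum>i\<in>{1..K}. cmod (x i t))\<^sup>2
        \<le> P powr \<alpha> u u * b\<^sup>2 * (real K * (\<Sum>i\<in>{1..K}. (cmod (x i t))\<^sup>2))"
      using sum_squared_le_sum_of_squares[of "\<lambda>i. cmod (x i t)" "{1..K}"]
      by (intro mult_left_mono) (auto simp: mult.commute)
    finally show ?thesis .
  qed
  then have "(\<Sum>t<n. (cmod (s u w g t - s u w' g t))\<^sup>2)
     \<le> (\<Sum>t<n. P powr \<alpha> u u * b\<^sup>2 * (real K * (\<Sum>i\<in>{1..K}. (cmod (x i t))\<^sup>2)))"
    by (intro sum_mono) auto
  also have "\<dots> = P powr \<alpha> u u * b\<^sup>2 * (real K * (\<Sum>i\<in>{1..K}. \<Sum>t<n. (cmod (x i t))\<^sup>2))"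
    unfolding sum_distrib_left[symmetric] by (subst sum.swap) (rule refl)
  also have "\<dots> \<le> P powr \<alpha> u u * b\<^sup>2 * (real K * (\<Sum>i\<in>{1..K}. 4 * real n))"
  proof (intro mult_left_mono sum_mono)
    fix i assume i: "i \<in> {1..K}"
    have "(\<Sum>t<n. (cmod (x i t))\<^sup>2) \<le> (\<Sum>t<n. 2 * (cmod (enc i w t))\<^sup>2 + 2 * (cmod (enc i w' t))\<^sup>2)"
    proof (rule sum_mono)
      fix t
      have "(cmod (x i t))\<^sup>2 \<le> (cmod (enc i w t) + cmod (enc i w' t))\<^sup>2"
        unfolding x_def by (intro power_mono norm_triangle_ineq4) auto
      then show "(cmod (x i t))\<^sup>2 \<le> 2 * (cmod (enc i w t))\<^sup>2 + 2 * (cmod (enc i w' t))\<^sup>2"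
        using sum_squares_bound[of "cmod (enc i w t)" "cmod (enc i w' t)"] by (simp add: power2_sum)
    qed
    also have "\<dots> = 2 * (\<Sum>t<n. (cmod (enc i w t))\<^sup>2) + 2 * (\<Sum>t<n. (cmod (enc i w' t))\<^sup>2)"
      by (simp add: sum.distrib sum_distrib_left)
    also have "\<dots> \<le> 4 * real n" using power[OF i w(1)] power[OF i w(2)] by simp
    finally show "(\<Sum>t<n. (cmod (x i t))\<^sup>2) \<le> 4 * real n" .
  qed auto
  also have "\<dots> = real n * (4 * (real K)\<^sup>2 * b\<^sup>2 * P powr \<alpha> u u)"
    by (simp add: power2_eq_square)
  finally show ?thesis .
qed

text \<open>The two uses are \<open>r = 1\<close>, where the weight comes from the aligned images
  bound, and \<open>r = 0\<close>, where the sum counts tuples. The tuple \<open>w\<close> only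
  serves as the origin from which cells are measured.\<close>

lemma sum_packed_cells_le:
  fixes \<eta> r S C :: real
  assumes g: "bounded_gain g" and u: "u \<in> {1..K}" and w: "w \<in> W" and X: "X \<subseteq> W"
    and fib: "\<And>w'. w' \<in> X \<Longrightarrow> real (card {w''\<in>X. same u g w' w''}) \<le> S"
    and r: "r \<le> 1 + \<eta>" and S: "0 \<le> S" and C: "1 \<le> C"
    "\<And>Z. finite Z \<Longrightarrow> (\<Sum>z\<in>Z. (1 + cell_sq z) powr (- (1 + \<eta>))) \<le> C"
  shows "(\<Sum>w'\<in>X. \<Prod>t<n. (1 + cell_sq (cell_diff (s u w' g t) (s u w g t))) powr (- r))
    \<le> S * (C * ((5 + 8 * (real K)\<^sup>2 * b\<^sup>2) * exp 1 * P powr \<alpha> u u) powr (1 + \<eta> - r)) ^ n"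
proof -
  \<comment> \<open>Twice the mean squared distance from \<open>sum_sig_diff_le\<close>, plus the 4
    lost by rounding to cells.\<close>
  define Q where "Q = 8 * (real K)\<^sup>2 * b\<^sup>2 * P powr \<alpha> u u + 4"
  have "(\<Sum>w'\<in>X. \<Prod>t<n. (1 + cell_sq (cell_diff (s u w' g t) (s u w g t))) powr (- r))
      \<le> S * (C * ((1 + Q) * exp 1) powr (1 + \<eta> - r)) ^ n"
  proof (rule sum_prod_cells_le)
    show "finite X" using X finite_W finite_subset by blast
    show "0 \<le> Q" by (simp add: Q_def)
    fix w' assume w': "w' \<in> X"
    have "{w''\<in>X. \<forall>t<n. cell_diff (s u w'' g t) (s u w g t) = cell_diff (s u w' g t) (s u w g t)}
        = {w''\<in>X. same u g w' w''}"
      by (auto simp: cell_diff_eq_iff same_def)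
    then show "real (card {w''\<in>X. \<forall>t<n. cell_diff (s u w'' g t) (s u w g t) = cell_diff (s u w' g t) (s u w g t)}) \<le> S"
      using fib[OF w'] by simp
    have "(\<Sum>t<n. cell_sq (cell_diff (s u w' g t) (s u w g t)))
        \<le> (\<Sum>t<n. 2 * (cmod (s u w' g t - s u w g t))\<^sup>2 + 4)"
      by (intro sum_mono cell_sq_cell_diff_le)
    also have "\<dots> = 2 * (\<Sum>t<n. (cmod (s u w' g t - s u w g t))\<^sup>2) + 4 * real n"
      by (simp add: sum.distrib sum_distrib_left)
    also have "\<dots> \<le> real n * Q"
      using sum_sig_diff_le[OF g u, of w' w] w w' X by (auto simp: Q_def algebra_simps)
    finally show "(\<Sum>t<n. cell_sq (cell_diff (s u w' g t) (s u w g t))) \<le> real n * Q" .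
  qed (use r S C in auto)
  also have "\<dots> \<le> S * (C * ((5 + 8 * (real K)\<^sup>2 * b\<^sup>2) * exp 1 * P powr \<alpha> u u) powr (1 + \<eta> - r)) ^ n"
  proof -
    have "1 \<le> P powr \<alpha> u u" using P1 alpha_nonneg[OF u u] by (simp add: ge_one_powr_ge_zero)
    then have "1 + Q \<le> (5 + 8 * (real K)\<^sup>2 * b\<^sup>2) * P powr \<alpha> u u"
      by (simp add: Q_def algebra_simps)
    then have "(1 + Q) * exp 1 \<le> (5 + 8 * (real K)\<^sup>2 * b\<^sup>2) * P powr \<alpha> u u * exp 1"
      by (intro mult_right_mono) auto
    then show ?thesis
      using S C r
      by (intro mult_left_mono power_mono powr_mono2) (auto simp: Q_def mult_ac intro!: mult_nonneg_nonneg add_nonneg_nonneg)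
  qed
  finally show ?thesis .
qed

end

section \<open>Measurability of functions of the channel with finitely many sets as values\<close>

lemma sets_Collect_finite_valued_eq:
  assumes "finite D" "A \<subseteq> D" "\<And>g. g \<in> space M \<Longrightarrow> h g \<subseteq> D"
    and "\<And>d. d \<in> D \<Longrightarrow> {g \<in> space M. d \<in> h g} \<in> sets M"
  shows "{g \<in> space M. h g = A} \<in> sets M"
proof -
  have "{g \<in> space M. \<forall>d\<in>D. d \<in> h g \<longleftrightarrow> d \<in> A} \<in> sets M"
  proof (rule sets.sets_Collect_finite_All[OF _ \<open>finite D\<close>])
    fix d assume d: "d \<in> D"
    show "{g \<in> space M. (d \<in> h g) = (d \<in> A)} \<in> sets M"
      using assms(4)[OF d] by (cases "d \<in> A") (auto intro: sets.sets_Collect_neg)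
  qed
  also have "{g \<in> space M. \<forall>d\<in>D. d \<in> h g \<longleftrightarrow> d \<in> A} = {g \<in> space M. h g = A}"
    using assms(2,3) by blast
  finally show ?thesis .
qed

text \<open>Set-valued functions into finite sets take finitely many values, so the event is a
  finite union of measurable ones whatever \<open>Q\<close> is. In particular \<open>Q\<close> may
  involve a Hilbert choice, as \<open>pick\<close> does.\<close>

lemma sets_Collect_finite_valued:
  assumes "finite D1" "finite D2"
    and sub: "\<And>g. g \<in> space M \<Longrightarrow> h1 g \<subseteq> D1" "\<And>g. g \<in> space M \<Longrightarrow> h2 g \<subseteq> D2"
    and m1: "\<And>d. d \<in> D1 \<Longrightarrow> {g \<in> space M. d \<in> h1 g} \<in> sets M"
    and m2: "\<And>d. d \<in> D2 \<Longrightarrow> {g \<in> space M. d \<in> h2 g} \<in> sets M"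
  shows "{g \<in> space M. Q (h1 g) (h2 g)} \<in> sets M"
proof -
  have "{g \<in> space M. Q (h1 g) (h2 g)}
      = (\<Union>A\<in>Pow D1. \<Union>B\<in>{B\<in>Pow D2. Q A B}. {g \<in> space M. h1 g = A} \<inter> {g \<in> space M. h2 g = B})"
    using sub by auto
  also have "\<dots> \<in> sets M"
    using assms(1,2) by (intro sets.finite_UN sets.Int sets_Collect_finite_valued_eq[of D1]
        sets_Collect_finite_valued_eq[of D2] sub m1 m2) auto
  finally show ?thesis .
qed

section \<open>Aligned images for a pair of message tuples\<close>

context bc_code
begin

lemma sets_same:
  assumes "u \<in> {1..K}"
  shows "{g \<in> space \<nu>. same u g w w'} \<in> sets \<nu>"
proof -
  have "{g \<in> space \<nu>. \<forall>t\<in>{..<n}. cell (s u w g t) = cell (s u w' g t)} \<in> sets \<nu>"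
  proof (rule sets.sets_Collect_finite_All)
    fix t assume "t \<in> {..<n}"
    then have [measurable]: "(\<lambda>g. s u w g t) \<in> borel_measurable \<nu>" for w
      using measurable_sig[OF assms, of t n] by (simp cong: measurable_cong_sets add: sets_\<nu>)
    have [measurable]: "(\<lambda>g. \<lfloor>Re (s u w g t)\<rfloor>) \<in> measurable \<nu> (count_space UNIV)"
      "(\<lambda>g. \<lfloor>Im (s u w g t)\<rfloor>) \<in> measurable \<nu> (count_space UNIV)" for w
      by measurable
    have "{g \<in> space \<nu>. \<lfloor>Re (s u w g t)\<rfloor> = \<lfloor>Re (s u w' g t)\<rfloor> \<and> \<lfloor>Im (s u w g t)\<rfloor> = \<lfloor>Im (s u w' g t)\<rfloor>} \<in> sets \<nu>"
      by measurable
    then show "{g \<in> space \<nu>. cell (s u w g t) = cell (s u w' g t)} \<in> sets \<nu>"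
      by (simp add: cell_def)
  qed simp
  then show ?thesis by (simp only: Ball_def lessThan_iff same_def)
qed

lemma measurable_err:
  assumes u: "u \<in> {1..K}"
  shows "err u w \<in> borel_measurable \<nu>"
proof -
  interpret N: product_prob_space "\<lambda>_::nat. CN" "{..<n}"
    using product_sigma_finite_CN prob_space_CN
    by (simp add: product_prob_space_def product_prob_space_axioms_def)
  interpret NN: sigma_finite_measure "noise n"
    unfolding noise_def by (rule N.P.sigma_finite_measure_axioms)
  have sN [measurable_cong]: "sets (noise n) = sets (PiM {..<n} (\<lambda>_. borel))"
    unfolding noise_def by (intro sets_PiM_cong) auto
  have "(\<lambda>(g, z). \<lambda>t\<in>{..<n}. s u w g t + z t) \<in> measurable (\<nu> \<Otimes>\<^sub>M noise n) (PiM {..<n} (\<lambda>_. borel))"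
    unfolding split_beta
  proof (rule measurable_restrict)
    fix t assume t: "t \<in> {..<n}"
    then have [measurable]: "(\<lambda>g. s u w g t) \<in> borel_measurable \<nu>"
      using measurable_sig[OF u, of t n] by (simp cong: measurable_cong_sets add: sets_\<nu>)
    have [measurable]: "(\<lambda>z. z t) \<in> borel_measurable (noise n)"
      using t by (simp add: sN cong: measurable_cong_sets)
    show "(\<lambda>x. s u w (fst x) t + snd x t) \<in> borel_measurable (\<nu> \<Otimes>\<^sub>M noise n)" by measurable
  qed
  moreover have "(\<lambda>x. fst x) \<in> measurable (\<nu> \<Otimes>\<^sub>M noise n) (PiM (block_idx K n) (\<lambda>_. borel))"
    using measurable_fst[of \<nu> "noise n"] by (simp add: sets_\<nu> cong: measurable_cong_sets)
  ultimately have "(\<lambda>x. (\<lambda>t\<in>{..<n}. s u w (fst x) t + snd x t, fst x)) \<in> measurable (\<nu> \<Otimes>\<^sub>M noise n)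
      (PiM {..<n} (\<lambda>_. borel) \<Otimes>\<^sub>M PiM (block_idx K n) (\<lambda>_. borel))"
    by (simp add: split_beta)
  from measurable_compose[OF this dec[OF u]]
  have [measurable]: "(\<lambda>(g, z). dec u (\<lambda>t\<in>{..<n}. s u w g t + z t) g) \<in> measurable (\<nu> \<Otimes>\<^sub>M noise n) (count_space UNIV)"
    by (simp add: split_beta)
  show ?thesis
    unfolding err_def by measurable
qed

text \<open>The aligned images bound measures the difference of the codewords by its strongest
  component at \<open>u'\<close>; here that is converted into the distance of their cells at
  \<open>u\<close>. The resulting weight depends on the channel of receiver \<open>u\<close> and
  therefore stays under the integral.\<close>

lemma aligned_pair_le:
  fixes F :: "(nat \<times> nat \<times> nat \<Rightarrow> complex) \<Rightarrow> ennreal"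
  assumes u: "u \<in> {1..K}" and u': "u' \<in> {1..K}" and "u \<noteq> u'" and "w \<in> W" "w' \<in> W"
    and F: "F \<in> borel_measurable \<nu>"
    and inv: "\<And>g g'. (\<And>k i t. k \<noteq> u' \<Longrightarrow> (k, i, t) \<in> block_idx K n \<Longrightarrow> g (k, i, t) = g' (k, i, t)) \<Longrightarrow> F g = F g'"
    and A: "A = 5 * (2 + 8 * pi * fmax) * (1 + (real K)\<^sup>2 * b\<^sup>2) * P powr (\<alpha> u u - \<alpha> u' u)"
  shows "(\<integral>\<^sup>+g. F g * indicator {g. same u' g w w'} g \<partial>\<nu>)
     \<le> (\<integral>\<^sup>+g. F g * ennreal (\<Prod>t<n. A * (1 + cell_sq (cell_diff (s u w' g t) (s u w g t))) powr (- 1)) \<partial>\<nu>)"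
proof -
  define x where "x i t = enc i w' t - enc i w t" for i t
  define h where "h i t = P powr (\<alpha> u' i / 2) * cmod (x i t)" for i t
  define \<gamma> where "\<gamma> = \<alpha> u u - \<alpha> u' u"
  \<comment> \<open>At each time the transmitter whose difference arrives strongest at
    \<open>u'\<close> is selected, so that it controls the contributions of all the others.\<close>
  have "\<exists>i. i \<in> {1..K} \<and> (\<forall>j\<in>{1..K}. h j t \<le> h i t)" for t
  proof -
    have "Max ((\<lambda>i. h i t) ` {1..K}) \<in> (\<lambda>i. h i t) ` {1..K}" using u by (intro Max_in) auto
    then obtain i where "i \<in> {1..K}" "Max ((\<lambda>i. h i t) ` {1..K}) = h i t" by auto
    moreover have "h j t \<le> Max ((\<lambda>i. h i t) ` {1..K})" if "j \<in> {1..K}" for j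
      using that by (intro Max_ge) auto
    ultimately show ?thesis by metis
  qed
  then obtain \<iota> where \<iota>: "\<iota> t \<in> {1..K}" "\<And>j. j \<in> {1..K} \<Longrightarrow> h j t \<le> h (\<iota> t) t" for t by metis
  define v where "v t = h (\<iota> t) t" for t
  have v0: "0 \<le> v t" for t by (simp add: v_def h_def)
  let ?wt = "\<lambda>t. if v t \<le> 1 then 1 else fmax * (pi * (2 / v t)\<^sup>2)"
  have wt0: "0 \<le> ?wt t" for t using fmax_pos by auto
  \<comment> \<open>If \<open>v t \<le> 1\<close>, then \<open>1 \<le> 2 / (1 + (v t)^2)\<close>;
    otherwise \<open>1 + (v t)^2 \<le> 2 * (v t)^2\<close>, which turns \<open>4 * pi * fmax\<close>
    into \<open>8 * pi * fmax\<close>. The sum of the two numerators covers both cases.\<close>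
  have wt: "?wt t \<le> (2 + 8 * pi * fmax) / (1 + (v t)\<^sup>2)" for t
  proof (cases "v t \<le> 1")
    case True
    then have "(v t)\<^sup>2 \<le> 1" using v0[of t] by (simp add: power_le_one)
    moreover have "0 \<le> pi * fmax" using fmax_pos by simp
    moreover have "0 < 1 + (v t)\<^sup>2" by (simp add: add_pos_nonneg)
    ultimately show ?thesis using True by (simp add: pos_le_divide_eq)
  next
    case False
    then have v1: "1 \<le> (v t)\<^sup>2" by simp
    have "fmax * (pi * (2 / v t)\<^sup>2) = 8 * pi * fmax / (2 * (v t)\<^sup>2)"
      by (simp add: power_divide)
    also have "\<dots> \<le> 8 * pi * fmax / (1 + (v t)\<^sup>2)"
      using v1 fmax_pos by (intro divide_left_mono mult_pos_pos) auto
    also have "\<dots> \<le> (2 + 8 * pi * fmax) / (1 + (v t)\<^sup>2)"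
      using v1 by (intro divide_right_mono) auto
    finally show ?thesis using False by simp
  qed
  have P\<gamma>: "1 \<le> P powr \<gamma>"
    using P1 alpha_cross_le[OF u u' \<open>u \<noteq> u'\<close>] by (simp add: \<gamma>_def ge_one_powr_ge_zero)
  \<comment> \<open>By \<open>alpha_diff_le\<close>, passing from \<open>u'\<close> to
    \<open>u\<close> amplifies the difference from any transmitter by at most
    \<open>P powr (\<gamma> / 2)\<close>. Hence the distance at \<open>u\<close> is at most
    \<open>b * K * P powr (\<gamma> / 2) * v t\<close>.\<close>
  have main: "?wt t \<le> A * (1 + cell_sq (cell_diff (s u w' g t) (s u w g t))) powr (- 1)"
    if g: "bounded_gain g" and t: "t < n" for g t
  proof -
    let ?d = "(cmod (s u w' g t - s u w g t))\<^sup>2" and ?c = "cell_sq (cell_diff (s u w' g t) (s u w g t))"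
    have "cmod (s u w' g t - s u w g t) \<le> b * (\<Sum>i\<in>{1..K}. P powr (\<gamma> / 2) * v t)"
      unfolding sig_diff
    proof (rule cmod_sig_le)
      fix i assume i: "i \<in> {1..K}"
      then show "cmod (g (u, i, t)) \<le> b" using g u t by (auto simp: bounded_gain_def block_idx_def)
      have "\<alpha> u i / 2 \<le> \<gamma> / 2 + \<alpha> u' i / 2"
        using divide_right_mono[OF alpha_diff_le[OF u u' \<open>u \<noteq> u'\<close> i], of 2]
        by (simp add: \<gamma>_def diff_divide_distrib)
      then have "P powr (\<alpha> u i / 2) \<le> P powr (\<gamma> / 2 + \<alpha> u' i / 2)"
        using P1 by (rule powr_mono)
      then have "P powr (\<alpha> u i / 2) * cmod (x i t) \<le> P powr (\<gamma> / 2) * h i t"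
        unfolding h_def powr_add mult.assoc[symmetric] by (intro mult_right_mono) auto
      also have "\<dots> \<le> P powr (\<gamma> / 2) * v t"
        unfolding v_def using \<iota>(2)[OF i] by (intro mult_left_mono) auto
      finally show "P powr (\<alpha> u i / 2) * cmod (enc i w' t - enc i w t) \<le> P powr (\<gamma> / 2) * v t"
        by (simp add: x_def)
    qed (use b_pos in auto)
    then have "?d \<le> (b * (real K * (P powr (\<gamma> / 2) * v t)))\<^sup>2"
      by (intro power_mono) auto
    also have "\<dots> = (real K)\<^sup>2 * b\<^sup>2 * (P powr (\<gamma> / 2))\<^sup>2 * (v t)\<^sup>2"
      by (simp add: power_mult_distrib mult_ac)
    also have "(P powr (\<gamma> / 2))\<^sup>2 = P powr \<gamma>"
      using P1 by (simp add: power2_eq_square powr_add[symmetric])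
    finally have d: "?d \<le> (real K)\<^sup>2 * b\<^sup>2 * P powr \<gamma> * (v t)\<^sup>2" .
    \<comment> \<open>Rounding gives \<open>?c \<le> 2 * ?d + 4\<close>, hence the factor 5.\<close>
    have "1 + ?c \<le> 5 * (1 + ?d)"
      using cell_sq_cell_diff_le[of "s u w' g t" "s u w g t"] zero_le_power2[of "cmod (s u w' g t - s u w g t)"]
      unfolding distrib_left by linarith
    also have "1 + ?d \<le> P powr \<gamma> * 1 + (real K)\<^sup>2 * b\<^sup>2 * P powr \<gamma> * (v t)\<^sup>2"
      using d P\<gamma> by simp
    also have "\<dots> \<le> (1 + (real K)\<^sup>2 * b\<^sup>2) * P powr \<gamma> * (1 + (v t)\<^sup>2)"
    proof -
      have "0 \<le> (real K)\<^sup>2 * b\<^sup>2 * P powr \<gamma>" "0 \<le> P powr \<gamma> * (v t)\<^sup>2" by auto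
      then show ?thesis by (simp add: algebra_simps)
    qed
    finally have c: "1 + ?c \<le> 5 * (1 + (real K)\<^sup>2 * b\<^sup>2) * P powr \<gamma> * (1 + (v t)\<^sup>2)"
      by (simp only: mult.assoc)
    have pos: "0 < 1 + ?c" "0 < 1 + (v t)\<^sup>2" by (simp_all add: add_pos_nonneg)
    have "?wt t \<le> (2 + 8 * pi * fmax) / (1 + (v t)\<^sup>2)" by (rule wt)
    also have "\<dots> \<le> A / (1 + ?c)"
    proof -
      have "(2 + 8 * pi * fmax) * (1 + ?c) \<le> (2 + 8 * pi * fmax) * (5 * (1 + (real K)\<^sup>2 * b\<^sup>2) * P powr \<gamma> * (1 + (v t)\<^sup>2))"
        using c fmax_pos by (intro mult_left_mono) auto
      also have "\<dots> = A * (1 + (v t)\<^sup>2)" unfolding A \<gamma>_def by (simp only: mult_ac)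
      finally show ?thesis
        by (subst pos_divide_le_eq[OF pos(2)], subst times_divide_eq_left, subst pos_le_divide_eq[OF pos(1)])
    qed
    also have "\<dots> = A * (1 + ?c) powr (- 1)"
      using pos by (simp add: powr_minus divide_inverse)
    finally show ?thesis .
  qed
  have "(\<integral>\<^sup>+g. F g * indicator {g. same u' g w w'} g \<partial>\<nu>)
     \<le> (\<integral>\<^sup>+g. F g * indicator {g. \<forall>t<n. cmod (sig K \<alpha> P x g u' t) \<le> 2} g \<partial>\<nu>)"
  proof (intro nn_integral_mono mult_left_mono)
    fix g
    have "cmod (sig K \<alpha> P x g u' t) \<le> 2" if "same u' g w w'" "t < n" for t
      using that same_cell_dist(2)[of "s u' w' g t" "s u' w g t"]
      by (simp add: same_def sig_diff x_def[abs_def])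
    then show "indicator {g. same u' g w w'} g \<le> (indicator {g. \<forall>t<n. cmod (sig K \<alpha> P x g u' t) \<le> 2} g :: ennreal)"
      by (auto simp: indicator_def)
  qed simp
  also have "\<dots> \<le> ennreal (\<Prod>t<n. ?wt t) * (\<integral>\<^sup>+g. F g \<partial>\<nu>)"
  proof (rule aligned_images_le[OF u', where \<iota> = \<iota> and v = v])
    show "\<iota> t \<in> {1..K}" for t by (rule \<iota>(1))
    show "0 < P" using P1 by simp
    show "v t = P powr (\<alpha> u' (\<iota> t) / 2) * cmod (x (\<iota> t) t)" for t by (simp add: v_def h_def)
    show "F \<in> borel_measurable (PiM (block_idx K n) (\<lambda>_. borel))"
      using F by (simp add: sets_\<nu> cong: measurable_cong_sets)
  qed (rule inv)
  \<comment> \<open>The weights \<open>?wt\<close> do not depend on \<open>g\<close>, so their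
    product moves under the integral and can be compared there with the weight at receiver
    \<open>u\<close>.\<close>
  also have "\<dots> = (\<integral>\<^sup>+g. F g * ennreal (\<Prod>t<n. ?wt t) \<partial>\<nu>)"
    using F by (simp add: nn_integral_multc mult.commute)
  also have "\<dots> \<le> (\<integral>\<^sup>+g. F g * ennreal (\<Prod>t<n. A * (1 + cell_sq (cell_diff (s u w' g t) (s u w g t))) powr (- 1)) \<partial>\<nu>)"
    using bounded
  proof (intro nn_integral_mono_AE, eventually_elim)
    fix g assume "\<forall>x\<in>block_idx K n. cmod (g x) \<le> b"
    then have "bounded_gain g" by (simp add: bounded_gain_def)
    then show "F g * ennreal (\<Prod>t<n. ?wt t)
        \<le> F g * ennreal (\<Prod>t<n. A * (1 + cell_sq (cell_diff (s u w' g t) (s u w g t))) powr (- 1))"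
      using main wt0 by (intro mult_left_mono ennreal_leI prod_mono) auto
  qed
  finally show ?thesis .
qed

end

section \<open>Expurgation\<close>

text \<open>In use \<open>R\<close> is \<open>same_rel u g\<close>, a relation on the finite set of
  message tuples, so the channel enters only through finite data.\<close>

definition packs :: "('w \<Rightarrow> 'w \<Rightarrow> bool) \<Rightarrow> real \<Rightarrow> ('w \<times> 'w) set \<Rightarrow> 'w set \<Rightarrow> bool" where
  "packs ag S R X \<longleftrightarrow> (\<forall>w. real (card {w'\<in>X. ag w w' \<and> (w, w') \<in> R}) \<le> S)"

text \<open>A largest packed subset is a function of finite data only, so that it is measurable in the
  channel and does not inherit the decoder's dependence on the remaining channel coefficients.\<close>

definition pick :: "('w \<Rightarrow> 'w \<Rightarrow> bool) \<Rightarrow> real \<Rightarrow> ('w \<times> 'w) set \<Rightarrow> 'w set \<Rightarrow> 'w set" where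
  "pick ag S R Y = (SOME X. X \<subseteq> Y \<and> packs ag S R X \<and> (\<forall>Z. Z \<subseteq> Y \<longrightarrow> packs ag S R Z \<longrightarrow> card Z \<le> card X))"

lemma pick:
  assumes "finite Y" "0 \<le> S"
  shows "pick ag S R Y \<subseteq> Y" "packs ag S R (pick ag S R Y)"
    "\<And>Z. Z \<subseteq> Y \<Longrightarrow> packs ag S R Z \<Longrightarrow> card Z \<le> card (pick ag S R Y)"
proof -
  let ?C = "{X. X \<subseteq> Y \<and> packs ag S R X}"
  \<comment> \<open>The empty set is packed because \<open>0 \<le> S\<close>, so there is a packed
    subset of maximal size.\<close>
  have "finite (card ` ?C)" "card ` ?C \<noteq> {}"
    using assms by (auto simp: packs_def intro!: exI[of _ "{}"])
  then have "Max (card ` ?C) \<in> card ` ?C" "\<And>Z. Z \<in> ?C \<Longrightarrow> card Z \<le> Max (card ` ?C)"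
    by (auto intro: Max_in)
  then have "\<exists>X. X \<subseteq> Y \<and> packs ag S R X \<and> (\<forall>Z. Z \<subseteq> Y \<longrightarrow> packs ag S R Z \<longrightarrow> card Z \<le> card X)"
    by auto
  then have *: "pick ag S R Y \<subseteq> Y \<and> packs ag S R (pick ag S R Y) \<and> (\<forall>Z. Z \<subseteq> Y \<longrightarrow> packs ag S R Z \<longrightarrow> card Z \<le> card (pick ag S R Y))"
    unfolding pick_def by (rule someI_ex)
  then show "pick ag S R Y \<subseteq> Y" "packs ag S R (pick ag S R Y)"
    "\<And>Z. Z \<subseteq> Y \<Longrightarrow> packs ag S R Z \<Longrightarrow> card Z \<le> card (pick ag S R Y)" by auto
qed

context bc_code
begin

definition same_rel :: "nat \<Rightarrow> (nat \<times> nat \<times> nat \<Rightarrow> complex) \<Rightarrow> ((nat \<Rightarrow> nat) \<times> (nat \<Rightarrow> nat)) set" where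
  "same_rel u g = {(w, w'). w \<in> W \<and> w' \<in> W \<and> same u g w w'}"

text \<open>A random set of message tuples, for instance the survivors of an expurgation; the
  channel realization is the source of randomness.\<close>

definition msg_family :: "((nat \<times> nat \<times> nat \<Rightarrow> complex) \<Rightarrow> (nat \<Rightarrow> nat) set) \<Rightarrow> bool" where
  "msg_family Y \<longleftrightarrow> (\<forall>g. Y g \<subseteq> W) \<and> (\<forall>w\<in>W. {g \<in> space \<nu>. w \<in> Y g} \<in> sets \<nu>)"

lemma sets_family_same:
  assumes "msg_family Y" "u \<in> {1..K}"
  shows "{g \<in> space \<nu>. Q (Y g) (same_rel u g)} \<in> sets \<nu>"
proof (rule sets_Collect_finite_valued[where ?D1.0 = W and ?D2.0 = "W \<times> W"])
  fix d assume "d \<in> W \<times> W"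
  then obtain w w' where d: "d = (w, w')" "w \<in> W" "w' \<in> W" by auto
  then have "{g \<in> space \<nu>. d \<in> same_rel u g} = {g \<in> space \<nu>. same u g w w'}"
    by (auto simp: same_rel_def)
  then show "{g \<in> space \<nu>. d \<in> same_rel u g} \<in> sets \<nu>" using sets_same[OF assms(2)] by simp
qed (use assms finite_W in \<open>auto simp: msg_family_def same_rel_def\<close>)

lemma measurable_family_same:
  fixes f :: "_ \<Rightarrow> _ \<Rightarrow> nat"
  assumes "msg_family Y" "u \<in> {1..K}"
  shows "(\<lambda>g. ennreal (real (f (Y g) (same_rel u g)))) \<in> borel_measurable \<nu>"
proof -
  have "(\<lambda>g. f (Y g) (same_rel u g)) \<in> measurable \<nu> (count_space UNIV)"
    using sets_family_same[OF assms] by (auto simp: measurable_count_space_eq2_countable vimage_def Int_def conj_commute)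
  then show ?thesis by measurable
qed

lemma card_same_rel:
  assumes "Y \<subseteq> W" "w \<in> W"
  shows "{w'\<in>Y. ag w w' \<and> (w, w') \<in> same_rel u g} = {w'\<in>Y. ag w w' \<and> same u g w w'}"
  using assms by (auto simp: same_rel_def)

lemma packs_same_iff:
  assumes "Y \<subseteq> W" "0 \<le> S"
  shows "packs ag S (same_rel u g) Y \<longleftrightarrow> (\<forall>w\<in>W. real (card {w'\<in>Y. ag w w' \<and> same u g w w'}) \<le> S)"
proof -
  have e: "{w'\<in>Y. ag w w' \<and> (w, w') \<in> same_rel u g} = {}" if "w \<notin> W" for w
    using that by (auto simp: same_rel_def)
  have "real (card {w'\<in>Y. ag w w' \<and> (w, w') \<in> same_rel u g}) \<le> S" if "w \<notin> W" for w
    unfolding e[OF that] using assms(2) by simp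
  then have "packs ag S (same_rel u g) Y \<longleftrightarrow> (\<forall>w\<in>W. real (card {w'\<in>Y. ag w w' \<and> (w, w') \<in> same_rel u g}) \<le> S)"
    unfolding packs_def by blast
  also have "\<dots> \<longleftrightarrow> (\<forall>w\<in>W. real (card {w'\<in>Y. ag w w' \<and> same u g w w'}) \<le> S)"
    by (intro ball_cong refl) (simp only: card_same_rel[OF assms(1)])
  finally show ?thesis .
qed

text \<open>These tuples stand in the way of the counting hypothesis of
  \<open>card_expurgated_le\<close>; their mean number is what aligned images control.\<close>

definition overfull :: "nat set \<Rightarrow> nat \<Rightarrow> real \<Rightarrow> (nat \<times> nat \<times> nat \<Rightarrow> complex) \<Rightarrow> (nat \<Rightarrow> nat) set \<Rightarrow> (nat \<Rightarrow> nat) set" where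
  "overfull V u T g Y = {w\<in>Y. T < real (card {w'\<in>Y. agree V w w' \<and> same u g w w'})}"

lemma measurable_card_overfull:
  assumes "msg_family Y" "u \<in> {1..K}"
  shows "(\<lambda>g. ennreal (real (card (overfull V u T g (Y g))))) \<in> borel_measurable \<nu>"
proof -
  have "overfull V u T g (Y g) = {w\<in>Y g. T < real (card {w'\<in>Y g. agree V w w' \<and> (w, w') \<in> same_rel u g})}" for g
    using assms(1) by (auto simp: overfull_def msg_family_def card_same_rel subset_iff)
  then show ?thesis
    using measurable_family_same[OF assms, of "\<lambda>A R. card {w\<in>A. T < real (card {w'\<in>A. agree V w w' \<and> (w, w') \<in> R})}"]
    by simp
qed

text \<open>Deleting the unreliable and the overfull tuples from \<open>Y g\<close> leaves a packed
  set, and \<open>X g\<close> is at least as large because \<open>pick\<close> maximises the size.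
  The deleted set itself depends on the decoder and so on the whole channel, whereas
  \<open>X\<close> depends on \<open>g\<close> only through \<open>Y g\<close> and the cells at
  \<open>u\<close>.\<close>

lemma expurgation_step:
  fixes \<epsilon> T :: real
  assumes Y: "msg_family Y" and u: "u \<in> {1..K}" and T: "0 \<le> T" and \<epsilon>: "0 \<le> \<epsilon>"
    and err: "(\<Sum>w\<in>W. \<integral>\<^sup>+g. err u w g \<partial>\<nu>) \<le> ennreal (\<epsilon> * real (card W))"
    and X: "X = (\<lambda>g. pick (agree V) (2 * (2 * exp 2) ^ n * T) (same_rel u g) (Y g))"
  shows "msg_family X"
    and "\<And>g w. g \<in> space \<nu> \<Longrightarrow> w \<in> W \<Longrightarrow>
      real (card {w'\<in>X g. agree V w w' \<and> same u g w w'}) \<le> 2 * (2 * exp 2) ^ n * T"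
    and "(\<integral>\<^sup>+g. ennreal (real (card (W - X g))) \<partial>\<nu>)
      \<le> (\<integral>\<^sup>+g. ennreal (real (card (W - Y g))) \<partial>\<nu>) + ennreal (2 * \<epsilon> * real (card W))
        + (\<integral>\<^sup>+g. ennreal (real (card (overfull (insert u V) u T g (Y g)))) \<partial>\<nu>)"
proof -
  let ?L = "2 * (2 * exp 2) ^ n * T"
  have L0: "0 \<le> ?L" using T by simp
  have YW: "Y g \<subseteq> W" "finite (Y g)" for g
    using Y finite_W by (auto simp: msg_family_def intro: finite_subset)
  note p = pick[OF YW(2) L0]
  have XY: "X g \<subseteq> Y g" for g using p(1) by (simp add: X)
  show mX: "msg_family X"
    unfolding msg_family_def
  proof (intro conjI allI ballI)
    show "X g \<subseteq> W" for g using XY[of g] YW(1)[of g] by simp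
    show "{g \<in> space \<nu>. w \<in> X g} \<in> sets \<nu>" for w
      unfolding X by (rule sets_family_same[OF Y u, where Q = "\<lambda>A R. w \<in> pick (agree V) ?L R A"])
  qed
  show "real (card {w'\<in>X g. agree V w w' \<and> same u g w w'}) \<le> ?L" if "w \<in> W" for g w
    using p(2)[of "agree V" "same_rel u g" g] XY[of g] YW(1)[of g] that
    by (subst (asm) packs_same_iff[OF _ L0]) (auto simp: X)
  define bad where "bad g = {w\<in>W. ennreal (1/2) < err u w g}" for g
  have le: "card (W - X g) \<le> card (W - Y g) + card (bad g) + card (overfull (insert u V) u T g (Y g))"
    if g: "g \<in> space \<nu>" for g
  proof -
    \<comment> \<open>The competitor for the maximum in \<open>pick\<close>; only its size is used,
      so its measurability does not matter.\<close>
    define Z where "Z = Y g - bad g - overfull (insert u V) u T g (Y g)"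
    have Z: "Z \<subseteq> Y g" "finite Z" "Z \<subseteq> W" using YW[of g] by (auto simp: Z_def)
    have "packs (agree V) ?L (same_rel u g) Z"
      unfolding packs_same_iff[OF Z(3) L0]
    proof
      fix w
      show "real (card {w'\<in>Z. agree V w w' \<and> same u g w w'}) \<le> ?L"
      proof (rule card_expurgated_le[OF g u Z(2)])
        fix w' assume w': "w' \<in> Z"
        then show "err u w' g \<le> ennreal (1/2)" using Z by (auto simp: Z_def bad_def)
        have "card {w''\<in>Z. agree (insert u V) w' w'' \<and> same u g w' w''}
            \<le> card {w''\<in>Y g. agree (insert u V) w' w'' \<and> same u g w' w''}"
          using Z YW by (intro card_mono) auto
        also have "real \<dots> \<le> T" using w' by (auto simp: Z_def overfull_def)
        finally show "real (card {w''\<in>Z. agree (insert u V) w' w'' \<and> same u g w' w''}) \<le> T" by simp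
      qed (use T in auto)
    qed
    then have "card Z \<le> card (X g)" using p(3)[OF Z(1)] by (simp add: X)
    moreover have "card W \<le> card (Z \<union> (W - Y g) \<union> bad g \<union> overfull (insert u V) u T g (Y g))"
      using finite_W YW[of g] Z(2)
      by (intro card_mono finite_UnI) (auto simp: Z_def bad_def overfull_def)
    moreover have "\<dots> \<le> card Z + card (W - Y g) + card (bad g) + card (overfull (insert u V) u T g (Y g))"
      by (meson add_le_mono1 card_Un_le order_trans)
    moreover have "card (W - X g) = card W - card (X g)" "card (X g) \<le> card W"
      using XY[of g] YW(1)[of g] finite_W by (auto intro!: card_Diff_subset card_mono intro: finite_subset)
    ultimately show ?thesis by linarith
  qed
  have [measurable]: "err u w \<in> borel_measurable \<nu>" for w by (rule measurable_err[OF u])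
  have bad: "ennreal (real (card (bad g))) = (\<Sum>w\<in>W. indicator {g \<in> space \<nu>. ennreal (1/2) < err u w g} g)"
    if g: "g \<in> space \<nu>" for g
  proof -
    have "(\<Sum>w\<in>W. indicator {g \<in> space \<nu>. ennreal (1/2) < err u w g} g) = (\<Sum>w\<in>W. indicator (bad g) w :: ennreal)"
      by (intro sum.cong refl) (unfold bad_def indicator_def, use g in auto)
    also have "\<dots> = of_nat (card (W \<inter> bad g))"
      using finite_W by (simp add: indicator_def sum_of_bool_eq)
    also have "W \<inter> bad g = bad g" by (auto simp: bad_def)
    finally show ?thesis by (simp add: ennreal_of_nat_eq_real_of_nat)
  qed
  \<comment> \<open>Markov's inequality at the threshold 1/2, summed over the message
    tuples.\<close>
  have bad_le: "(\<integral>\<^sup>+g. ennreal (real (card (bad g))) \<partial>\<nu>) \<le> ennreal (2 * \<epsilon> * real (card W))"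
  proof -
    have "(\<integral>\<^sup>+g. ennreal (real (card (bad g))) \<partial>\<nu>) = (\<integral>\<^sup>+g. (\<Sum>w\<in>W. indicator {g \<in> space \<nu>. ennreal (1/2) < err u w g} g) \<partial>\<nu>)"
      by (intro nn_integral_cong bad)
    also have "\<dots> \<le> (\<integral>\<^sup>+g. (\<Sum>w\<in>W. 2 * err u w g) \<partial>\<nu>)"
    proof (intro nn_integral_mono sum_mono)
      fix g w
      have "1 \<le> 2 * err u w g" if "ennreal (1/2) < err u w g"
      proof -
        have "(2::real) * (1/2) = 1" by simp
        then have "1 = 2 * ennreal (1/2)"
          using ennreal_mult[of 2 "1/2"] by (metis ennreal_1 ennreal_numeral zero_le_divide_1_iff zero_le_numeral)
        also have "\<dots> \<le> 2 * err u w g" using that by (intro mult_left_mono) auto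
        finally show ?thesis .
      qed
      then show "indicator {g \<in> space \<nu>. ennreal (1/2) < err u w g} g \<le> 2 * err u w g"
        by (auto simp: indicator_def)
    qed
    also have "\<dots> = 2 * (\<Sum>w\<in>W. \<integral>\<^sup>+g. err u w g \<partial>\<nu>)"
      by (subst nn_integral_sum) (auto simp: nn_integral_cmult sum_distrib_left)
    also have "\<dots> \<le> 2 * ennreal (\<epsilon> * real (card W))"
      by (intro mult_left_mono err) simp
    also have "\<dots> = ennreal (2 * \<epsilon> * real (card W))"
      using \<epsilon> by (simp add: ennreal_mult'' ennreal_mult mult.assoc)
    finally show ?thesis .
  qed
  have mbad: "(\<lambda>g. ennreal (real (card (bad g)))) \<in> borel_measurable \<nu>"
    by (subst measurable_cong[OF bad]) measurable
  have mY: "(\<lambda>g. ennreal (real (card (W - Y g)))) \<in> borel_measurable \<nu>"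
    using measurable_family_same[OF Y u, of "\<lambda>A R. card (W - A)"] by simp
  note mo = measurable_card_overfull[OF Y u, of "insert u V" T]
  have "(\<integral>\<^sup>+g. ennreal (real (card (W - X g))) \<partial>\<nu>)
     \<le> (\<integral>\<^sup>+g. ennreal (real (card (W - Y g))) + ennreal (real (card (bad g)))
          + ennreal (real (card (overfull (insert u V) u T g (Y g)))) \<partial>\<nu>)"
  proof (intro nn_integral_mono)
    fix g assume "g \<in> space \<nu>"
    from le[OF this] have "real (card (W - X g)) \<le> real (card (W - Y g)) + real (card (bad g)) + real (card (overfull (insert u V) u T g (Y g)))"
      by linarith
    then show "ennreal (real (card (W - X g))) \<le> ennreal (real (card (W - Y g))) + ennreal (real (card (bad g)))
          + ennreal (real (card (overfull (insert u V) u T g (Y g))))"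
      by (simp add: ennreal_plus[symmetric] ennreal_leI del: ennreal_plus)
  qed
  also have "\<dots> = (\<integral>\<^sup>+g. ennreal (real (card (W - Y g))) \<partial>\<nu>) + (\<integral>\<^sup>+g. ennreal (real (card (bad g))) \<partial>\<nu>)
        + (\<integral>\<^sup>+g. ennreal (real (card (overfull (insert u V) u T g (Y g)))) \<partial>\<nu>)"
    using mY mbad mo by (subst nn_integral_add, measurable)+
  also have "\<dots> \<le> (\<integral>\<^sup>+g. ennreal (real (card (W - Y g))) \<partial>\<nu>) + ennreal (2 * \<epsilon> * real (card W))
        + (\<integral>\<^sup>+g. ennreal (real (card (overfull (insert u V) u T g (Y g)))) \<partial>\<nu>)"
    by (intro add_mono bad_le order_refl)
  finally show "(\<integral>\<^sup>+g. ennreal (real (card (W - X g))) \<partial>\<nu>)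
      \<le> (\<integral>\<^sup>+g. ennreal (real (card (W - Y g))) \<partial>\<nu>) + ennreal (2 * \<epsilon> * real (card W))
        + (\<integral>\<^sup>+g. ennreal (real (card (overfull (insert u V) u T g (Y g)))) \<partial>\<nu>)" .
qed

section \<open>The mean number of overfull tuples at the next receiver\<close>

lemma measurable_cell_sq:
  assumes "u \<in> {1..K}" "t < n"
  shows "(\<lambda>g. cell_sq (cell_diff (s u w' g t) (s u w g t))) \<in> borel_measurable \<nu>"
proof -
  have [measurable]: "(\<lambda>g. s u w g t) \<in> borel_measurable \<nu>" for w
    using measurable_sig[OF assms] by (simp cong: measurable_cong_sets add: sets_\<nu>)
  show ?thesis
    unfolding cell_sq_def cell_diff_def fst_conv snd_conv by measurable
qed

text \<open>Per channel use, a bound on the mean number of cells of receiver \<open>u\<close> whose codewords fall at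
  receiver \<open>u'\<close> into the cell of a given codeword.\<close>

definition align :: "real \<Rightarrow> real \<Rightarrow> nat \<Rightarrow> nat \<Rightarrow> real" where
  "align \<eta> C u u' = 5 * (2 + 8 * pi * fmax) * (1 + (real K)\<^sup>2 * b\<^sup>2) * P powr (\<alpha> u u - \<alpha> u' u)
     * (C * ((5 + 8 * (real K)\<^sup>2 * b\<^sup>2) * exp 1 * P powr \<alpha> u u) powr \<eta>)"

lemma align_pos:
  assumes "1 \<le> C"
  shows "0 < align \<eta> C u u'"
proof -
  have "0 < 2 + 8 * pi * fmax" using fmax_pos by (simp add: add_pos_pos)
  moreover have "0 < 1 + (real K)\<^sup>2 * b\<^sup>2" "0 < 5 + 8 * (real K)\<^sup>2 * b\<^sup>2"
    by (auto intro: add_pos_nonneg)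
  ultimately show ?thesis unfolding align_def using P1 assms by (intro mult_pos_pos) auto
qed

text \<open>Markov's inequality for pairs: \<open>T\<close> times the number of overfull tuples is
  at most the number of surviving pairs that share a cell at \<open>u'\<close>. The mean over the
  channel of \<open>u'\<close> replaces each sharing event by a weight at \<open>u\<close>, and the
  packing at \<open>u\<close> bounds the sum of these weights for each fixed
  \<open>w\<close>.\<close>

lemma nn_integral_overfull_le:
  fixes \<eta> S T C :: real
  assumes Y: "msg_family Y" and u: "u \<in> {1..K}" and u': "u' \<in> {1..K}" and ne: "u \<noteq> u'"
    and inv: "\<And>g g'. (\<And>k i t. k \<noteq> u' \<Longrightarrow> (k, i, t) \<in> block_idx K n \<Longrightarrow> g (k, i, t) = g' (k, i, t)) \<Longrightarrow> Y g = Y g'"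
    and pack: "\<And>g w. g \<in> space \<nu> \<Longrightarrow> w \<in> W \<Longrightarrow> real (card {w'\<in>Y g. agree V w w' \<and> same u g w w'}) \<le> S"
    and S: "0 \<le> S" and T: "0 < T" and \<eta>: "0 < \<eta>" and C: "1 \<le> C"
    "\<And>Z. finite Z \<Longrightarrow> (\<Sum>z\<in>Z. (1 + cell_sq z) powr (- (1 + \<eta>))) \<le> C"
  shows "(\<integral>\<^sup>+g. ennreal (real (card (overfull V u' T g (Y g)))) \<partial>\<nu>)
    \<le> ennreal (S * align \<eta> C u u' ^ n / T * real (card W))"
proof -
  interpret prob_space \<nu> by (rule prob)
  define A where "A = 5 * (2 + 8 * pi * fmax) * (1 + (real K)\<^sup>2 * b\<^sup>2) * P powr (\<alpha> u u - \<alpha> u' u)"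
  have A0: "0 \<le> A" using fmax_pos by (simp add: A_def)
  have YW: "Y g \<subseteq> W" "finite (Y g)" for g
    using Y finite_W by (auto simp: msg_family_def intro: finite_subset)
  \<comment> \<open>The indicator that both tuples survive. By \<open>inv\<close> it does not depend
    on the channel of receiver \<open>u'\<close>, as aligned images require.\<close>
  define F :: "(nat \<Rightarrow> nat) \<Rightarrow> (nat \<Rightarrow> nat) \<Rightarrow> (nat \<times> nat \<times> nat \<Rightarrow> complex) \<Rightarrow> ennreal"
    where "F w w' g = (if w \<in> Y g \<and> w' \<in> Y g then 1 else 0)" for w w' g
  have mF [measurable]: "F w w' \<in> borel_measurable \<nu>" for w w'
  proof -
    have "{g \<in> space \<nu>. w \<in> Y g \<and> w' \<in> Y g} \<in> sets \<nu>"
      by (rule sets_family_same[OF Y u, where Q = "\<lambda>A R. w \<in> A \<and> w' \<in> A"])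
    then have [measurable]: "Measurable.pred \<nu> (\<lambda>g. w \<in> Y g \<and> w' \<in> Y g)" by (simp add: pred_def)
    show ?thesis unfolding F_def[abs_def] by measurable
  qed
  define p where "p w w' g = (\<Prod>t<n. A * (1 + cell_sq (cell_diff (s u w' g t) (s u w g t))) powr (- 1))" for w w' g
  have p0: "0 \<le> p w w' g" for w w' g using A0 by (auto simp: p_def intro!: prod_nonneg)
  have [measurable]: "p w w' \<in> borel_measurable \<nu>" for w w'
    unfolding p_def[abs_def]
  proof (rule borel_measurable_prod)
    fix t assume "t \<in> {..<n}"
    then have [measurable]: "(\<lambda>g. cell_sq (cell_diff (s u w' g t) (s u w g t))) \<in> borel_measurable \<nu>"
      by (intro measurable_cell_sq[OF u]) simp
    show "(\<lambda>g. A * (1 + cell_sq (cell_diff (s u w' g t) (s u w g t))) powr (- 1)) \<in> borel_measurable \<nu>"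
      by measurable
  qed
  have [measurable]: "(\<lambda>g. indicator {g. same u' g w w'} g :: ennreal) \<in> borel_measurable \<nu>" for w w'
  proof -
    have [measurable]: "Measurable.pred \<nu> (\<lambda>g. same u' g w w')" using sets_same[OF u'] by (simp add: pred_def)
    have "(\<lambda>g. (if same u' g w w' then 1 else 0) :: ennreal) \<in> borel_measurable \<nu>" by measurable
    then show ?thesis by (simp add: indicator_def of_bool_def cong: if_cong)
  qed
  define ag where "ag w = {w'\<in>W. agree V w w'}" for w
  have fag: "finite (ag w)" for w using finite_W by (simp add: ag_def)
  let ?O = "\<lambda>g. overfull V u' T g (Y g)"
  have count: "ennreal T * ennreal (real (card (?O g)))
     \<le> (\<Sum>w\<in>W. \<Sum>w'\<in>ag w. F w w' g * indicator {g. same u' g w w'} g)" for g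
  proof -
    have OW: "?O g \<subseteq> W" using YW[of g] by (auto simp: overfull_def)
    have "ennreal T * ennreal (real (card (?O g))) = (\<Sum>w\<in>?O g. ennreal T)"
      by (simp add: ennreal_of_nat_eq_real_of_nat mult.commute)
    also have "\<dots> \<le> (\<Sum>w\<in>?O g. \<Sum>w'\<in>ag w. F w w' g * indicator {g. same u' g w w'} g)"
    proof (rule sum_mono)
      fix w assume w: "w \<in> ?O g"
      let ?c = "{w'\<in>Y g. agree V w w' \<and> same u' g w w'}"
      have "ennreal T \<le> ennreal (real (card ?c))"
        using w by (intro ennreal_leI) (simp add: overfull_def)
      also have "\<dots> = (\<Sum>w'\<in>?c. 1)" by (simp add: ennreal_of_nat_eq_real_of_nat)
      also have "\<dots> = (\<Sum>w'\<in>?c. F w w' g * indicator {g. same u' g w w'} g)"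
        using w by (intro sum.cong) (auto simp: F_def overfull_def)
      also have "\<dots> \<le> (\<Sum>w'\<in>ag w. F w w' g * indicator {g. same u' g w w'} g)"
        using fag YW[of g] by (intro sum_mono2) (auto simp: ag_def)
      finally show "ennreal T \<le> (\<Sum>w'\<in>ag w. F w w' g * indicator {g. same u' g w w'} g)" .
    qed
    also have "\<dots> \<le> (\<Sum>w\<in>W. \<Sum>w'\<in>ag w. F w w' g * indicator {g. same u' g w w'} g)"
      using OW finite_W by (intro sum_mono2) auto
    finally show ?thesis .
  qed
  have pointwise: "(\<Sum>w\<in>W. \<Sum>w'\<in>ag w. F w w' g * ennreal (p w w' g)) \<le> ennreal (real (card W) * (S * align \<eta> C u u' ^ n))"
    if g: "g \<in> space \<nu>" "bounded_gain g" for g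
  proof -
    have "(\<Sum>w'\<in>ag w. F w w' g * ennreal (p w w' g)) \<le> ennreal (S * align \<eta> C u u' ^ n)" if w: "w \<in> W" for w
    proof -
      \<comment> \<open>Tuples of \<open>X\<close> agree on \<open>V\<close> with \<open>w\<close>
        and hence with one another, so the hypothesis \<open>pack\<close> applies with any of them
        as centre.\<close>
      define X where "X = {w'\<in>Y g. agree V w w'}"
      have X: "X \<subseteq> W" "finite X" using YW[of g] by (auto simp: X_def)
      have "(\<Sum>w'\<in>ag w. F w w' g * ennreal (p w w' g)) \<le> (\<Sum>w'\<in>ag w. if w' \<in> X then ennreal (p w w' g) else 0)"
        by (intro sum_mono) (auto simp: F_def X_def ag_def)
      also have "\<dots> = (\<Sum>w'\<in>ag w \<inter> X. ennreal (p w w' g))"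
        using fag by (simp add: sum.inter_restrict)
      also have "ag w \<inter> X = X" using X by (auto simp: ag_def X_def)
      also have "(\<Sum>w'\<in>X. ennreal (p w w' g)) = ennreal (\<Sum>w'\<in>X. p w w' g)"
        by (rule sum_ennreal) (rule p0)
      also have "(\<Sum>w'\<in>X. p w w' g) = A ^ n * (\<Sum>w'\<in>X. \<Prod>t<n. (1 + cell_sq (cell_diff (s u w' g t) (s u w g t))) powr (- 1))"
        unfolding p_def prod.distrib sum_distrib_left prod_constant card_lessThan ..
      also have "\<dots> \<le> A ^ n * (S * (C * ((5 + 8 * (real K)\<^sup>2 * b\<^sup>2) * exp 1 * P powr \<alpha> u u) powr (1 + \<eta> - 1)) ^ n)"
      proof (intro mult_left_mono sum_packed_cells_le[OF g(2) u w X(1)])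
        fix w' assume w': "w' \<in> X"
        have "card {w''\<in>X. same u g w' w''} \<le> card {w''\<in>Y g. agree V w' w'' \<and> same u g w' w''}"
          using w' YW[of g] by (intro card_mono) (auto simp: X_def agree_def)
        also have "real \<dots> \<le> S" using pack[OF g(1), of w'] w' X by auto
        finally show "real (card {w''\<in>X. same u g w' w''}) \<le> S" by simp
      qed (use S \<eta> C A0 in auto)
      also have "\<dots> = S * align \<eta> C u u' ^ n"
        unfolding align_def A_def[symmetric] by (simp add: power_mult_distrib mult_ac)
      finally show ?thesis by (simp add: ennreal_leI)
    qed
    then have "(\<Sum>w\<in>W. \<Sum>w'\<in>ag w. F w w' g * ennreal (p w w' g)) \<le> (\<Sum>w\<in>W. ennreal (S * align \<eta> C u u' ^ n))"
      by (intro sum_mono)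
    also have "\<dots> = ennreal (\<Sum>w\<in>W. S * align \<eta> C u u' ^ n)"
      using S C by (intro sum_ennreal mult_nonneg_nonneg zero_le_power less_imp_le[OF align_pos]) auto
    finally show ?thesis by simp
  qed
  have "ennreal T * (\<integral>\<^sup>+g. ennreal (real (card (?O g))) \<partial>\<nu>)
     = (\<integral>\<^sup>+g. ennreal T * ennreal (real (card (?O g))) \<partial>\<nu>)"
    by (rule nn_integral_cmult[symmetric]) (rule measurable_card_overfull[OF Y u'])
  also have "\<dots> \<le> (\<integral>\<^sup>+g. (\<Sum>w\<in>W. \<Sum>w'\<in>ag w. F w w' g * indicator {g. same u' g w w'} g) \<partial>\<nu>)"
    by (intro nn_integral_mono count)
  also have "\<dots> = (\<Sum>w\<in>W. \<Sum>w'\<in>ag w. \<integral>\<^sup>+g. F w w' g * indicator {g. same u' g w w'} g \<partial>\<nu>)"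
    by (simp add: nn_integral_sum)
  also have "\<dots> \<le> (\<Sum>w\<in>W. \<Sum>w'\<in>ag w. \<integral>\<^sup>+g. F w w' g * ennreal (p w w' g) \<partial>\<nu>)"
  proof (intro sum_mono)
    fix w w' assume w: "w \<in> W" "w' \<in> ag w"
    show "(\<integral>\<^sup>+g. F w w' g * indicator {g. same u' g w w'} g \<partial>\<nu>) \<le> (\<integral>\<^sup>+g. F w w' g * ennreal (p w w' g) \<partial>\<nu>)"
      unfolding p_def
    proof (rule aligned_pair_le[OF u u' ne w(1) _ mF _ A_def])
      show "w' \<in> W" using w by (simp add: ag_def)
      fix g g' :: "nat \<times> nat \<times> nat \<Rightarrow> complex"
      assume "\<And>k i t. k \<noteq> u' \<Longrightarrow> (k, i, t) \<in> block_idx K n \<Longrightarrow> g (k, i, t) = g' (k, i, t)"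
      then have "Y g = Y g'" by (rule inv)
      then show "F w w' g = F w w' g'" by (simp add: F_def)
    qed
  qed
  also have "\<dots> = (\<integral>\<^sup>+g. (\<Sum>w\<in>W. \<Sum>w'\<in>ag w. F w w' g * ennreal (p w w' g)) \<partial>\<nu>)"
    by (simp add: nn_integral_sum)
  also have "\<dots> \<le> (\<integral>\<^sup>+g. ennreal (real (card W) * (S * align \<eta> C u u' ^ n)) \<partial>\<nu>)"
    using AE_space bounded
    by (intro nn_integral_mono_AE, eventually_elim) (intro pointwise, auto simp: bounded_gain_def)
  also have "\<dots> = ennreal (real (card W) * (S * align \<eta> C u u' ^ n))"
    by (simp add: emeasure_space_1)
  finally have le: "ennreal T * (\<integral>\<^sup>+g. ennreal (real (card (?O g))) \<partial>\<nu>) \<le> ennreal (real (card W) * (S * align \<eta> C u u' ^ n))" .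
  have "(\<integral>\<^sup>+g. ennreal (real (card (?O g))) \<partial>\<nu>) = ennreal (1 / T) * (ennreal T * (\<integral>\<^sup>+g. ennreal (real (card (?O g))) \<partial>\<nu>))"
    using T by (simp add: mult.assoc[symmetric] ennreal_mult'[symmetric] del: ennreal_mult')
  also have "\<dots> \<le> ennreal (1 / T) * ennreal (real (card W) * (S * align \<eta> C u u' ^ n))"
    by (intro mult_left_mono le) simp
  also have "\<dots> = ennreal (S * align \<eta> C u u' ^ n / T * real (card W))"
    using T by (subst ennreal_mult'[symmetric]) (auto simp: mult_ac)
  finally show ?thesis .
qed

section \<open>Expurgation along a path of receivers\<close>

lemma same_rel_cong:
  assumes "u \<in> {1..K}" "\<And>i t. (u, i, t) \<in> block_idx K n \<Longrightarrow> g (u, i, t) = g' (u, i, t)"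
  shows "same_rel u g = same_rel u g'"
proof -
  have "s u w g t = s u w g' t" if "t < n" for w t
    using assms that by (intro sig_cong_block) (auto simp: block_idx_def)
  then show ?thesis by (auto simp: same_rel_def same_def)
qed

text \<open>With all messages fixed a class contains a single tuple, so the threshold 1 is never
  exceeded. This starts the induction along the path without any loss from overfull cells.\<close>

lemma overfull_all_empty: "overfull {1..K} u 1 g W = {}"
proof -
  have "card {w'\<in>W. agree {1..K} w w' \<and> same u g w w'} \<le> 1" if "w \<in> W" for w
  proof -
    have "w' = w" if "w' \<in> W" "agree {1..K} w w'" for w'
      using that \<open>w \<in> W\<close> by (intro PiE_ext[of w' "{1..K}" "\<lambda>k. {..<Mc k}" w]) (auto simp: msgs_def agree_def)
    then have "{w'\<in>W. agree {1..K} w w' \<and> same u g w w'} \<subseteq> {w}" by auto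
    then show ?thesis using card_mono[of "{w}"] by fastforce
  qed
  then show ?thesis by (fastforce simp: overfull_def)
qed

text \<open>Expurgation along the path \<open>us\<close>: after step \<open>j\<close> the surviving tuples are packed at receiver
  \<open>us ! j\<close> once the messages of the users outside \<open>us ! 0, \<dots>, us ! j\<close> are fixed.\<close>

lemma expurgate_path:
  fixes us :: "nat list" and \<epsilon> \<delta> \<eta> C :: real
  assumes us: "distinct us" "set us \<subseteq> {1..K}" and j: "j < length us"
    and err: "\<And>u. u \<in> set us \<Longrightarrow> (\<Sum>w\<in>W. \<integral>\<^sup>+g. err u w g \<partial>\<nu>) \<le> ennreal (\<epsilon> * real (card W))"
    and \<epsilon>: "0 \<le> \<epsilon>" and \<delta>: "0 < \<delta>" and \<eta>: "0 < \<eta>" and C: "1 \<le> C"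
    "\<And>Z. finite Z \<Longrightarrow> (\<Sum>z\<in>Z. (1 + cell_sq z) powr (- (1 + \<eta>))) \<le> C"
    and L: "L = 2 * (2 * exp 2) ^ n"
  shows "\<exists>X. msg_family X
    \<and> (\<forall>g g'. (\<forall>k i t. k \<in> set (take (Suc j) us) \<longrightarrow> (k, i, t) \<in> block_idx K n \<longrightarrow> g (k, i, t) = g' (k, i, t)) \<longrightarrow> X g = X g')
    \<and> (\<forall>g\<in>space \<nu>. \<forall>w\<in>W. real (card {w'\<in>X g. agree ({1..K} - set (take (Suc j) us)) w w' \<and> same (us ! j) g w w'})
          \<le> L * (\<Prod>i<j. L * align \<eta> C (us ! i) (us ! Suc i) ^ n / \<delta>))
    \<and> (\<integral>\<^sup>+g. ennreal (real (card (W - X g))) \<partial>\<nu>) \<le> ennreal (real (Suc j) * (2 * \<epsilon> + \<delta>) * real (card W))"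
  using j
proof (induction j)
  case 0
  define u where "u = us ! 0"
  have u: "u \<in> {1..K}" "u \<in> set us" using us(2) 0 nth_mem[of 0 us] by (auto simp: u_def simp del: nth_mem)
  define V where "V = {1..K} - set (take (Suc 0) us)"
  have V: "insert u V = {1..K}" using u 0 by (cases us) (auto simp: V_def u_def)
  define X where "X g = pick (agree V) (2 * (2 * exp 2) ^ n * 1) (same_rel u g) W" for g
  have fam: "msg_family (\<lambda>_. W)" by (auto simp: msg_family_def)
  note st = expurgation_step[OF fam u(1) _ \<epsilon> err[OF u(2)], of 1 X V]
  have X: "X = (\<lambda>g. pick (agree V) (2 * (2 * exp 2) ^ n * 1) (same_rel u g) W)" by (simp add: X_def fun_eq_iff)
  show ?case
  proof (intro exI[of _ X] conjI allI impI ballI)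
    show "msg_family X" by (rule st(1)[OF _ X]) simp
    show "real (card {w'\<in>X g. agree ({1..K} - set (take (Suc 0) us)) w w' \<and> same (us ! 0) g w w'})
          \<le> L * (\<Prod>i<0. L * align \<eta> C (us ! i) (us ! Suc i) ^ n / \<delta>)" if "g \<in> space \<nu>" "w \<in> W" for g w
      using st(2)[OF _ X that] by (simp add: V_def u_def L)
    have "(\<integral>\<^sup>+g. ennreal (real (card (W - X g))) \<partial>\<nu>) \<le> ennreal (2 * \<epsilon> * real (card W))"
      using st(3)[OF _ X] unfolding V overfull_all_empty by simp
    also have "\<dots> \<le> ennreal (real (Suc 0) * (2 * \<epsilon> + \<delta>) * real (card W))"
      using \<delta> by (intro ennreal_leI mult_right_mono) auto
    finally show "(\<integral>\<^sup>+g. ennreal (real (card (W - X g))) \<partial>\<nu>) \<le> \<dots>" .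
    show "X g = X g'" if h: "\<forall>k i t. k \<in> set (take (Suc 0) us) \<longrightarrow> (k, i, t) \<in> block_idx K n \<longrightarrow> g (k, i, t) = g' (k, i, t)" for g g'
    proof -
      have "u \<in> set (take (Suc 0) us)" using 0 by (cases us) (auto simp: u_def)
      then show ?thesis unfolding X_def using h by (subst same_rel_cong[OF u(1), of g g']) auto
    qed
  qed
next
  case (Suc j)
  define u where "u = us ! j"
  define u' where "u' = us ! Suc j"
  have u: "u \<in> {1..K}" "u' \<in> {1..K}" "u' \<in> set us" "u \<noteq> u'"
    using us Suc.prems nth_mem[of j us] nth_mem[of "Suc j" us]
    by (auto simp: u_def u'_def nth_eq_iff_index_eq simp del: nth_mem)
  have take: "set (take (Suc (Suc j)) us) = insert u' (set (take (Suc j) us))"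
    using Suc.prems by (simp add: take_Suc_conv_app_nth u'_def insert_commute)
  \<comment> \<open>The receivers of the path are distinct, so the set \<open>Y\<close> built so far
    does not depend on the channel of the new receiver \<open>u'\<close>.\<close>
  have nin: "u' \<notin> set (take (Suc j) us)"
    using us(1) Suc.prems by (auto simp: u'_def in_set_conv_nth nth_eq_iff_index_eq)
  define V where "V = {1..K} - set (take (Suc (Suc j)) us)"
  have V: "insert u' V = {1..K} - set (take (Suc j) us)" using u take nin by (auto simp: V_def)
  define S where "S = L * (\<Prod>i<j. L * align \<eta> C (us ! i) (us ! Suc i) ^ n / \<delta>)"
  have S0: "0 < S"
    unfolding S_def L using \<delta> C by (intro mult_pos_pos prod_pos divide_pos_pos ballI zero_less_power align_pos) auto
  obtain Y where Y: "msg_family Y"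
    and inv: "\<And>g g'. (\<forall>k i t. k \<in> set (take (Suc j) us) \<longrightarrow> (k, i, t) \<in> block_idx K n \<longrightarrow> g (k, i, t) = g' (k, i, t)) \<Longrightarrow> Y g = Y g'"
    and pack: "\<And>g w. g \<in> space \<nu> \<Longrightarrow> w \<in> W \<Longrightarrow> real (card {w'\<in>Y g. agree (insert u' V) w w' \<and> same u g w w'}) \<le> S"
    and loss: "(\<integral>\<^sup>+g. ennreal (real (card (W - Y g))) \<partial>\<nu>) \<le> ennreal (real (Suc j) * (2 * \<epsilon> + \<delta>) * real (card W))"
    using Suc.IH Suc.prems unfolding V u_def S_def by force
  define a where "a = align \<eta> C u u' ^ n"
  have a0: "0 < a" using C by (simp add: a_def align_pos)
  \<comment> \<open>This threshold makes the bound on the mean fraction of overfull tuples exactly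
    \<open>\<delta>\<close>.\<close>
  define T where "T = S * a / \<delta>"
  have T0: "0 < T" using S0 a0 \<delta> by (simp add: T_def)
  define X where "X = (\<lambda>g. pick (agree V) (2 * (2 * exp 2) ^ n * T) (same_rel u' g) (Y g))"
  note st = expurgation_step[OF Y u(2) less_imp_le[OF T0] \<epsilon> err[OF u(3)] X_def]
  have "(\<integral>\<^sup>+g. ennreal (real (card (overfull (insert u' V) u' T g (Y g)))) \<partial>\<nu>)
      \<le> ennreal (S * align \<eta> C u u' ^ n / T * real (card W))"
  proof (rule nn_integral_overfull_le[OF Y u(1,2,4) _ pack less_imp_le[OF S0] T0 \<eta> C])
    fix g g' :: "nat \<times> nat \<times> nat \<Rightarrow> complex"
    assume "\<And>k i t. k \<noteq> u' \<Longrightarrow> (k, i, t) \<in> block_idx K n \<Longrightarrow> g (k, i, t) = g' (k, i, t)"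
    then show "Y g = Y g'" using nin by (intro inv) metis
  qed
  also have "S * align \<eta> C u u' ^ n / T = \<delta>"
    using S0 a0 \<delta> by (simp add: T_def a_def[symmetric])
  finally have over: "(\<integral>\<^sup>+g. ennreal (real (card (overfull (insert u' V) u' T g (Y g)))) \<partial>\<nu>) \<le> ennreal (\<delta> * real (card W))" .
  show ?case
  proof (intro exI[of _ X] conjI allI impI ballI)
    show "msg_family X" by (rule st(1))
    show "real (card {w'\<in>X g. agree ({1..K} - set (take (Suc (Suc j)) us)) w w' \<and> same (us ! Suc j) g w w'})
          \<le> L * (\<Prod>i<Suc j. L * align \<eta> C (us ! i) (us ! Suc i) ^ n / \<delta>)" if "g \<in> space \<nu>" "w \<in> W" for g w
    proof -
      have "L * (\<Prod>i<Suc j. L * align \<eta> C (us ! i) (us ! Suc i) ^ n / \<delta>) = 2 * (2 * exp 2) ^ n * T"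
        by (simp add: T_def S_def L a_def u_def u'_def)
      then show ?thesis using st(2)[OF that] by (simp add: V_def u'_def)
    qed
    have "(\<integral>\<^sup>+g. ennreal (real (card (W - X g))) \<partial>\<nu>) \<le> ennreal (real (Suc j) * (2 * \<epsilon> + \<delta>) * real (card W))
        + ennreal (2 * \<epsilon> * real (card W)) + ennreal (\<delta> * real (card W))"
      by (rule order_trans[OF st(3)]) (intro add_mono loss over order_refl)
    also have "\<dots> = ennreal (real (Suc (Suc j)) * (2 * \<epsilon> + \<delta>) * real (card W))"
      using \<epsilon> \<delta> by (subst ennreal_plus[symmetric], simp, simp)+ (simp add: algebra_simps)
    finally show "(\<integral>\<^sup>+g. ennreal (real (card (W - X g))) \<partial>\<nu>) \<le> \<dots>" .
    show "X g = X g'" if h: "\<forall>k i t. k \<in> set (take (Suc (Suc j)) us) \<longrightarrow> (k, i, t) \<in> block_idx K n \<longrightarrow> g (k, i, t) = g' (k, i, t)" for g g'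
    proof -
      have "Y g = Y g'" by (rule inv) (use h take in auto)
      moreover have "same_rel u' g = same_rel u' g'" by (rule same_rel_cong[OF u(2)]) (use h take in auto)
      ultimately show ?thesis by (simp add: X_def)
    qed
  qed
qed

text \<open>At the last receiver of the path the cells are counted, using the power constraint only.\<close>

lemma prod_messages_le:
  fixes us :: "nat list" and \<epsilon> \<delta> \<eta> C :: real
  assumes us: "distinct us" "set us \<subseteq> {1..K}" "us \<noteq> []"
    and err: "\<And>u. u \<in> set us \<Longrightarrow> (\<Sum>w\<in>W. \<integral>\<^sup>+g. err u w g \<partial>\<nu>) \<le> ennreal (\<epsilon> * real (card W))"
    and \<epsilon>: "0 \<le> \<epsilon>" and \<delta>: "0 < \<delta>" and \<eta>: "0 < \<eta>" and C: "1 \<le> C"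
    "\<And>Z. finite Z \<Longrightarrow> (\<Sum>z\<in>Z. (1 + cell_sq z) powr (- (1 + \<eta>))) \<le> C"
    and L: "L = 2 * (2 * exp 2) ^ n"
    and small: "real (length us) * (2 * \<epsilon> + \<delta>) < 1 / 2"
  shows "real (\<Prod>k\<in>set us. Mc k) \<le> 2 * (L * (\<Prod>i<length us - 1. L * align \<eta> C (us ! i) (us ! Suc i) ^ n / \<delta>)
     * (C * ((5 + 8 * (real K)\<^sup>2 * b\<^sup>2) * exp 1 * P powr \<alpha> (last us) (last us)) powr (1 + \<eta>)) ^ n)"
proof -
  interpret prob_space \<nu> by (rule prob)
  define u where "u = last us"
  have u: "u \<in> {1..K}" "u = us ! (length us - 1)" using us last_in_set[OF us(3)] last_conv_nth[OF us(3)] by (auto simp only: u_def)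
  define V where "V = {1..K} - set us"
  define S where "S = L * (\<Prod>i<length us - 1. L * align \<eta> C (us ! i) (us ! Suc i) ^ n / \<delta>)"
  define B where "B = (C * ((5 + 8 * (real K)\<^sup>2 * b\<^sup>2) * exp 1 * P powr \<alpha> u u) powr (1 + \<eta>)) ^ n"
  have S0: "0 < S"
    unfolding S_def L using \<delta> C by (intro mult_pos_pos prod_pos divide_pos_pos ballI zero_less_power align_pos) auto
  have B0: "0 \<le> B" using C by (simp add: B_def)
  obtain X where X: "msg_family X"
    and pack: "\<And>g w. g \<in> space \<nu> \<Longrightarrow> w \<in> W \<Longrightarrow> real (card {w'\<in>X g. agree V w w' \<and> same u g w w'}) \<le> S"
    and loss: "(\<integral>\<^sup>+g. ennreal (real (card (W - X g))) \<partial>\<nu>) \<le> ennreal (real (length us) * (2 * \<epsilon> + \<delta>) * real (card W))"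
  proof -
    have "length us - 1 < length us" "Suc (length us - 1) = length us" using us by auto
    then show thesis
      using expurgate_path[OF us(1,2) _ err \<epsilon> \<delta> \<eta> C L, of "length us - 1"] that
      unfolding V_def S_def u(2) by force
  qed
  have XW: "X g \<subseteq> W" "finite (X g)" for g
    using X finite_W by (auto simp: msg_family_def intro: finite_subset)
  \<comment> \<open>The mean fraction of discarded tuples is below 1/2, so some channel realization
    with bounded gains keeps at least half of them. From here on the channel is fixed.\<close>
  have "\<exists>g\<in>space \<nu>. bounded_gain g \<and> real (card (W - X g)) \<le> real (card W) / 2"
  proof (rule ccontr)
    assume "\<not> ?thesis"
    then have *: "real (card W) / 2 \<le> real (card (W - X g))" if "g \<in> space \<nu>" "bounded_gain g" for g
      using that by force
    have "ennreal (real (card W) / 2) = (\<integral>\<^sup>+g. ennreal (real (card W) / 2) \<partial>\<nu>)"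
      by (simp add: emeasure_space_1)
    also have "\<dots> \<le> (\<integral>\<^sup>+g. ennreal (real (card (W - X g))) \<partial>\<nu>)"
      using AE_space bounded
      by (intro nn_integral_mono_AE, eventually_elim) (intro ennreal_leI *, auto simp: bounded_gain_def)
    also have "\<dots> \<le> ennreal (real (length us) * (2 * \<epsilon> + \<delta>) * real (card W))" by (rule loss)
    finally have "real (card W) / 2 \<le> real (length us) * (2 * \<epsilon> + \<delta>) * real (card W)"
      using \<epsilon> \<delta> by (subst (asm) ennreal_le_iff) auto
    also have "\<dots> < 1 / 2 * real (card W)"
      using small card_W_pos by (intro mult_strict_right_mono) auto
    finally show False by simp
  qed
  then obtain g where g: "g \<in> space \<nu>" "bounded_gain g" and half: "real (card (W - X g)) \<le> real (card W) / 2"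
    by blast
  have "card (W - X g) = card W - card (X g)" "card (X g) \<le> card W"
    using XW[of g] finite_W by (auto intro!: card_Diff_subset card_mono)
  then have half': "real (card W) \<le> 2 * real (card (X g))" using half by linarith
  define Q where "Q = PiE V (\<lambda>k. {..<Mc k})"
  have finQ: "finite Q" by (auto simp: Q_def V_def intro: finite_PiE)
  have cls: "real (card {w'\<in>X g. restrict w' V = q}) \<le> S * B" for q
  proof (cases "{w'\<in>X g. restrict w' V = q} = {}")
    case True
    then show ?thesis using S0 B0 by (simp only: card.empty) simp
  next
    case False
    then obtain w where w: "w \<in> X g" "restrict w V = q" by auto
    define Z where "Z = {w'\<in>X g. restrict w' V = q}"
    have Z: "Z \<subseteq> W" using XW by (auto simp: Z_def)
    have agV: "agree V w1 w2" if "w1 \<in> Z" "w2 \<in> Z" for w1 w2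
      using that unfolding Z_def agree_def by (metis (mono_tags, lifting) mem_Collect_eq restrict_apply')
    \<comment> \<open>With exponent 0 every factor equals 1, so the weighted sum counts the tuples.
      The base must be nonzero because \<open>0 powr 0 = 0\<close>.\<close>
    have "real (card Z) = (\<Sum>w'\<in>Z. \<Prod>t<n. (1 + cell_sq (cell_diff (s u w' g t) (s u w g t))) powr (- 0))"
    proof -
      have "1 + cell_sq z \<noteq> 0" for z using cell_sq_nonneg[of z] by linarith
      then show ?thesis by simp
    qed
    also have "\<dots> \<le> S * (C * ((5 + 8 * (real K)\<^sup>2 * b\<^sup>2) * exp 1 * P powr \<alpha> u u) powr (1 + \<eta> - 0)) ^ n"
    proof (rule sum_packed_cells_le[OF g(2) u(1) _ Z])
      show "w \<in> W" using w XW by auto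
      fix w' assume w': "w' \<in> Z"
      have "card {w''\<in>Z. same u g w' w''} \<le> card {w''\<in>X g. agree V w' w'' \<and> same u g w' w''}"
        using w' XW[of g] agV by (intro card_mono) (auto simp: Z_def)
      also have "real \<dots> \<le> S" using pack[OF g(1)] w' Z by auto
      finally show "real (card {w''\<in>Z. same u g w' w''}) \<le> S" by simp
    qed (use S0 \<eta> C in auto)
    finally show ?thesis by (simp add: Z_def B_def)
  qed
  have "X g \<subseteq> (\<Union>q\<in>Q. {w'\<in>X g. restrict w' V = q})"
  proof
    fix w assume w: "w \<in> X g"
    then have "w \<in> PiE {1..K} (\<lambda>k. {..<Mc k})" using XW(1)[of g] by (auto simp: msgs_def)
    then have "restrict w V \<in> Q" unfolding Q_def V_def by (intro restrict_PiE_iff[THEN iffD2]) (auto simp: PiE_iff)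
    then show "w \<in> (\<Union>q\<in>Q. {w'\<in>X g. restrict w' V = q})" using w by blast
  qed
  then have "card (X g) \<le> (\<Sum>q\<in>Q. card {w'\<in>X g. restrict w' V = q})"
    by (intro order_trans[OF card_mono card_UN_le]) (use finQ XW in auto)
  then have "real (card (X g)) \<le> (\<Sum>q\<in>Q. real (card {w'\<in>X g. restrict w' V = q}))"
    unfolding of_nat_sum[symmetric] by (rule of_nat_mono)
  also have "\<dots> \<le> (\<Sum>q\<in>Q. S * B)" by (intro sum_mono cls)
  also have "\<dots> = real (\<Prod>k\<in>V. Mc k) * (S * B)" by (simp add: Q_def card_PiE V_def)
  finally have le: "real (card W) \<le> real (\<Prod>k\<in>V. Mc k) * (2 * (S * B))" using half' by simp
  have "card W = (\<Prod>k\<in>V. Mc k) * (\<Prod>k\<in>set us. Mc k)"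
    unfolding card_W V_def using us(2) by (intro prod.subset_diff) auto
  then have eq: "real (card W) = real (\<Prod>k\<in>V. Mc k) * real (\<Prod>k\<in>set us. Mc k)"
    by (simp only: of_nat_mult)
  have "0 < Mc k" if "k \<in> V" for k
    using Mc1[of k] that unfolding V_def Diff_iff by linarith
  then have "0 < real (\<Prod>k\<in>V. Mc k)" by (simp add: prod_pos)
  \<comment> \<open>The number of message tuples of the users outside the path occurs on both sides
    and cancels.\<close>
  from mult_left_le_imp_le[OF le[unfolded eq] this]
  have "real (\<Prod>k\<in>set us. Mc k) \<le> 2 * (S * B)" .
  then show ?thesis by (simp only: S_def B_def u_def mult.assoc)
qed

end

section \<open>From codes to the GDoF region\<close>

text \<open>One pair of constants serves all block lengths. For \<open>S\<close> inside a block,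
  \<open>S\<close> and the rest of the block are finite and disjoint, so the density hypothesis for
  the whole process applies to them.\<close>

lemma block_channel_of_admissible:
  assumes "admissible_channel K \<mu>"
  obtains b fmax where "\<And>n. block_channel K n
      (distr \<mu> (PiM (block_idx K n) (\<lambda>_. lborel)) (\<lambda>g. restrict g (block_idx K n))) b fmax"
proof -
  have pr: "prob_space \<mu>" and sm: "sets \<mu> = sets (PiM (chan_idx K) (\<lambda>_. borel))"
    using assms by (auto simp: admissible_channel_def)
  obtain fmax where fmax: "0 < fmax" and dens: "\<And>S T. finite S \<and> finite T \<and> S \<subseteq> chan_idx K \<and> T \<subseteq> chan_idx K \<and> S \<inter> T = {} \<Longrightarrow>
        (\<exists>fST fT.
           fST \<in> borel_measurable (PiM (S \<union> T) (\<lambda>_. lborel)) \<and>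
           fT \<in> borel_measurable (PiM T (\<lambda>_. lborel)) \<and>
           distr \<mu> (PiM (S \<union> T) (\<lambda>_. lborel)) (\<lambda>g. restrict g (S \<union> T))
             = density (PiM (S \<union> T) (\<lambda>_. lborel)) fST \<and>
           distr \<mu> (PiM T (\<lambda>_. lborel)) (\<lambda>g. restrict g T)
             = density (PiM T (\<lambda>_. lborel)) fT \<and>
           (AE x in PiM (S \<union> T) (\<lambda>_. lborel).
              fST x \<le> ennreal (fmax ^ card S) * fT (restrict x T)))"
    using assms unfolding admissible_channel_def by blast
  obtain a b where ab: "0 < a" "a \<le> b" "AE g in \<mu>. \<forall>x\<in>chan_idx K. a \<le> cmod (g x) \<and> cmod (g x) \<le> b"
    using assms unfolding admissible_channel_def by blast
  have sub: "block_idx K n \<subseteq> chan_idx K" for n by (auto simp: block_idx_def chan_idx_def)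
  have lb: "sets (PiM A (\<lambda>_. lborel)) = sets (PiM A (\<lambda>_. borel :: complex measure))"
    for A :: "(nat \<times> nat \<times> nat) set" by (intro sets_PiM_cong) auto
  have mr: "(\<lambda>g. restrict g A) \<in> measurable \<mu> (PiM A (\<lambda>_. lborel))" if "A \<subseteq> chan_idx K" for A
    using measurable_restrict_subset[OF that, of "\<lambda>_. borel :: complex measure"]
    by (simp add: sm lb cong: measurable_cong_sets)
  show thesis
  proof (rule that[of b fmax])
    fix n
    let ?B = "block_idx K n"
    let ?\<nu> = "distr \<mu> (PiM ?B (\<lambda>_. lborel)) (\<lambda>g. restrict g ?B)"
    show "block_channel K n ?\<nu> b fmax"
    proof (rule block_channel.intro)
      show "prob_space ?\<nu>" by (rule prob_space.prob_space_distr[OF pr mr[OF sub]])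
      show "sets ?\<nu> = sets (PiM ?B (\<lambda>_. borel))" by (simp add: lb)
      show "0 < fmax" "0 < b" using fmax ab by auto
      have "{g \<in> space (PiM ?B (\<lambda>_. lborel)). \<forall>x\<in>?B. cmod (g x) \<le> b} \<in> sets (PiM ?B (\<lambda>_. lborel))"
      proof (rule sets.sets_Collect_finite_All)
        fix x assume "x \<in> ?B"
        then have [measurable]: "(\<lambda>g. g x) \<in> borel_measurable (PiM ?B (\<lambda>_. lborel :: complex measure))"
          by simp
        show "{g \<in> space (PiM ?B (\<lambda>_. lborel)). cmod (g x) \<le> b} \<in> sets (PiM ?B (\<lambda>_. lborel))" by measurable
      qed simp
      then show "AE g in ?\<nu>. \<forall>x\<in>?B. cmod (g x) \<le> b"
        using ab(3) sub[of n] by (subst AE_distr_iff[OF mr[OF sub]]) auto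
      fix S assume S: "S \<subseteq> ?B"
      let ?T = "?B - S"
      have ST: "S \<union> ?T = ?B" using S by auto
      have fin: "finite S \<and> finite ?T \<and> S \<subseteq> chan_idx K \<and> ?T \<subseteq> chan_idx K \<and> S \<inter> ?T = {}"
        using S sub[of n] finite_subset[OF S] by auto
      have "distr ?\<nu> (PiM ?T (\<lambda>_. lborel)) (\<lambda>g. restrict g ?T) = distr \<mu> (PiM ?T (\<lambda>_. lborel)) (\<lambda>g. restrict g ?T)"
      proof -
        have "(\<lambda>g. restrict g ?T) \<in> measurable (PiM ?B (\<lambda>_. lborel :: complex measure)) (PiM ?T (\<lambda>_. lborel))"
          by (rule measurable_restrict_subset) auto
        from distr_distr[OF this mr[OF sub]] show ?thesis
          by (simp add: comp_def Int_absorb1)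
      qed
      with dens[OF fin] show "\<exists>fST fT.
          fST \<in> borel_measurable (PiM ?B (\<lambda>_. lborel)) \<and>
          fT \<in> borel_measurable (PiM ?T (\<lambda>_. lborel)) \<and>
          ?\<nu> = density (PiM ?B (\<lambda>_. lborel)) fST \<and>
          distr ?\<nu> (PiM ?T (\<lambda>_. lborel)) (\<lambda>g. restrict g ?T) = density (PiM ?T (\<lambda>_. lborel)) fT \<and>
          (AE x in PiM ?B (\<lambda>_. lborel). fST x \<le> ennreal (fmax ^ card S) * fT (restrict x ?T))"
        unfolding ST by simp
    qed
  qed
qed

text \<open>The received block depends only on the channel coefficients of that block, so the error
  may be integrated under the block law. Multiplying by the number of message tuples undoes the
  averaging in \<open>err_prob\<close>.\<close>

lemma (in bc_code) sum_err_le: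
  assumes \<nu>: "\<nu> = distr \<mu> (PiM (block_idx K n) (\<lambda>_. lborel)) (\<lambda>g. restrict g (block_idx K n))"
    and m: "(\<lambda>g. restrict g (block_idx K n)) \<in> measurable \<mu> (PiM (block_idx K n) (\<lambda>_. lborel))"
    and u: "u \<in> {1..K}" and \<epsilon>: "0 \<le> \<epsilon>"
    and le: "err_prob K \<alpha> \<mu> P n Mc enc dec u \<le> ennreal \<epsilon>"
  shows "(\<Sum>w\<in>W. \<integral>\<^sup>+g. err u w g \<partial>\<nu>) \<le> ennreal (\<epsilon> * real (card W))"
proof -
  have int: "(\<integral>\<^sup>+g. err u w g \<partial>\<nu>) = (\<integral>\<^sup>+g. (\<integral>\<^sup>+z.
        (if dec u (restrict (rx K \<alpha> P (\<lambda>i t. enc i w t) g z u) {..<n}) (restrict g (block_idx K n)) \<noteq> w u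
         then 1 else 0) \<partial>noise n) \<partial>\<mu>)" for w
  proof -
    have "(\<integral>\<^sup>+g. err u w g \<partial>\<nu>) = (\<integral>\<^sup>+g. err u w (restrict g (block_idx K n)) \<partial>\<mu>)"
      using nn_integral_distr[OF m, of "err u w"] measurable_err[OF u, of w] unfolding \<nu> by blast
    also have "\<dots> = (\<integral>\<^sup>+g. (\<integral>\<^sup>+z.
        (if dec u (restrict (rx K \<alpha> P (\<lambda>i t. enc i w t) g z u) {..<n}) (restrict g (block_idx K n)) \<noteq> w u
         then 1 else 0) \<partial>noise n) \<partial>\<mu>)"
    proof (intro nn_integral_cong)
      fix g
      have "s u w (restrict g (block_idx K n)) t = s u w g t" if "t < n" for t
        using u that by (intro sig_cong_block) (auto simp: block_idx_def)
      then have "(\<lambda>t\<in>{..<n}. s u w (restrict g (block_idx K n)) t + z t)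
          = restrict (rx K \<alpha> P (\<lambda>i t. enc i w t) g z u) {..<n}" for z
        by (auto simp: rx_eq_sig fun_eq_iff restrict_def)
      then show "err u w (restrict g (block_idx K n)) = (\<integral>\<^sup>+z.
        (if dec u (restrict (rx K \<alpha> P (\<lambda>i t. enc i w t) g z u) {..<n}) (restrict g (block_idx K n)) \<noteq> w u
         then 1 else 0) \<partial>noise n)"
        by (simp add: err_def)
    qed
    finally show ?thesis .
  qed
  have c0: "0 < real (card W)" using card_W_pos by simp
  have "(\<Sum>w\<in>W. \<integral>\<^sup>+g. err u w g \<partial>\<nu>)
      = ennreal (real (card W)) * (ennreal (1 / real (card W)) * (\<Sum>w\<in>W. \<integral>\<^sup>+g. err u w g \<partial>\<nu>))"
    using c0 by (simp add: mult.assoc[symmetric] ennreal_mult'[symmetric] del: ennreal_mult')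
  also have "ennreal (1 / real (card W)) * (\<Sum>w\<in>W. \<integral>\<^sup>+g. err u w g \<partial>\<nu>) = err_prob K \<alpha> \<mu> P n Mc enc dec u"
    unfolding err_prob_def int ..
  also have "ennreal (real (card W)) * err_prob K \<alpha> \<mu> P n Mc enc dec u \<le> ennreal (real (card W)) * ennreal \<epsilon>"
    by (intro mult_left_mono le) simp
  also have "\<dots> = ennreal (\<epsilon> * real (card W))"
    using \<epsilon> by (simp add: ennreal_mult[symmetric] mult.commute)
  finally show ?thesis .
qed

text \<open>Taking logarithms and dividing by \<open>n\<close> turns every factor of the form
  \<open>c ^ n\<close> into a constant. Hence \<open>Z\<close> depends on neither \<open>P\<close>,
  the rates nor the block length, and only the powers of \<open>P\<close> remain.\<close>

lemma rate_bound:
  fixes us :: "nat list" and \<eta> :: real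
  assumes sls: "SLS K \<alpha>" and adm: "admissible_channel K \<mu>"
    and us: "distinct us" "set us \<subseteq> {1..K}" "us \<noteq> []" and \<eta>: "0 < \<eta>"
  obtains Z where "\<And>P R. 1 \<le> P \<Longrightarrow> achievable K \<alpha> \<mu> P R \<Longrightarrow>
    (\<Sum>k\<in>set us. R k) \<le> Z + ((\<Sum>i<length us - 1. \<alpha> (us ! i) (us ! i) - \<alpha> (us ! Suc i) (us ! i) + \<eta> * \<alpha> (us ! i) (us ! i))
       + (1 + \<eta>) * \<alpha> (last us) (last us)) * ln P"
proof -
  obtain b fmax where bc: "\<And>n. block_channel K n
      (distr \<mu> (PiM (block_idx K n) (\<lambda>_. lborel)) (\<lambda>g. restrict g (block_idx K n))) b fmax"
    using block_channel_of_admissible[OF adm] by blast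
  obtain C where C: "1 \<le> C" "\<And>Z. finite Z \<Longrightarrow> (\<Sum>z\<in>Z. (1 + cell_sq z) powr (- (1 + \<eta>))) \<le> C"
    using sum_cell_powr_bounded[OF \<eta>] by blast
  have fmax: "0 < fmax" using bc[of 0] by (rule block_channel.fmax_pos)
  define m where "m = length us"
  have m: "1 \<le> m" using us by (cases us) (auto simp: m_def)
  define c2 where "c2 = (5 + 8 * (real K)\<^sup>2 * b\<^sup>2) * exp 1"
  define A0 where "A0 = 5 * (2 + 8 * pi * fmax) * (1 + (real K)\<^sup>2 * b\<^sup>2)"
  define a0 where "a0 = A0 * C * c2 powr \<eta>"
  define e where "e i = \<alpha> (us ! i) (us ! i) - \<alpha> (us ! Suc i) (us ! i) + \<eta> * \<alpha> (us ! i) (us ! i)" for i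
  \<comment> \<open>The constant of one step of the path: \<open>4 * exp 2\<close> for
    \<open>L\<close>, \<open>a0\<close> for \<open>align\<close> and \<open>8 * m\<close> for
    \<open>1 / \<delta>\<close>, each taken per channel use.\<close>
  define k0 where "k0 = (4 * exp 2) * a0 * (8 * real m)"
  define Z0 where "Z0 = 2 * ((4 * exp 2) * k0 ^ (m - 1) * (C * c2 powr (1 + \<eta>)))"
  have c2: "0 < c2" by (auto simp: c2_def intro!: mult_pos_pos add_pos_nonneg)
  have A0: "0 < A0" using fmax by (auto simp: A0_def intro!: mult_pos_pos add_pos_nonneg)
  have a0: "0 < a0" using A0 C c2 by (simp add: a0_def)
  have k0: "0 < k0" using a0 m by (simp add: k0_def)
  have Z0: "0 < Z0" using k0 C c2 by (simp add: Z0_def)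
  let ?E = "(\<Sum>i<m - 1. e i) + (1 + \<eta>) * \<alpha> (last us) (last us)"
  have "(\<Sum>k\<in>set us. R k) \<le> ln Z0 + ?E * ln P" if P: "1 \<le> P" and ach: "achievable K \<alpha> \<mu> P R" for P R
  proof -
    \<comment> \<open>The same number bounds the error probability of the code and the loss from
      overfull cells in each step; the total loss is \<open>3 * m * \<delta> = 3/8\<close>, below
      1/2.\<close>
    define \<delta> where "\<delta> = 1 / (8 * real m)"
    have \<delta>: "0 < \<delta>" using m by (simp add: \<delta>_def)
    obtain n Mc enc dec where n: "1 \<le> n"
      and rate: "\<forall>k\<in>{1..K}. 1 \<le> Mc k \<and> real n * R k \<le> ln (real (Mc k))"
      and pow: "\<forall>i\<in>{1..K}. \<forall>w\<in>msgs K Mc. (\<Sum>t<n. (cmod (enc i w t))\<^sup>2) \<le> real n"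
      and dec: "\<forall>k\<in>{1..K}. (\<lambda>(y, g). dec k y g) \<in>
            measurable (PiM {..<n} (\<lambda>_. borel) \<Otimes>\<^sub>M PiM (block_idx K n) (\<lambda>_. borel)) (count_space UNIV)"
      and errp: "\<forall>k\<in>{1..K}. err_prob K \<alpha> \<mu> P n Mc enc dec k \<le> ennreal \<delta>"
      using ach \<delta> unfolding achievable_def by blast
    define \<nu> where "\<nu> = distr \<mu> (PiM (block_idx K n) (\<lambda>_. lborel)) (\<lambda>g. restrict g (block_idx K n))"
    interpret bc_code K n \<nu> b fmax \<alpha> P Mc enc dec
      unfolding bc_code_def bc_code_axioms_def using bc[of n, folded \<nu>_def] sls P rate pow dec by blast
    have mr: "(\<lambda>g. restrict g (block_idx K n)) \<in> measurable \<mu> (PiM (block_idx K n) (\<lambda>_. lborel))"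
    proof -
      have "block_idx K n \<subseteq> chan_idx K" by (auto simp: block_idx_def chan_idx_def)
      from measurable_restrict_subset[OF this, of "\<lambda>_. borel :: complex measure"]
      have "(\<lambda>g. restrict g (block_idx K n)) \<in> measurable \<mu> (PiM (block_idx K n) (\<lambda>_. borel))"
        using adm by (simp add: admissible_channel_def cong: measurable_cong_sets)
      moreover have "sets (PiM (block_idx K n) (\<lambda>_. lborel)) = sets (PiM (block_idx K n) (\<lambda>_. borel :: complex measure))"
        by (intro sets_PiM_cong) auto
      ultimately show ?thesis by (simp cong: measurable_cong_sets)
    qed
    define L where "L = 2 * (2 * exp (2::real)) ^ n"
    \<comment> \<open>As \<open>1 \<le> n\<close>, a constant that is at least 1 is bounded by its
      own \<open>n\<close>-th power. All constants are put under one common \<open>n\<close>-th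
      power in this way.\<close>
    have two: "2 \<le> (2::real) ^ n" using n power_increasing[of 1 n "2::real"] by simp
    have L: "L \<le> (4 * exp 2) ^ n" "0 \<le> L"
    proof -
      have "L \<le> 2 ^ n * (2 * exp 2) ^ n" unfolding L_def by (intro mult_right_mono two) auto
      also have "\<dots> = (4 * exp 2) ^ n" unfolding power_mult_distrib[symmetric] by simp
      finally show "L \<le> (4 * exp 2) ^ n" .
    qed (simp add: L_def)
    have d8: "1 / \<delta> \<le> (8 * real m) ^ n"
    proof -
      have "1 \<le> 8 * real m" using m by simp
      then have "(8 * real m) ^ 1 \<le> (8 * real m) ^ n" using n by (intro power_increasing) auto
      then show ?thesis by (simp add: \<delta>_def)
    qed
    have al: "align \<eta> C (us ! i) (us ! Suc i) = a0 * P powr e i" for i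
    proof -
      have "align \<eta> C (us ! i) (us ! Suc i)
         = A0 * P powr (\<alpha> (us ! i) (us ! i) - \<alpha> (us ! Suc i) (us ! i)) * (C * (c2 powr \<eta> * P powr (\<alpha> (us ! i) (us ! i) * \<eta>)))"
        unfolding align_def A0_def[symmetric] c2_def[symmetric] by (simp add: powr_mult powr_powr)
      then show ?thesis by (simp add: a0_def e_def powr_add mult_ac)
    qed
    have la: "(c2 * P powr \<alpha> (last us) (last us)) powr (1 + \<eta>) = c2 powr (1 + \<eta>) * P powr ((1 + \<eta>) * \<alpha> (last us) (last us))"
      by (simp add: powr_mult powr_powr mult.commute)
    have er: "(\<Sum>w\<in>msgs K Mc. \<integral>\<^sup>+g. err u w g \<partial>\<nu>) \<le> ennreal (\<delta> * real (card (msgs K Mc)))" if "u \<in> set us" for u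
      using that us errp \<delta> by (intro sum_err_le[OF \<nu>_def mr]) auto
    have sm: "real (length us) * (2 * \<delta> + \<delta>) < 1 / 2" using m by (simp add: \<delta>_def m_def[symmetric])
    have "real (\<Prod>k\<in>set us. Mc k) \<le> 2 * (L * (\<Prod>i<m - 1. L * (a0 * P powr e i) ^ n / \<delta>)
       * (C * (c2 powr (1 + \<eta>) * P powr ((1 + \<eta>) * \<alpha> (last us) (last us)))) ^ n)"
      using prod_messages_le[OF us er less_imp_le[OF \<delta>] \<delta> \<eta> C L_def sm]
      unfolding al c2_def[symmetric] la m_def .
    also have "\<dots> \<le> 2 ^ n * ((4 * exp 2) ^ n * (\<Prod>i<m - 1. (4 * exp 2) ^ n * (a0 * P powr e i) ^ n * (8 * real m) ^ n)
       * (C * (c2 powr (1 + \<eta>) * P powr ((1 + \<eta>) * \<alpha> (last us) (last us)))) ^ n)"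
    proof (intro mult_mono two order_refl prod_mono conjI L)
      fix i
      show "0 \<le> L * (a0 * P powr e i) ^ n / \<delta>" using L a0 \<delta> by simp
      have "L * (a0 * P powr e i) ^ n * (1 / \<delta>) \<le> (4 * exp 2) ^ n * (a0 * P powr e i) ^ n * (8 * real m) ^ n"
        using L a0 \<delta> by (intro mult_mono d8 order_refl) auto
      then show "L * (a0 * P powr e i) ^ n / \<delta> \<le> (4 * exp 2) ^ n * (a0 * P powr e i) ^ n * (8 * real m) ^ n" by simp
    qed (use L a0 \<delta> C in \<open>auto intro!: prod_nonneg mult_nonneg_nonneg\<close>)
    also have "\<dots> = (2 * ((4 * exp 2) * (\<Prod>i<m - 1. (4 * exp 2) * (a0 * P powr e i) * (8 * real m))
       * (C * (c2 powr (1 + \<eta>) * P powr ((1 + \<eta>) * \<alpha> (last us) (last us)))))) ^ n"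
      by (simp only: power_mult_distrib prod_power_distrib)
    also have "(\<Prod>i<m - 1. (4 * exp 2) * (a0 * P powr e i) * (8 * real m)) = (\<Prod>i<m - 1. k0 * P powr e i)"
      by (intro prod.cong refl) (simp add: k0_def)
    also have "\<dots> = k0 ^ (m - 1) * P powr (\<Sum>i<m - 1. e i)"
      using P by (simp add: prod.distrib powr_sum)
    also have "2 * ((4 * exp 2) * (k0 ^ (m - 1) * P powr (\<Sum>i<m - 1. e i))
       * (C * (c2 powr (1 + \<eta>) * P powr ((1 + \<eta>) * \<alpha> (last us) (last us))))) = Z0 * P powr ?E"
      unfolding Z0_def powr_add by (simp only: mult_ac)
    finally have fin: "real (\<Prod>k\<in>set us. Mc k) \<le> (Z0 * P powr ?E) ^ n" .
    have Mpos: "0 < real (Mc k)" if "k \<in> set us" for k using that us rate by force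
    have "real n * (\<Sum>k\<in>set us. R k) \<le> (\<Sum>k\<in>set us. ln (real (Mc k)))"
      unfolding sum_distrib_left using us rate by (intro sum_mono) auto
    also have "\<dots> = ln (real (\<Prod>k\<in>set us. Mc k))"
      using Mpos by (simp add: ln_prod)
    also have "\<dots> \<le> ln ((Z0 * P powr ?E) ^ n)"
      using fin Mpos P by (subst ln_le_cancel_iff) (auto intro!: prod_pos zero_less_power mult_pos_pos Z0)
    also have "\<dots> = real n * (ln Z0 + ?E * ln P)"
      using Z0 P by (simp add: ln_realpow ln_mult ln_powr)
    finally show ?thesis using n by simp
  qed
  then show thesis using that unfolding e_def m_def by blast
qed

text \<open>A cycle opened at any of its edges is such a path.\<close>

lemma gdof_path_bound:
  fixes us :: "nat list"
  assumes sls: "SLS K \<alpha>" and adm: "admissible_channel K \<mu>"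
    and us: "distinct us" "set us \<subseteq> {1..K}" "us \<noteq> []" and d: "d \<in> gdof_region K \<alpha> \<mu>"
  shows "(\<Sum>k\<in>set us. d k) \<le> (\<Sum>i<length us - 1. \<alpha> (us ! i) (us ! i) - \<alpha> (us ! Suc i) (us ! i)) + \<alpha> (last us) (last us)"
proof -
  obtain R :: "real \<Rightarrow> nat \<Rightarrow> real" where R: "\<forall>\<^sub>F P in at_top. achievable K \<alpha> \<mu> P (R P)"
    "\<And>k. k \<in> {1..K} \<Longrightarrow> ((\<lambda>P. R P k / ln P) \<longlongrightarrow> d k) at_top"
    using d unfolding gdof_region_def by blast
  define A where "A = (\<Sum>i<length us - 1. \<alpha> (us ! i) (us ! i) - \<alpha> (us ! Suc i) (us ! i)) + \<alpha> (last us) (last us)"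
  \<comment> \<open>\<open>B\<close> collects the direct gains that are multiplied by the excess
    exponent \<open>\<eta>\<close>.\<close>
  define B where "B = (\<Sum>i<length us - 1. \<alpha> (us ! i) (us ! i)) + \<alpha> (last us) (last us)"
  have le: "(\<Sum>k\<in>set us. d k) \<le> A + \<eta> * B" if \<eta>: "0 < \<eta>" for \<eta>
  proof -
    obtain Z where Z: "\<And>P R. 1 \<le> P \<Longrightarrow> achievable K \<alpha> \<mu> P R \<Longrightarrow>
      (\<Sum>k\<in>set us. R k) \<le> Z + ((\<Sum>i<length us - 1. \<alpha> (us ! i) (us ! i) - \<alpha> (us ! Suc i) (us ! i) + \<eta> * \<alpha> (us ! i) (us ! i))
       + (1 + \<eta>) * \<alpha> (last us) (last us)) * ln P"
      using rate_bound[OF sls adm us \<eta>] by blast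
    have AB: "(\<Sum>i<length us - 1. \<alpha> (us ! i) (us ! i) - \<alpha> (us ! Suc i) (us ! i) + \<eta> * \<alpha> (us ! i) (us ! i))
       + (1 + \<eta>) * \<alpha> (last us) (last us) = A + \<eta> * B"
      unfolding A_def B_def sum.distrib sum_distrib_left distrib_left distrib_right by simp
    have "((\<lambda>P. \<Sum>k\<in>set us. R P k / ln P) \<longlongrightarrow> (\<Sum>k\<in>set us. d k)) at_top"
      using us(2) by (intro tendsto_sum R) auto
    moreover have "((\<lambda>P. Z / ln P + (A + \<eta> * B)) \<longlongrightarrow> 0 + (A + \<eta> * B)) at_top"
      by (intro tendsto_add tendsto_const tendsto_divide_0[OF tendsto_const])
        (auto intro: filterlim_at_top_imp_at_infinity ln_at_top)
    moreover have "\<forall>\<^sub>F P in at_top. (\<Sum>k\<in>set us. R P k / ln P) \<le> Z / ln P + (A + \<eta> * B)"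
      using R(1) eventually_gt_at_top[of 1]
    proof eventually_elim
      case (elim P)
      then have l: "0 < ln P" by simp
      have "(\<Sum>k\<in>set us. R P k / ln P) = (\<Sum>k\<in>set us. R P k) / ln P" by (simp add: sum_divide_distrib)
      also have "\<dots> \<le> (Z + (A + \<eta> * B) * ln P) / ln P"
        using Z[of P "R P"] elim l unfolding AB by (intro divide_right_mono) auto
      also have "\<dots> = Z / ln P + (A + \<eta> * B)" using l by (simp add: add_divide_distrib)
      finally show ?case .
    qed
    ultimately show ?thesis by (intro tendsto_le[OF trivial_limit_at_top_linorder]) auto
  qed
  \<comment> \<open>\<open>\<eta>\<close> is sent to 0 only after \<open>P\<close> has gone to
    infinity, because the constant \<open>Z\<close> depends on \<open>\<eta>\<close>.\<close>
  have "((\<lambda>\<eta>. A + \<eta> * B) \<longlongrightarrow> A + 0 * B) (at_right 0)"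
    by (intro tendsto_intros)
  then have "(\<Sum>k\<in>set us. d k) \<le> A + 0 * B"
  proof (rule tendsto_lowerbound)
    show "\<forall>\<^sub>F \<eta> in at_right 0. (\<Sum>k\<in>set us. d k) \<le> A + \<eta> * B"
      using eventually_at_right_less by eventually_elim (rule le)
  qed simp
  then show ?thesis by (simp add: A_def)
qed

text \<open>Rotation by \<open>Suc m\<close> opens the cycle at the edge leaving position
  \<open>m\<close>: the path starts at the next position and ends at \<open>m\<close>. The path sum
  omits the term \<open>f m\<close> of that edge and adds the direct gain at \<open>m\<close>
  instead, which leaves exactly the cross gain of the opened edge.\<close>

lemma Delta_rotate:
  assumes "distinct \<pi>" "2 \<le> length \<pi>" "m < length \<pi>" and us: "us = rotate (Suc m) \<pi>"
  shows "(\<Sum>i<length us - 1. \<alpha> (us ! i) (us ! i) - \<alpha> (us ! Suc i) (us ! i)) + \<alpha> (last us) (last us)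
    = Delta \<alpha> \<pi> + \<alpha> (\<pi> ! ((m + 1) mod length \<pi>)) (\<pi> ! m)"
proof -
  define M where "M = length \<pi>"
  have M: "2 \<le> M" "m < M" "length us = M" using assms by (auto simp: M_def)
  define f where "f j = \<alpha> (\<pi> ! j) (\<pi> ! j) - \<alpha> (\<pi> ! (Suc j mod M)) (\<pi> ! j)" for j
  define r where "r i = (Suc m + i) mod M" for i
  have nth: "us ! i = \<pi> ! r i" if "i < M" for i
    using that unfolding us r_def M_def by (rule nth_rotate)
  have r_less: "r i < M" for i using M by (simp add: r_def)
  have r_Suc: "r (Suc i) = Suc (r i) mod M" for i by (simp add: r_def mod_Suc_eq)
  have r_last: "r (M - 1) = m" using M by (simp add: r_def)
  have r_0: "r 0 = Suc m mod M" by (simp add: r_def)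
  have "distinct us" using assms by simp
  then have inj: "inj_on r {..<M}"
    using M nth by (auto simp: inj_on_def distinct_conv_nth) metis
  have bij: "bij_betw r {..<M} {..<M}"
    unfolding bij_betw_def using inj r_less endo_inj_surj[of "{..<M}" r] by blast
  have "delta \<alpha> (\<pi> ! j) (\<pi> ! ((j + 1) mod M)) = f j" if "j < M" for j
  proof -
    \<comment> \<open>A cycle of length at least 2 has no loops, so \<open>delta\<close> takes its
      second branch.\<close>
    have "Suc j mod M \<noteq> j" "Suc j mod M < M" using M that by (auto simp: mod_Suc)
    then have "\<pi> ! j \<noteq> \<pi> ! (Suc j mod M)"
      using assms(1) that by (auto simp: M_def nth_eq_iff_index_eq)
    then show ?thesis by (simp add: delta_def f_def)
  qed
  then have "Delta \<alpha> \<pi> = (\<Sum>j<M. f j)"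
    using M by (auto simp: Delta_def M_def[symmetric] intro!: sum.cong)
  also have "\<dots> = (\<Sum>i<M. f (r i))" by (rule sum.reindex_bij_betw[OF bij, symmetric])
  also have "{..<M} = insert (M - 1) {..<M - 1}" using M by auto
  also have "(\<Sum>i\<in>insert (M - 1) {..<M - 1}. f (r i)) = f m + (\<Sum>i<M - 1. f (r i))"
    using r_last by simp
  also have "(\<Sum>i<M - 1. f (r i)) = (\<Sum>i<M - 1. \<alpha> (us ! i) (us ! i) - \<alpha> (us ! Suc i) (us ! i))"
    by (intro sum.cong refl) (simp add: nth f_def r_Suc)
  finally have "Delta \<alpha> \<pi> = f m + (\<Sum>i<M - 1. \<alpha> (us ! i) (us ! i) - \<alpha> (us ! Suc i) (us ! i))" .
  moreover have "last us = \<pi> ! m"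
    using M nth[of "M - 1"] r_last by (subst last_conv_nth) auto
  ultimately show ?thesis by (simp add: f_def M(3) M_def[symmetric])
qed

text \<open>Only user \<open>k\<close> is active. The single cycle inside \<open>{k}\<close> is
  \<open>[k]\<close>, so that user can be given all of \<open>\<alpha> k k\<close>.\<close>

lemma alpha_le_D_sum_TINA:
  assumes "SLS K \<alpha>" "k \<in> {1..K}"
  shows "\<alpha> k k \<le> D_sum_TINA K \<alpha>"
proof -
  define d where "d j = (if j = k then \<alpha> k k else 0)" for j
  have nn: "0 \<le> \<alpha> j j" if "j \<in> {1..K}" for j using assms(1) that by (auto simp: SLS_def)
  have "(\<Sum>j\<in>set \<pi>. d j) \<le> Delta \<alpha> \<pi>" if "is_cycle K \<pi>" "set \<pi> \<subseteq> {k}" for \<pi>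
  proof -
    have \<pi>: "\<pi> \<noteq> []" "distinct \<pi>" using that by (auto simp: is_cycle_def)
    then have "set \<pi> = {k}" using that(2) by (cases \<pi>) auto
    moreover have "length \<pi> = 1" using \<pi> \<open>set \<pi> = {k}\<close> distinct_card[of \<pi>] by simp
    moreover have "\<pi> ! 0 = k" using calculation by (metis nth_mem singletonD zero_less_one)
    ultimately show ?thesis by (simp add: Delta_def d_def)
  qed
  then have "d \<in> D_PTIN K \<alpha> {k}"
    using nn[OF assms(2)] by (auto simp: D_PTIN_def d_def)
  then have "d \<in> D_TINA K \<alpha>" using assms(2) by (auto simp: D_TINA_def intro!: bexI[of _ "{k}"])
  \<comment> \<open>Boundedness makes the \<open>Sup\<close> an upper bound of its set; the
    one-element cycles bound every coordinate by its direct gain.\<close>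
  moreover have "bdd_above ((\<lambda>d. \<Sum>k\<in>{1..K}. d k) ` D_TINA K \<alpha>)"
  proof (rule bdd_aboveI2)
    fix d' assume "d' \<in> D_TINA K \<alpha>"
    then obtain S where S: "S \<subseteq> {1..K}" "d' \<in> D_PTIN K \<alpha> S" by (auto simp: D_TINA_def)
    show "(\<Sum>k\<in>{1..K}. d' k) \<le> (\<Sum>j\<in>{1..K}. \<alpha> j j)"
    proof (rule sum_mono)
      fix j assume j: "j \<in> {1..K}"
      show "d' j \<le> \<alpha> j j"
      proof (cases "j \<in> S")
        case True
        have "\<forall>\<pi>. is_cycle K \<pi> \<and> set \<pi> \<subseteq> S \<longrightarrow> (\<Sum>k\<in>set \<pi>. d' k) \<le> Delta \<alpha> \<pi>"
          using S(2) unfolding D_PTIN_def by blast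
        moreover have "is_cycle K [j] \<and> set [j] \<subseteq> S" using j True by (simp add: is_cycle_def)
        ultimately have "(\<Sum>k\<in>set [j]. d' k) \<le> Delta \<alpha> [j]" by blast
        then show ?thesis by (simp add: Delta_def)
      next
        case False
        then show ?thesis using S j nn[OF j] by (auto simp: D_PTIN_def)
      qed
    qed
  qed
  ultimately have "(\<Sum>j\<in>{1..K}. d j) \<le> D_sum_TINA K \<alpha>"
    unfolding D_sum_TINA_def by (intro cSup_upper) auto
  moreover have "(\<Sum>j\<in>{1..K}. d j) = \<alpha> k k" using assms(2) by (simp add: d_def)
  ultimately show ?thesis by simp
qed

theorem lemma7:
  fixes K :: nat and \<alpha> :: "nat \<Rightarrow> nat \<Rightarrow> real"
    and \<mu> :: "(nat \<times> nat \<times> nat \<Rightarrow> complex) measure"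
    and \<pi> :: "nat list" and d :: "nat \<Rightarrow> real"
  assumes "SLS K \<alpha>"
    and "admissible_channel K \<mu>"
    and "is_cycle K \<pi>"
    and "d \<in> gdof_region K \<alpha> \<mu>"
  shows "(\<forall>m<length \<pi>. (\<Sum>k\<in>set \<pi>. d k) \<le> Delta \<alpha> \<pi> + \<alpha> (\<pi>!((m+1) mod length \<pi>)) (\<pi>!m))
         \<and> (\<Sum>k\<in>set \<pi>. d k) \<le> Delta \<alpha> \<pi> + D_sum_TINA K \<alpha>"
proof -
  have \<pi>: "\<pi> \<noteq> []" "distinct \<pi>" "set \<pi> \<subseteq> {1..K}" using assms(3) by (auto simp: is_cycle_def)
  have mem: "\<pi> ! j \<in> {1..K}" if "j < length \<pi>" for j using \<pi>(3) that by (meson nth_mem subsetD)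
  have nn: "0 \<le> \<alpha> i j" if "i \<in> {1..K}" "j \<in> {1..K}" for i j
    using assms(1) that by (auto simp: SLS_def)
  have edge: "(\<Sum>k\<in>set \<pi>. d k) \<le> Delta \<alpha> \<pi> + \<alpha> (\<pi>!((m+1) mod length \<pi>)) (\<pi>!m)" if m: "m < length \<pi>" for m
  \<comment> \<open>A cycle of length 1 has no edge to open: its path bound is already
    \<open>Delta\<close>, and the added gain is non-negative.\<close>
  proof (cases "length \<pi> = 1")
    case True
    then obtain k where k: "\<pi> = [k]" by (metis One_nat_def length_0_conv length_Suc_conv)
    then have "d k \<le> \<alpha> k k"
      using gdof_path_bound[OF assms(1,2) \<pi>(2,3,1) assms(4)] by simp
    moreover have "0 \<le> \<alpha> k k" using nn \<pi>(3) k by simp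
    ultimately show ?thesis using m by (simp add: k Delta_def)
  next
    case False
    then have M: "2 \<le> length \<pi>" using m by linarith
    define us where "us = rotate (Suc m) \<pi>"
    have "(\<Sum>k\<in>set us. d k) \<le> (\<Sum>i<length us - 1. \<alpha> (us ! i) (us ! i) - \<alpha> (us ! Suc i) (us ! i)) + \<alpha> (last us) (last us)"
      using \<pi> by (intro gdof_path_bound[OF assms(1,2) _ _ _ assms(4)]) (auto simp: us_def)
    then show ?thesis unfolding Delta_rotate[OF \<pi>(2) M m us_def] by (simp add: us_def)
  qed
  \<comment> \<open>Any edge would do; the first one is taken. The SLS condition bounds its cross
    gain by the direct gain at the transmitter, and for a cycle of length 1 the two
    coincide.\<close>
  have "\<alpha> (\<pi>!((0+1) mod length \<pi>)) (\<pi>!0) \<le> \<alpha> (\<pi>!0) (\<pi>!0)"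
  proof (cases "\<pi>!((0+1) mod length \<pi>) = \<pi>!0")
    case False
    have "0 < length \<pi>" using \<pi>(1) by simp
    then have "\<pi>!((0+1) mod length \<pi>) \<in> {1..K}" "\<pi>!0 \<in> {1..K}"
      using mem mod_less_divisor by blast+
    then show ?thesis
      using assms(1) False unfolding SLS_def by (metis max.bounded_iff)
  qed simp
  also have "\<dots> \<le> D_sum_TINA K \<alpha>" using \<pi>(1) mem by (intro alpha_le_D_sum_TINA[OF assms(1)]) auto
  finally show ?thesis using edge edge[of 0] \<pi>(1) by force
qed

end
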